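(* Let $n\geq 2$, let $(z,w)\in\mathbb{C}^n\times\mathbb{C}$ be the coordinates and, near the origin, let $M\subset\mathbb{C}^{n+1}$ be a submanifold of real codimension 2 given by $$w=\rho(z,\bar z)=z^*Az+\overline{z^tBz}+z^tCz+E(z,\bar z),$$ where $\rho$ is real-analytic, $A,B,C$ are complex $n\times n$ matrices, $B$ and $C$ are symmetric, and $E$ is $O(\|z\|^3)$. If $M$ is a CR image, then the following hold. (a) $\operatorname{rank}\begin{bmatrix}A^*\\ B\end{bmatrix}\leq 1$. (b) Near the origin, $M$ is biholomorphically equivalent to exactly one of the following forms: (1) $w=\bar z_1z_2+\bar z_1^2+O(\|z\|^3)$, (2) $w=\bar z_1z_2+O(\|z\|^3)$, (3) $w=|z_1|^2+a\bar z_1^2+O(\|z\|^3)$, $a\geq 0$, (4) $w=\bar z_1^2+O(\|z\|^3)$, (5) $w=O(\|z\|^3)$. Furthermore, examples (of such CR images $M$) exist for all five cases.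
   Context: Vectors $z\in\mathbb{C}^n$ are columns; $z^t$ is the transpose, $z^*$ the conjugate transpose, and $A^*$ the conjugate transpose of $A$. $\begin{bmatrix} A^* \\ B\end{bmatrix}$ is the $2n\times n$ matrix obtained by stacking $A^*$ on top of $B$. $\rho$ is complex-valued. For a real submanifold $M\subset\mathbb{C}^{m}$ and $p\in M$, $T^{0,1}_pM$ is the intersection of $\mathbb{C}\otimes T_pM$ with the span of the antiholomorphic coordinate vectors $\partial/\partial\bar\zeta_j|_p$ of $\mathbb{C}^m$. $M_{\mathit{CR}}\subset M$ is the set of points near which $\dim_{\mathbb{C}}T^{0,1}_pM$ is constant as $p\in M$ varies. A real-analytic submanifold $M\subset\mathbb{C}^m$ is a CR image if there exists a real-analytic vector bundle $\mathcal{V}\subset\mathbb{C}\otimes TM$ over $M$ such that $\mathcal{V}_p=T^{0,1}_pM$ for all $p\in M_{\mathit{CR}}$. Biholomorphic equivalence near the origin is via a biholomorphic map between neighborhoods of the origin fixing the origin; "equivalent to the form (i)" means equivalent to some real-analytic submanifold of that form. *)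

theory Defs
  imports "HOL-Analysis.Analysis" "HOL-Library.Landau_Symbols"
begin

section \<open>Real-analytic maps and submanifolds\<close>

text \<open>Multi-indices are functions on the standard basis, extended by 0. The sum of the power
  series is unconditional, which is absolute convergence when the target is finite-dimensional.\<close>

definition real_analytic_on ::
  "('a::euclidean_space \<Rightarrow> 'b::real_normed_vector) \<Rightarrow> 'a set \<Rightarrow> bool" where
  "real_analytic_on f U \<longleftrightarrow>
     (\<forall>p\<in>U. \<exists>r>0. \<exists>c. \<forall>x\<in>ball p r.
        ((\<lambda>\<alpha>. (\<Prod>b\<in>Basis. ((x - p) \<bullet> b) ^ \<alpha> b) *\<^sub>R c \<alpha>) has_sum f x)
          {\<alpha>. \<forall>b. b \<notin> Basis \<longrightarrow> \<alpha> b = (0::nat)})"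

text \<open>Embedded submanifolds of dimension \<open>d\<close>, given by ambient real-analytic charts that
  straighten the set to a linear subspace.\<close>

definition real_analytic_submanifold :: "nat \<Rightarrow> ('a::euclidean_space) set \<Rightarrow> bool" where
  "real_analytic_submanifold d M \<longleftrightarrow>
     (\<forall>p\<in>M. \<exists>W (\<phi> :: 'a \<Rightarrow> 'a) \<psi> S.
        open W \<and> p \<in> W \<and> open (\<phi> ` W) \<and>
        real_analytic_on \<phi> W \<and> real_analytic_on \<psi> (\<phi> ` W) \<and> (\<forall>x\<in>W. \<psi> (\<phi> x) = x) \<and>
        subspace S \<and> dim S = d \<and> \<phi> ` (M \<inter> W) = S \<inter> \<phi> ` W)"

definition tangent_space :: "('a::real_normed_vector) set \<Rightarrow> 'a \<Rightarrow> 'a set" where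
  "tangent_space M p =
     {v. \<exists>\<gamma> :: real \<Rightarrow> 'a. \<gamma> 0 = p \<and> (\<forall>\<^sub>F t in nhds 0. \<gamma> t \<in> M) \<and>
           (\<gamma> has_vector_derivative v) (at 0)}"


section \<open>The CR structure of a submanifold of complex space\<close>

text \<open>The complexified tangent space of \<open>\<complex>\<^sup>m\<close> at a point is represented in the frame
  \<open>\<partial>/\<partial>\<zeta>\<^sub>j\<close> (index \<open>Inl j\<close>), \<open>\<partial>/\<partial>\<zeta>\<^sub>j\<close>-bar (index \<open>Inr j\<close>). The real tangent vector
  \<open>v \<in> \<complex>\<^sup>m = \<real>\<^sup>2\<^sup>m\<close>, i.e. the sum of \<open>Re v\<^sub>j \<partial>/\<partial>x\<^sub>j + Im v\<^sub>j \<partial>/\<partial>y\<^sub>j\<close> where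
  \<open>\<zeta>\<^sub>j = x\<^sub>j + i y\<^sub>j\<close>, has the coordinates \<open>v\<^sub>j\<close> at \<open>Inl j\<close> and \<open>cnj v\<^sub>j\<close> at \<open>Inr j\<close>.
  The operations \<open>vec.span\<close> and \<open>vec.dim\<close> are the complex ones.\<close>

definition real_tangent_vector :: "complex ^ 'm \<Rightarrow> complex ^ ('m + 'm)" where
  "real_tangent_vector v = (\<chi> k. case k of Inl j \<Rightarrow> v $ j | Inr j \<Rightarrow> cnj (v $ j))"

definition complexified_tangent_space ::
  "(complex ^ 'm) set \<Rightarrow> complex ^ 'm \<Rightarrow> (complex ^ ('m + 'm)) set" where
  "complexified_tangent_space M p = vec.span (real_tangent_vector ` tangent_space M p)"

definition T01 :: "(complex ^ 'm) set \<Rightarrow> complex ^ 'm \<Rightarrow> (complex ^ ('m + 'm)) set" where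
  "T01 M p = complexified_tangent_space M p \<inter> vec.span (range (\<lambda>j. axis (Inr j) 1))"

definition CR_points :: "(complex ^ 'm) set \<Rightarrow> (complex ^ 'm) set" where
  "CR_points M =
     {p \<in> M. \<exists>W. open W \<and> p \<in> W \<and> (\<forall>q\<in>M \<inter> W. vec.dim (T01 M q) = vec.dim (T01 M p))}"

text \<open>A real-analytic subbundle of the complexified tangent bundle, given by local frames. As usual,
  real-analytic functions on a submanifold are the local restrictions of ambient ones.
  The rank may differ between components of \<open>M\<close>.\<close>

definition real_analytic_subbundle ::
  "(complex ^ 'm) set \<Rightarrow> (complex ^ 'm \<Rightarrow> (complex ^ ('m + 'm)) set) \<Rightarrow> bool" where
  "real_analytic_subbundle M V \<longleftrightarrow>
     (\<forall>p\<in>M. V p \<subseteq> complexified_tangent_space M p) \<and>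
     (\<forall>p\<in>M. \<exists>W k. \<exists>s :: nat \<Rightarrow> complex ^ 'm \<Rightarrow> complex ^ ('m + 'm).
        open W \<and> p \<in> W \<and> (\<forall>i<k. real_analytic_on (s i) W) \<and>
        (\<forall>q\<in>M \<inter> W. inj_on (\<lambda>i. s i q) {..<k} \<and>
                   vec.independent ((\<lambda>i. s i q) ` {..<k}) \<and>
                   V q = vec.span ((\<lambda>i. s i q) ` {..<k})))"

definition CR_image :: "(complex ^ 'm) set \<Rightarrow> bool" where
  "CR_image M \<longleftrightarrow>
     (\<exists>d. real_analytic_submanifold d M) \<and>
     (\<exists>V. real_analytic_subbundle M V \<and> (\<forall>p\<in>CR_points M. V p = T01 M p))"


section \<open>Biholomorphic equivalence near the origin\<close>

definition holomorphic_map_on :: "(complex ^ 'm \<Rightarrow> complex ^ 'k) \<Rightarrow> (complex ^ 'm) set \<Rightarrow> bool" where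
  "holomorphic_map_on F U \<longleftrightarrow>
     (\<forall>x\<in>U. \<exists>D. (F has_derivative D) (at x) \<and> (\<forall>c v. D (c *s v) = c *s D v))"

definition biholomorphic_near_0 :: "(complex ^ 'm) set \<Rightarrow> (complex ^ 'm) set \<Rightarrow> bool" where
  "biholomorphic_near_0 M M' \<longleftrightarrow>
     (\<exists>U U' F G. open U \<and> open U' \<and> 0 \<in> U \<and> 0 \<in> U' \<and>
        holomorphic_map_on F U \<and> holomorphic_map_on G U' \<and>
        F ` U = U' \<and> (\<forall>x\<in>U. G (F x) = x) \<and> F 0 = 0 \<and> F ` (M \<inter> U) = M' \<inter> U')"


section \<open>Graphs of codimension two and the model forms\<close>

text \<open>\<open>\<complex>\<^sup>n \<times> \<complex>\<close> with coordinates \<open>(z, w)\<close> is \<open>complex ^ 'n option\<close>: the coordinate \<open>z\<^sub>j\<close> has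
  index \<open>Some j\<close> and \<open>w\<close> has index \<open>None\<close>.\<close>

definition z_part :: "complex ^ ('n::finite) option \<Rightarrow> complex ^ 'n" where
  "z_part \<zeta> = (\<chi> j. \<zeta> $ Some j)"

definition w_part :: "complex ^ ('n::finite) option \<Rightarrow> complex" where
  "w_part \<zeta> = \<zeta> $ None"

text \<open>\<open>M\<close> is a submanifold of real codimension 2 that near the origin is given by
  \<open>w = \<rho>(z)\<close> (the dependence on the conjugate of \<open>z\<close> being implicit), \<open>\<rho>\<close> real-analytic near 0.\<close>

definition graph_near_0 :: "(complex ^ ('n::finite) option) set \<Rightarrow> (complex ^ 'n \<Rightarrow> complex) \<Rightarrow> bool" where
  "graph_near_0 M \<rho> \<longleftrightarrow>
     real_analytic_submanifold (2 * CARD('n)) M \<and>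
     (\<exists>U. open U \<and> 0 \<in> U \<and> real_analytic_on \<rho> U) \<and>
     (\<exists>W. open W \<and> 0 \<in> W \<and> M \<inter> W = {\<zeta> \<in> W. w_part \<zeta> = \<rho> (z_part \<zeta>)})"

text \<open>Since the filter is \<open>nhds 0\<close> and not \<open>at 0\<close>, this includes \<open>E 0 = 0\<close>.\<close>

definition O3 :: "(complex ^ 'n \<Rightarrow> complex) \<Rightarrow> bool" where
  "O3 E \<longleftrightarrow> E \<in> O[nhds 0](\<lambda>z. of_real (norm z ^ 3))"

definition conj_transpose :: "complex ^ 'n ^ 'm \<Rightarrow> complex ^ 'm ^ 'n" where
  "conj_transpose A = (\<chi> i j. cnj (A $ j $ i))"

definition stack :: "complex ^ 'n ^ 'k \<Rightarrow> complex ^ 'n ^ 'm \<Rightarrow> complex ^ 'n ^ ('k + 'm)" where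
  "stack A B = (\<chi> r. case r of Inl i \<Rightarrow> A $ i | Inr i \<Rightarrow> B $ i)"

definition sesquilinear_form :: "complex ^ 'n ^ 'n \<Rightarrow> complex ^ 'n \<Rightarrow> complex" where
  "sesquilinear_form A z = (\<Sum>i\<in>UNIV. \<Sum>j\<in>UNIV. cnj (z $ i) * A $ i $ j * z $ j)"

definition quadratic_form :: "complex ^ 'n ^ 'n \<Rightarrow> complex ^ 'n \<Rightarrow> complex" where
  "quadratic_form B z = (\<Sum>i\<in>UNIV. \<Sum>j\<in>UNIV. z $ i * B $ i $ j * z $ j)"

datatype model = Form1 | Form2 | Form3 real | Form4 | Form5

definition models :: "model set" where
  "models = {Form1, Form2, Form4, Form5} \<union> {Form3 a |a. a \<ge> 0}"

text \<open>\<open>i1\<close> and \<open>i2\<close> are the labels of the coordinates \<open>z\<^sub>1\<close> and \<open>z\<^sub>2\<close>.\<close>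

fun model_quadric :: "('n::finite) \<Rightarrow> 'n \<Rightarrow> model \<Rightarrow> complex ^ 'n \<Rightarrow> complex" where
  "model_quadric i1 i2 Form1 z = cnj (z $ i1) * z $ i2 + cnj (z $ i1) ^ 2"
| "model_quadric i1 i2 Form2 z = cnj (z $ i1) * z $ i2"
| "model_quadric i1 i2 (Form3 a) z = of_real (cmod (z $ i1) ^ 2) + of_real a * cnj (z $ i1) ^ 2"
| "model_quadric i1 i2 Form4 z = cnj (z $ i1) ^ 2"
| "model_quadric i1 i2 Form5 z = 0"

definition has_form :: "('n::finite) \<Rightarrow> 'n \<Rightarrow> model \<Rightarrow> (complex ^ 'n option) set \<Rightarrow> bool" where
  "has_form i1 i2 f M \<longleftrightarrow>
     (\<exists>\<rho>. graph_near_0 M \<rho> \<and> O3 (\<lambda>z. \<rho> z - model_quadric i1 i2 f z))"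

end

theory Submission
  imports Defs "HOL-Complex_Analysis.Conformal_Mappings"
begin

text \<open>At a point of \<open>M\<close> the space of (0,1) vectors is the kernel of the antiholomorphic gradient
  \<open>b\<close> of \<open>\<rho>\<close>. To first order \<open>b\<close> is \<open>L z = A z + 2 cnj (B z)\<close>, so if \<open>L z \<noteq> 0\<close> the points over \<open>t z\<close>
  are CR points of the minimal dimension \<open>n - 1\<close>; dividing the annihilation relation for the frame of
  the given bundle by \<open>t\<close> and letting \<open>t \<rightarrow> 0\<close> gives an \<open>(n - 1)\<close>-dimensional space that annihilates
  \<open>L z\<close> for every \<open>z\<close>, which is the rank condition. It makes the quadratic part
  \<open>cnj (l z) m(z) + b cnj (l z)\<^sup>2\<close> up to a holomorphic polynomial, and a linear change of \<open>z\<close> and a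
  shear in \<open>w\<close> produce one of the models. Conversely a biholomorphism can only change the quadratic
  part linearly, up to a holomorphic quadratic polynomial, so the mixed and antiholomorphic parts
  separate the models.\<close>

section \<open>Real-analytic functions\<close>

text \<open>When \<open>L\<close> is not identically zero, the origin is not a CR point: the
  gradient vanishes there, so the (0,1) space has the full dimension n and exceeds the fibre of the
  bundle. The fibre at 0 is known only as a limit, but as one and the same limit along every ray,
  and this common space of dimension n - 1 is what forces rank one. \<open>L\<close> is merely real
  linear; comparing \<open>z\<close> with \<open>\<i> z\<close> separates \<open>A\<close> from
  \<open>B\<close>. For uniqueness the obstacle is that a biholomorphism is given by its
  complex-linear first derivatives alone. Second-order information is drawn from holomorphic
  functions of one variable: the Schwarz lemma in the w-direction, and a removable singularity on
  each complex line in z-space. The latter leaves an unknown term \<open>c u\<^sup>2\<close> on the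
  circle \<open>norm u = 1\<close> of each line. There mixed, antiholomorphic and holomorphic
  quadratic terms have the weights 0, -2 and 2 in u, and so can be told apart without knowing that
  the unknown term is a polynomial in z.\<close>

definition monomial :: "'a::euclidean_space \<Rightarrow> 'a list \<Rightarrow> real" where
  "monomial h xs = (\<Prod>b\<leftarrow>xs. h \<bullet> b)"

lemma monomial_simps [simp]:
  "monomial h [] = 1" "monomial h (b # xs) = (h \<bullet> b) * monomial h xs"
  "monomial h (xs @ ys) = monomial h xs * monomial h ys"
  by (simp_all add: monomial_def)

lemma monomial_eq_prod_count:
  assumes "set xs \<subseteq> Basis"
  shows "monomial h xs = (\<Prod>b\<in>Basis. (h \<bullet> b) ^ count_list xs b)"
  using assms
proof (induction xs)
  case Nil
  then show ?case by simp
next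
  case (Cons a xs)
  have "(\<Prod>b\<in>Basis. (h \<bullet> b) ^ count_list (a # xs) b)
      = (\<Prod>b\<in>Basis. (if b = a then h \<bullet> b else 1) * (h \<bullet> b) ^ count_list xs b)"
    by (intro prod.cong) auto
  also have "\<dots> = (h \<bullet> a) * (\<Prod>b\<in>Basis. (h \<bullet> b) ^ count_list xs b)"
    using Cons.prems by (simp add: prod.distrib prod.delta)
  finally show ?case using Cons by simp
qed

lemma abs_monomial_le:
  assumes "set xs \<subseteq> Basis" "norm h \<le> s"
  shows "\<bar>monomial h xs\<bar> \<le> s ^ length xs"
  using assms(1)
proof (induction xs)
  case (Cons a xs)
  then have "\<bar>h \<bullet> a\<bar> \<le> s"
    using Basis_le_norm[of a h] assms(2) by simp
  then show ?case using Cons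
    by (simp add: abs_mult mult_mono)
qed simp

text \<open>Power series indexed by words in the basis instead of multi-indices: products and linear
  substitutions then expand without multinomial coefficients. The index set is arbitrary, so that
  several terms may share the same word.\<close>

definition word_expansion ::
  "('a::euclidean_space \<Rightarrow> complex) \<Rightarrow> 'a \<Rightarrow> real \<Rightarrow> 'i set \<Rightarrow> ('i \<Rightarrow> 'a list) \<Rightarrow> ('i \<Rightarrow> complex) \<Rightarrow> bool"
  where
  "word_expansion f p s I w d \<longleftrightarrow>
     0 < s \<and> (\<forall>i\<in>I. set (w i) \<subseteq> Basis) \<and> (\<lambda>i. s ^ length (w i) * norm (d i)) summable_on I \<and>
     (\<forall>h. norm h \<le> s \<longrightarrow> ((\<lambda>i. monomial h (w i) *\<^sub>R d i) has_sum f (p + h)) I)"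

text \<open>One evaluation gives the absolute convergence: at the point whose coordinates all exceed
  those of \<open>p\<close> by \<open>s\<close>, each monomial is \<open>s\<close> to the power of
  its degree, and unconditional sums in \<complex> are absolute.\<close>

lemma word_expansion_exists:
  fixes f :: "'a::euclidean_space \<Rightarrow> complex"
  assumes "real_analytic_on f U" "p \<in> U"
  obtains s and I :: "('a \<Rightarrow> nat) set" and w d where "word_expansion f p s I w d"
proof -
  define I where "I = {\<alpha>::'a \<Rightarrow> nat. \<forall>b. b \<notin> Basis \<longrightarrow> \<alpha> b = 0}"
  obtain r c where r: "r > 0" and
    sums: "\<And>x. x \<in> ball p r \<Longrightarrow> ((\<lambda>\<alpha>. (\<Prod>b\<in>Basis. ((x - p) \<bullet> b) ^ \<alpha> b) *\<^sub>R c \<alpha>) has_sum f x) I"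
    using assms unfolding real_analytic_on_def I_def by blast
  obtain bs :: "'a list" where bs: "set bs = Basis" "distinct bs"
    using finite_distinct_list[OF finite_Basis] by blast
  define w where "w \<alpha> = concat (map (\<lambda>b. replicate (\<alpha> b) b) bs)" for \<alpha> :: "'a \<Rightarrow> nat"
  have w_Basis: "set (w \<alpha>) \<subseteq> Basis" for \<alpha>
  proof -
    have "set (w \<alpha>) \<subseteq> set bs" unfolding w_def by auto
    with bs show ?thesis by metis
  qed
  have mon: "monomial h (w \<alpha>) = (\<Prod>b\<in>Basis. (h \<bullet> b) ^ \<alpha> b)" for h \<alpha>
  proof -
    have "monomial h (concat (map (\<lambda>b. replicate (\<alpha> b) b) xs)) = (\<Prod>b\<leftarrow>xs. (h \<bullet> b) ^ \<alpha> b)" for xs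
    proof (induction xs)
      case (Cons a xs)
      have "monomial h (replicate n a) = (h \<bullet> a) ^ n" for n
        by (induction n) auto
      with Cons show ?case by simp
    qed simp
    then show ?thesis
      by (simp add: w_def prod.distinct_set_conv_list[OF bs(2), symmetric] bs(1))
  qed
  have len: "s ^ length (w \<alpha>) = (\<Prod>b\<in>Basis. s ^ \<alpha> b)" for s :: real and \<alpha>
  proof -
    have "s ^ length (concat (map (\<lambda>b. replicate (\<alpha> b) b) xs)) = (\<Prod>b\<leftarrow>xs. s ^ \<alpha> b)" for xs
      by (induction xs) (auto simp: power_add)
    then show ?thesis
      by (simp add: w_def prod.distinct_set_conv_list[OF bs(2), symmetric] bs(1))
  qed
  \<comment> \<open>The corner \<open>x\<close> below is at distance at most
    \<open>DIM('a) * s\<close> from \<open>p\<close>, which this choice keeps below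
    \<open>r\<close>.\<close>
  define s where "s = r / (2 * (DIM('a) + 1))"
  have s: "s > 0" using r by (simp add: s_def)
  have "s \<le> r / 2"
    using r unfolding s_def by (intro divide_left_mono) auto
  then have sr: "s < r" using r by simp
  define x where "x = p + (\<Sum>b\<in>Basis. s *\<^sub>R b)"
  have "norm (x - p) \<le> (\<Sum>b\<in>(Basis::'a set). s)"
    unfolding x_def using s by (simp add: sum_norm_le del: sum_constant)
  also have "\<dots> < r"
    using r by (simp add: s_def divide_simps)
  finally have "x \<in> ball p r" by (simp add: dist_norm norm_minus_commute)
  moreover have "(x - p) \<bullet> b = s" if "b \<in> Basis" for b
    using that by (simp add: x_def inner_sum_left inner_Basis if_distrib sum.delta cong: if_cong)
  ultimately have "(\<lambda>\<alpha>. (\<Prod>b\<in>Basis. s ^ \<alpha> b) *\<^sub>R c \<alpha>) summable_on I"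
    using sums[of x] by (auto simp: summable_on_def cong: prod.cong)
  then have "(\<lambda>\<alpha>. norm ((\<Prod>b\<in>Basis. s ^ \<alpha> b) *\<^sub>R c \<alpha>)) summable_on I"
    by (simp only: summable_on_iff_abs_summable_on_complex)
  then have "(\<lambda>\<alpha>. s ^ length (w \<alpha>) * norm (c \<alpha>)) summable_on I"
    using s by (simp add: len prod_nonneg abs_prod)
  moreover have "((\<lambda>\<alpha>. monomial h (w \<alpha>) *\<^sub>R c \<alpha>) has_sum f (p + h)) I" if "norm h \<le> s" for h
    using sums[of "p + h"] sr that by (simp add: mon dist_norm)
  ultimately have "word_expansion f p s I w c"
    using s w_Basis by (simp add: word_expansion_def)
  then show ?thesis by (rule that)
qed

text \<open>Words with the same letter counts give the same monomial, so the multi-index coefficient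
  is the sum over all indices whose word has these counts.\<close>

lemma real_analytic_onI_word_expansion:
  fixes f :: "'a::euclidean_space \<Rightarrow> complex"
  assumes "\<And>p. p \<in> U \<Longrightarrow> \<exists>s (I :: 'i set) w d. word_expansion f p s I w d"
  shows "real_analytic_on f U"
  unfolding real_analytic_on_def
proof
  fix p assume "p \<in> U"
  then obtain s w d and I :: "'i set" where "word_expansion f p s I w d"
    using assms by blast
  then have s: "s > 0" and wB: "\<And>i. i \<in> I \<Longrightarrow> set (w i) \<subseteq> Basis"
    and summ: "(\<lambda>i. s ^ length (w i) * norm (d i)) summable_on I"
    and sums: "\<And>h. norm h \<le> s \<Longrightarrow> ((\<lambda>i. monomial h (w i) *\<^sub>R d i) has_sum f (p + h)) I"
    by (auto simp: word_expansion_def)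
  define A where "A = {\<alpha>::'a \<Rightarrow> nat. \<forall>b. b \<notin> Basis \<longrightarrow> \<alpha> b = 0}"
  define fiber where "fiber \<alpha> = {i \<in> I. count_list (w i) = \<alpha>}" for \<alpha>
  define c where "c \<alpha> = infsum d (fiber \<alpha>)" for \<alpha>
  have outside: "b \<notin> set (w i)" if "i \<in> I" "b \<notin> Basis" for i b
    using wB[OF that(1)] that(2) by auto
  have d_summable: "d summable_on fiber \<alpha>" for \<alpha>
  proof -
    \<comment> \<open>The weight \<open>s ^ length (w i)\<close> is constant on a fibre and can be
      divided out, which leaves absolute summability of \<open>d\<close>.\<close>
    have len: "length (w i) = sum \<alpha> Basis" if "i \<in> fiber \<alpha>" for i
    proof -
      have "length (w i) = sum (count_list (w i)) (set (w i))" by (simp add: sum_count_set)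
      also have "\<dots> = sum \<alpha> Basis"
        using that wB by (intro sum.mono_neutral_cong_left) (auto simp: fiber_def count_list_0_iff)
      finally show ?thesis .
    qed
    have "(\<lambda>i. s ^ length (w i) * norm (d i)) summable_on fiber \<alpha>"
      by (rule summable_on_subset_banach[OF summ]) (auto simp: fiber_def)
    then have "(\<lambda>i. s ^ sum \<alpha> Basis * norm (d i)) summable_on fiber \<alpha>"
      by (rule summable_on_cong[THEN iffD1, rotated]) (simp add: len)
    then have "(\<lambda>i. norm (d i)) summable_on fiber \<alpha>"
      using s by (simp add: summable_on_cmult_right')
    then show ?thesis by (rule abs_summable_summable)
  qed
  have "((\<lambda>\<alpha>. (\<Prod>b\<in>Basis. ((x - p) \<bullet> b) ^ \<alpha> b) *\<^sub>R c \<alpha>) has_sum f x) A" if x: "x \<in> ball p s" for x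
  proof (rule has_sum_SigmaD)
    define h where "h = x - p"
    \<comment> \<open>Tagging each index with its letter counts turns \<open>I\<close> into the
      disjoint union of the fibres, so the sum can be taken fibre by fibre.\<close>
    let ?g = "\<lambda>i. (count_list (w i), i)"
    have "bij_betw ?g I (Sigma A fiber)"
      by (intro bij_betwI[where g = snd]) (auto simp: A_def fiber_def outside count_list_0_iff)
    moreover have "((\<lambda>i. monomial h (w i) *\<^sub>R d i) has_sum f x) I"
      using sums[of h] x by (simp add: h_def dist_norm norm_minus_commute)
    ultimately show "((\<lambda>(\<alpha>, i). monomial h (w i) *\<^sub>R d i) has_sum f x) (Sigma A fiber)"
      by (subst has_sum_reindex_bij_betw[symmetric]) auto
    fix \<alpha> assume "\<alpha> \<in> A"
    have "((\<lambda>i. (\<Prod>b\<in>Basis. (h \<bullet> b) ^ \<alpha> b) *\<^sub>R d i) has_sum (\<Prod>b\<in>Basis. (h \<bullet> b) ^ \<alpha> b) *\<^sub>R c \<alpha>) (fiber \<alpha>)"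
      unfolding c_def by (intro has_sum_scaleR has_sum_infsum d_summable)
    then show "((\<lambda>i. case (\<alpha>, i) of (\<alpha>, i) \<Rightarrow> monomial h (w i) *\<^sub>R d i) has_sum
                 (\<Prod>b\<in>Basis. ((x - p) \<bullet> b) ^ \<alpha> b) *\<^sub>R c \<alpha>) (fiber \<alpha>)"
      unfolding h_def[symmetric]
      by (rule has_sum_cong[THEN iffD1, rotated])
         (use wB in \<open>auto simp: monomial_eq_prod_count fiber_def\<close>)
  qed
  with s show "\<exists>r>0. \<exists>c. \<forall>x\<in>ball p r.
      ((\<lambda>\<alpha>. (\<Prod>b\<in>Basis. ((x - p) \<bullet> b) ^ \<alpha> b) *\<^sub>R c \<alpha>) has_sum f x) {\<alpha>. \<forall>b. b \<notin> Basis \<longrightarrow> \<alpha> b = (0::nat)}"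
    unfolding A_def by blast
qed

lemma word_expansion_shrink:
  assumes "word_expansion f p s I w d" "0 < t" "t \<le> s"
  shows "word_expansion f p t I w d"
proof -
  have "(\<lambda>i. t ^ length (w i) * norm (d i)) summable_on I"
    by (rule summable_on_comparison_test[where f = "\<lambda>i. s ^ length (w i) * norm (d i)"])
       (use assms in \<open>auto simp: word_expansion_def intro!: mult_right_mono power_mono\<close>)
  then show ?thesis
    using assms by (auto simp: word_expansion_def)
qed

lemma word_expansion_mult:
  assumes f: "word_expansion f p s I w d" and g: "word_expansion g p s J w' d'"
  shows "word_expansion (\<lambda>x. f x * g x) p s (I \<times> J) (\<lambda>(i, j). w i @ w' j) (\<lambda>(i, j). d i * d' j)"
proof -
  from f g have s: "s > 0" by (simp add: word_expansion_def)
  let ?a = "\<lambda>i. s ^ length (w i) * norm (d i)" and ?b = "\<lambda>j. s ^ length (w' j) * norm (d' j)"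
  have a: "?a summable_on I" and b: "?b summable_on J"
    using f g by (auto simp: word_expansion_def)
  \<comment> \<open>This double series of absolute values dominates the product series at every
    \<open>h\<close> with \<open>norm h \<le> s\<close>.\<close>
  have summ: "(\<lambda>(i, j). ?a i * ?b j) summable_on I \<times> J"
  proof (rule abs_summable_summable, rule Infinite_Sum.abs_summable_on_Sigma_iff[THEN iffD2], intro conjI ballI)
    show "(\<lambda>j. norm (case (i, j) of (i, j) \<Rightarrow> ?a i * ?b j)) summable_on J" for i
      using s summable_on_cmult_right[OF b, of "?a i"] by (simp add: abs_mult)
    show "(\<lambda>i. norm (\<Sum>\<^sub>\<infinity>j\<in>J. norm (case (i, j) of (i, j) \<Rightarrow> ?a i * ?b j))) summable_on I"
      using s summable_on_cmult_left[OF a, of "infsum ?b J"]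
      by (simp add: abs_mult infsum_cmult_right' infsum_nonneg)
  qed
  have "((\<lambda>(i, j). monomial h (w i @ w' j) *\<^sub>R (d i * d' j)) has_sum (f (p + h) * g (p + h))) (I \<times> J)"
    if h: "norm h \<le> s" for h
  proof (rule has_sum_SigmaI)
    have F: "((\<lambda>i. monomial h (w i) *\<^sub>R d i) has_sum f (p + h)) I"
      and G: "((\<lambda>j. monomial h (w' j) *\<^sub>R d' j) has_sum g (p + h)) J"
      using f g h by (auto simp: word_expansion_def)
    show "((\<lambda>y. case (i, y) of (i, j) \<Rightarrow> monomial h (w i @ w' j) *\<^sub>R (d i * d' j)) has_sum
        (monomial h (w i) *\<^sub>R d i) * g (p + h)) J" for i
      using has_sum_cmult_right[OF G, of "monomial h (w i) *\<^sub>R d i"] by (simp add: mult_ac)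
    show "((\<lambda>i. monomial h (w i) *\<^sub>R d i * g (p + h)) has_sum f (p + h) * g (p + h)) I"
      by (rule has_sum_cmult_left[OF F])
    have "norm (monomial h (w i @ w' j) *\<^sub>R (d i * d' j)) \<le> ?a i * ?b j" if "i \<in> I" "j \<in> J" for i j
    proof -
      have "\<bar>monomial h (w i)\<bar> \<le> s ^ length (w i)" "\<bar>monomial h (w' j)\<bar> \<le> s ^ length (w' j)"
        using f g that h by (auto simp: word_expansion_def intro!: abs_monomial_le)
      then have "\<bar>monomial h (w i)\<bar> * \<bar>monomial h (w' j)\<bar> * (norm (d i) * norm (d' j))
          \<le> s ^ length (w i) * s ^ length (w' j) * (norm (d i) * norm (d' j))"
        using s by (intro mult_right_mono mult_mono) auto
      then show ?thesis by (simp add: norm_mult abs_mult mult_ac)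
    qed
    then have "(\<lambda>x. norm (case x of (i, j) \<Rightarrow> monomial h (w i @ w' j) *\<^sub>R (d i * d' j))) summable_on I \<times> J"
      by (intro summable_on_comparison_test[OF summ]) auto
    then show "(\<lambda>(i, j). monomial h (w i @ w' j) *\<^sub>R (d i * d' j)) summable_on I \<times> J"
      by (rule abs_summable_summable)
  qed
  moreover have "(\<lambda>(i, j). s ^ length (w i @ w' j) * norm (d i * d' j)) summable_on I \<times> J"
    using summ by (simp add: power_add norm_mult mult_ac)
  ultimately show ?thesis
    using f g by (auto simp: word_expansion_def case_prod_unfold)
qed

text \<open>The distributive law: picking one summand in each factor is picking a word. It expands
  the coordinates of \<open>L h\<close> in those of \<open>h\<close>.\<close>

lemma sum_words_eq_prod:
  fixes g :: "'b \<Rightarrow> 'c \<Rightarrow> real"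
  assumes "finite B"
  shows "(\<Sum>ys | set ys \<subseteq> B \<and> length ys = length xs. \<Prod>(x, y)\<leftarrow>zip xs ys. g x y) = (\<Prod>x\<leftarrow>xs. \<Sum>y\<in>B. g x y)"
proof (induction xs)
  case Nil
  have "{ys. set ys \<subseteq> B \<and> length ys = length []} = {[]}" by auto
  then show ?case by simp
next
  case (Cons a xs)
  let ?W = "{ys. set ys \<subseteq> B \<and> length ys = length xs}"
  have "{ys. set ys \<subseteq> B \<and> length ys = length (a # xs)} = (\<lambda>(y, ys). y # ys) ` (B \<times> ?W)"
    by (auto simp: length_Suc_conv image_iff)
  moreover have "inj_on (\<lambda>(y, ys). y # ys) (B \<times> ?W)"
    by (auto simp: inj_on_def)
  ultimately have "(\<Sum>ys | set ys \<subseteq> B \<and> length ys = length (a # xs). \<Prod>(x, y)\<leftarrow>zip (a # xs) ys. g x y)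
      = (\<Sum>(y, ys)\<in>B \<times> ?W. g a y * (\<Prod>(x, y)\<leftarrow>zip xs ys. g x y))"
    by (simp add: sum.reindex case_prod_unfold)
  also have "\<dots> = (\<Sum>y\<in>B. g a y) * (\<Sum>ys\<in>?W. \<Prod>(x, y)\<leftarrow>zip xs ys. g x y)"
    by (simp add: sum_product sum.cartesian_product)
  finally show ?case using Cons by simp
qed

text \<open>Each letter \<open>b\<close> is replaced by the linear form
  \<open>h \<mapsto> L h \<bullet> b\<close>, a finite sum over the basis. Every word thus expands
  into finitely many words of the same length, and only the outer sum is infinite.\<close>

lemma word_expansion_compose_linear:
  fixes L :: "'a::euclidean_space \<Rightarrow> 'b::euclidean_space"
  assumes f: "word_expansion f (L q) s I w d" and L: "linear L"
  obtains t w' d' where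
    "word_expansion (\<lambda>x. f (L x)) q t (SIGMA i:I. {ys :: 'a list. set ys \<subseteq> Basis \<and> length ys = length (w i)}) w' d'"
proof -
  from f have s: "s > 0" and summ: "(\<lambda>i. s ^ length (w i) * norm (d i)) summable_on I"
    by (auto simp: word_expansion_def)
  \<comment> \<open>A bound for the norm of \<open>L\<close>; the \<open>1\<close> keeps it positive
    for \<open>L = 0\<close>. With \<open>t = s / K\<close> both \<open>L h\<close> and the sums of
    absolute values in \<open>row\<close> stay within \<open>s\<close>.\<close>
  define K where "K = (\<Sum>b\<in>(Basis::'a set). norm (L b)) + 1"
  have K: "K > 0" by (simp add: K_def sum_nonneg add_nonneg_pos)
  define t where "t = s / K"
  have t: "t > 0" using s K by (simp add: t_def)
  have row: "(\<Sum>y\<in>Basis. t * \<bar>L y \<bullet> b\<bar>) \<le> s" if "b \<in> Basis" for b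
  proof -
    have "(\<Sum>y\<in>Basis. \<bar>L y \<bullet> b\<bar>) \<le> K"
      unfolding K_def using that by (smt (verit) Basis_le_norm sum_mono)
    then have "t * (\<Sum>y\<in>Basis. \<bar>L y \<bullet> b\<bar>) \<le> t * K" using t by (intro mult_left_mono) auto
    then show ?thesis using K by (simp add: sum_distrib_left t_def)
  qed
  have Lh: "norm (L h) \<le> s" if "norm h \<le> t" for h
  proof -
    have "L h = (\<Sum>y\<in>Basis. (h \<bullet> y) *\<^sub>R L y)"
      using L by (metis (no_types, lifting) euclidean_representation linear_scale linear_sum sum.cong)
    also have "norm \<dots> \<le> (\<Sum>y\<in>Basis. t * norm (L y))"
      proof (intro sum_norm_le)
      fix y :: 'a assume "y \<in> Basis"
      then have "\<bar>h \<bullet> y\<bar> \<le> t" using Basis_le_norm[of y h] that by simp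
      then show "norm ((h \<bullet> y) *\<^sub>R L y) \<le> t * norm (L y)" by (simp add: mult_right_mono)
    qed
    also have "\<dots> \<le> t * K" unfolding sum_distrib_left[symmetric] K_def using t by simp
    finally show ?thesis using K by (simp add: t_def)
  qed
  let ?W = "\<lambda>i. {ys :: 'a list. set ys \<subseteq> Basis \<and> length ys = length (w i)}"
  let ?c = "\<lambda>i ys. \<Prod>(b, y)\<leftarrow>zip (w i) ys. L y \<bullet> b"
  have finW: "finite (?W i)" for i
    by (rule finite_lists_length_eq) simp
  have expand: "(\<Sum>ys\<in>?W i. (\<Prod>y\<leftarrow>ys. e y) * (\<Prod>(b, y)\<leftarrow>zip (w i) ys. g b y))
      = (\<Prod>b\<leftarrow>w i. \<Sum>y\<in>Basis. e y * g b y)" for i and e :: "'a \<Rightarrow> real" and g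
  proof -
    have "(\<Prod>y\<leftarrow>ys. e y) * (\<Prod>(b, y)\<leftarrow>zip xs ys. g b y) = (\<Prod>(b, y)\<leftarrow>zip xs ys. e y * g b y)"
      if "length ys = length xs" for ys and xs :: "'b list"
      using that by (induction ys xs rule: list_induct2) auto
    then show ?thesis
      by (subst sum_words_eq_prod[symmetric]) (auto intro!: sum.cong)
  qed
  have "word_expansion (\<lambda>x. f (L x)) q t (Sigma I ?W) snd (\<lambda>(i, ys). ?c i ys *\<^sub>R d i)"
    unfolding word_expansion_def
  proof (intro conjI allI impI)
    show "0 < t" by fact
    show "\<forall>x\<in>Sigma I ?W. set (snd x) \<subseteq> Basis" by auto
    have row_prod: "(\<Prod>b\<leftarrow>w i. \<Sum>y\<in>Basis. t * \<bar>L y \<bullet> b\<bar>) \<le> s ^ length (w i)" if "i \<in> I" for i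
    proof -
      have "0 \<le> (\<Prod>b\<leftarrow>xs. \<Sum>y\<in>Basis. t * \<bar>L y \<bullet> b\<bar>) \<and>
          (\<Prod>b\<leftarrow>xs. \<Sum>y\<in>Basis. t * \<bar>L y \<bullet> b\<bar>) \<le> s ^ length xs" if "set xs \<subseteq> Basis" for xs :: "'b list"
        using that
      proof (induction xs)
        case (Cons a xs)
        then show ?case
          using s t row[of a] by (auto intro!: mult_mono mult_nonneg_nonneg sum_nonneg)
      qed simp
      with f that show ?thesis by (auto simp: word_expansion_def)
    qed
    have abs_c: "\<bar>?c i ys\<bar> = (\<Prod>(b, y)\<leftarrow>zip (w i) ys. \<bar>L y \<bullet> b\<bar>)" for i ys
    proof -
      have "\<bar>prod_list xs\<bar> = prod_list (map abs xs)" for xs :: "real list"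
        by (induction xs) (auto simp: abs_mult)
      then show ?thesis by (simp add: o_def case_prod_unfold)
    qed
    have bound: "(\<Sum>ys\<in>?W i. t ^ length ys * norm (?c i ys *\<^sub>R d i)) \<le> s ^ length (w i) * norm (d i)"
      if "i \<in> I" for i
    proof -
      have "(\<Sum>ys\<in>?W i. t ^ length ys * norm (?c i ys *\<^sub>R d i))
          = (\<Sum>ys\<in>?W i. (\<Prod>y\<leftarrow>ys. t) * (\<Prod>(b, y)\<leftarrow>zip (w i) ys. \<bar>L y \<bullet> b\<bar>)) * norm (d i)"
        by (simp only: sum_distrib_right, intro sum.cong) (simp_all add: abs_c prod_list_replicate map_replicate_const)
      also have "\<dots> \<le> s ^ length (w i) * norm (d i)"
        unfolding expand using row_prod[OF that] by (intro mult_right_mono) auto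
      finally show ?thesis .
    qed
    show abs: "(\<lambda>x. t ^ length (snd x) * norm (case x of (i, ys) \<Rightarrow> ?c i ys *\<^sub>R d i)) summable_on Sigma I ?W"
    proof (rule abs_summable_summable, rule Infinite_Sum.abs_summable_on_Sigma_iff[THEN iffD2], intro conjI ballI)
      show "(\<lambda>ys. norm (t ^ length (snd (i, ys)) * norm (case (i, ys) of (i, ys) \<Rightarrow> ?c i ys *\<^sub>R d i)))
          summable_on ?W i" for i
        by (rule summable_on_finite[OF finW])
      show "(\<lambda>i. norm (\<Sum>\<^sub>\<infinity>ys\<in>?W i. norm (t ^ length (snd (i, ys)) *
          norm (case (i, ys) of (i, ys) \<Rightarrow> ?c i ys *\<^sub>R d i)))) summable_on I"
        using t bound
        by (intro summable_on_comparison_test[OF summ])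
           (auto simp: infsum_finite[OF finW] abs_mult sum_nonneg)
    qed
    fix h :: 'a assume h: "norm h \<le> t"
    show "((\<lambda>x. monomial h (snd x) *\<^sub>R (case x of (i, ys) \<Rightarrow> ?c i ys *\<^sub>R d i)) has_sum f (L (q + h))) (Sigma I ?W)"
    proof (rule has_sum_SigmaI)
      show "((\<lambda>ys. monomial h (snd (i, ys)) *\<^sub>R (case (i, ys) of (i, ys) \<Rightarrow> ?c i ys *\<^sub>R d i)) has_sum
          monomial (L h) (w i) *\<^sub>R d i) (?W i)" for i
      proof -
        have "(\<Sum>y\<in>Basis. (h \<bullet> y) * (L y \<bullet> b)) = L h \<bullet> b" for b
        proof -
          have "L h = (\<Sum>y\<in>Basis. (h \<bullet> y) *\<^sub>R L y)"
            using L by (metis (no_types, lifting) euclidean_representation linear_scale linear_sum sum.cong)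
          then show ?thesis by (simp add: inner_sum_left)
        qed
        then have "(\<Sum>ys\<in>?W i. monomial h ys * ?c i ys) = monomial (L h) (w i)"
          using expand[of "\<lambda>y. h \<bullet> y" "\<lambda>b y. L y \<bullet> b" i] by (simp add: monomial_def)
        then have "(\<Sum>ys\<in>?W i. monomial h ys *\<^sub>R (?c i ys *\<^sub>R d i)) = monomial (L h) (w i) *\<^sub>R d i"
          by (simp add: scaleR_sum_left[symmetric])
        then show ?thesis
          using has_sum_finite[OF finW[of i], of "\<lambda>ys. monomial h ys *\<^sub>R (?c i ys *\<^sub>R d i)"] by simp
      qed
      show "((\<lambda>i. monomial (L h) (w i) *\<^sub>R d i) has_sum f (L (q + h))) I"
        using f Lh[OF h] L by (auto simp: word_expansion_def linear_add)
      have "norm (monomial h (snd x) *\<^sub>R (case x of (i, ys) \<Rightarrow> ?c i ys *\<^sub>R d i))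
          \<le> t ^ length (snd x) * norm (case x of (i, ys) \<Rightarrow> ?c i ys *\<^sub>R d i)" if "x \<in> Sigma I ?W" for x
        using abs_monomial_le[of "snd x" h t] that h by (auto intro!: mult_right_mono)
      then have "(\<lambda>x. norm (monomial h (snd x) *\<^sub>R (case x of (i, ys) \<Rightarrow> ?c i ys *\<^sub>R d i))) summable_on Sigma I ?W"
        by (intro summable_on_comparison_test[OF abs]) auto
      then show "(\<lambda>x. monomial h (snd x) *\<^sub>R (case x of (i, ys) \<Rightarrow> ?c i ys *\<^sub>R d i)) summable_on Sigma I ?W"
        by (rule abs_summable_summable)
    qed
  qed
  then show ?thesis by (rule that)
qed

section \<open>Closure properties of real-analytic functions\<close>

lemma real_analytic_on_mult:
  fixes f g :: "'a::euclidean_space \<Rightarrow> complex"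
  assumes "real_analytic_on f U" "real_analytic_on g U"
  shows "real_analytic_on (\<lambda>x. f x * g x) U"
proof (rule real_analytic_onI_word_expansion)
  fix p assume "p \<in> U"
  obtain s and I :: "('a \<Rightarrow> nat) set" and w d where f: "word_expansion f p s I w d"
    using word_expansion_exists[OF assms(1) \<open>p \<in> U\<close>] .
  obtain t and J :: "('a \<Rightarrow> nat) set" and w' d' where g: "word_expansion g p t J w' d'"
    using word_expansion_exists[OF assms(2) \<open>p \<in> U\<close>] .
  have "0 < min s t" using f g by (simp add: word_expansion_def)
  then have "word_expansion f p (min s t) I w d" "word_expansion g p (min s t) J w' d'"
    using f g by (auto intro: word_expansion_shrink)
  from word_expansion_mult[OF this]
  show "\<exists>s (I :: (('a \<Rightarrow> nat) \<times> ('a \<Rightarrow> nat)) set) w d. word_expansion (\<lambda>x. f x * g x) p s I w d"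
    by blast
qed

lemma real_analytic_on_compose_linear:
  fixes f :: "'b::euclidean_space \<Rightarrow> complex" and L :: "'a::euclidean_space \<Rightarrow> 'b"
  assumes "real_analytic_on f U" "linear L" "L ` V \<subseteq> U"
  shows "real_analytic_on (\<lambda>x. f (L x)) V"
proof (rule real_analytic_onI_word_expansion)
  fix q assume "q \<in> V"
  then obtain s and I :: "('b \<Rightarrow> nat) set" and w d where "word_expansion f (L q) s I w d"
    using word_expansion_exists[OF assms(1), of "L q"] assms(3) by blast
  from word_expansion_compose_linear[OF this assms(2)]
  show "\<exists>s (I :: (('b \<Rightarrow> nat) \<times> 'a list) set) w d. word_expansion (\<lambda>x. f (L x)) q s I w d"
    by metis
qed

lemma real_analytic_on_linear:
  fixes f :: "'a::euclidean_space \<Rightarrow> complex"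
  assumes "linear f"
  shows "real_analytic_on f U"
proof (rule real_analytic_onI_word_expansion)
  fix p
  let ?I = "insert None (Some ` Basis) :: 'a option set"
  let ?w = "\<lambda>i. case i of None \<Rightarrow> [] | Some b \<Rightarrow> [b]"
  let ?d = "\<lambda>i. case i of None \<Rightarrow> f p | Some b \<Rightarrow> f b"
  have "f (p + h) = (\<Sum>i\<in>?I. monomial h (?w i) *\<^sub>R ?d i)" for h
  proof -
    have "f h = (\<Sum>b\<in>Basis. (h \<bullet> b) *\<^sub>R f b)"
      using assms by (metis (no_types, lifting) euclidean_representation linear_scale linear_sum sum.cong)
    then show ?thesis
      using assms by (simp add: linear_add sum.reindex)
  qed
  then have "((\<lambda>i. monomial h (?w i) *\<^sub>R ?d i) has_sum f (p + h)) ?I" for h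
    using has_sum_finite[of ?I "\<lambda>i. monomial h (?w i) *\<^sub>R ?d i"] by simp
  then have "word_expansion f p 1 ?I ?w ?d"
    by (auto simp: word_expansion_def intro!: summable_on_finite)
  then show "\<exists>s (I :: 'a option set) w d. word_expansion f p s I w d" by blast
qed

lemma real_analytic_on_const: "real_analytic_on (\<lambda>x. c) U"
  unfolding real_analytic_on_def
proof (intro ballI exI conjI)
  fix p :: 'a and x
  let ?A = "{\<alpha>::'a \<Rightarrow> nat. \<forall>b. b \<notin> Basis \<longrightarrow> \<alpha> b = 0}"
  let ?c = "\<lambda>\<alpha>::'a \<Rightarrow> nat. if \<alpha> = (\<lambda>_. 0) then c else 0"
  have "((\<lambda>\<alpha>. (\<Prod>b\<in>Basis. ((x - p) \<bullet> b) ^ \<alpha> b) *\<^sub>R ?c \<alpha>) has_sum c) {\<lambda>_. 0}"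
    using has_sum_finite[of "{\<lambda>_. 0}" "\<lambda>\<alpha>. (\<Prod>b\<in>Basis. ((x - p) \<bullet> b) ^ \<alpha> b) *\<^sub>R ?c \<alpha>"] by simp
  then show "((\<lambda>\<alpha>. (\<Prod>b\<in>Basis. ((x - p) \<bullet> b) ^ \<alpha> b) *\<^sub>R ?c \<alpha>) has_sum c) ?A"
    by (rule has_sum_cong_neutral[THEN iffD1, rotated -1]) auto
qed (rule zero_less_one)

lemma real_analytic_on_add:
  assumes "real_analytic_on f U" "real_analytic_on g U"
  shows "real_analytic_on (\<lambda>x. f x + g x) U"
  unfolding real_analytic_on_def
proof
  fix p assume "p \<in> U"
  let ?S = "\<lambda>f c x. ((\<lambda>\<alpha>. (\<Prod>b\<in>Basis. ((x - p) \<bullet> b) ^ \<alpha> b) *\<^sub>R c \<alpha>) has_sum f x) {\<alpha>. \<forall>b. b \<notin> Basis \<longrightarrow> \<alpha> b = (0::nat)}"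
  obtain r c where r: "r > 0" "\<forall>x\<in>ball p r. ?S f c x"
    using assms(1) \<open>p \<in> U\<close> unfolding real_analytic_on_def by blast
  obtain r' c' where r': "r' > 0" "\<forall>x\<in>ball p r'. ?S g c' x"
    using assms(2) \<open>p \<in> U\<close> unfolding real_analytic_on_def by blast
  have *: "?S (\<lambda>x. f x + g x) (\<lambda>\<alpha>. c \<alpha> + c' \<alpha>) x" if "x \<in> ball p (min r r')" for x
  proof -
    have "?S f c x" "?S g c' x" using r(2) r'(2) that by auto
    from has_sum_add[OF this] show ?thesis by (simp add: scaleR_add_right)
  qed
  then show "\<exists>r>0. \<exists>c. \<forall>x\<in>ball p r. ?S (\<lambda>x. f x + g x) c x"
    using r(1) r'(1)
    by (intro exI[of _ "min r r'"] conjI exI[of _ "\<lambda>\<alpha>. c \<alpha> + c' \<alpha>"] ballI) (simp, rule *)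
qed

lemma real_analytic_on_sum:
  assumes "finite K" "\<And>k. k \<in> K \<Longrightarrow> real_analytic_on (f k) U"
  shows "real_analytic_on (\<lambda>x. \<Sum>k\<in>K. f k x) U"
  using assms by (induction K) (auto intro: real_analytic_on_const real_analytic_on_add)

lemma real_analytic_on_bounded_linear:
  assumes "bounded_linear T" "real_analytic_on f U"
  shows "real_analytic_on (\<lambda>x. T (f x)) U"
  unfolding real_analytic_on_def
proof
  fix p assume "p \<in> U"
  then obtain r c where "r > 0" and sums: "\<And>x. x \<in> ball p r \<Longrightarrow>
      ((\<lambda>\<alpha>. (\<Prod>b\<in>Basis. ((x - p) \<bullet> b) ^ \<alpha> b) *\<^sub>R c \<alpha>) has_sum f x) {\<alpha>. \<forall>b. b \<notin> Basis \<longrightarrow> \<alpha> b = (0::nat)}"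
    using assms(2) unfolding real_analytic_on_def by blast
  then show "\<exists>r>0. \<exists>c. \<forall>x\<in>ball p r.
      ((\<lambda>\<alpha>. (\<Prod>b\<in>Basis. ((x - p) \<bullet> b) ^ \<alpha> b) *\<^sub>R c \<alpha>) has_sum T (f x)) {\<alpha>. \<forall>b. b \<notin> Basis \<longrightarrow> \<alpha> b = (0::nat)}"
    using has_sum_bounded_linear[OF assms(1) sums]
    by (intro exI[of _ r] conjI exI[of _ "\<lambda>\<alpha>. T (c \<alpha>)"])
       (auto simp: linear_scale[OF bounded_linear.linear[OF assms(1)]])
qed

lemma real_analytic_on_vec:
  fixes f :: "'a::euclidean_space \<Rightarrow> complex ^ 'k"
  assumes "\<And>k. real_analytic_on (\<lambda>x. f x $ k) U"
  shows "real_analytic_on f U"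
proof -
  have "bounded_linear (axis k :: complex \<Rightarrow> complex ^ 'k)" for k
    by (intro linear_conv_bounded_linear[THEN iffD1] linearI) (auto simp: vec_eq_iff axis_def)
  then have "real_analytic_on (\<lambda>x. \<Sum>k\<in>UNIV. axis k (f x $ k)) U"
    by (intro real_analytic_on_sum real_analytic_on_bounded_linear[OF _ assms]) auto
  moreover have "(\<Sum>k\<in>UNIV. axis k (f x $ k)) = f x" for x
    by (simp add: vec_eq_iff axis_def if_distrib sum.delta cong: if_cong)
  ultimately show ?thesis by simp
qed

section \<open>Taylor expansion with a remainder uniform in the base point\<close>

primrec monomial_deriv :: "'a::euclidean_space \<Rightarrow> 'a \<Rightarrow> 'a list \<Rightarrow> real" where
  "monomial_deriv x h [] = 0"
| "monomial_deriv x h (b # xs) = (x \<bullet> b) * monomial_deriv x h xs + (h \<bullet> b) * monomial x xs"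

lemma monomial_deriv_linear:
  "monomial_deriv x (h + k) xs = monomial_deriv x h xs + monomial_deriv x k xs"
  "monomial_deriv x (c *\<^sub>R h) xs = c * monomial_deriv x h xs"
  by (induction xs) (auto simp: algebra_simps inner_add_left)

text \<open>Each further letter contributes two terms by the product rule, each with a factor
  \<open>a\<close>; their sum is absorbed by the base \<open>2 * a\<close>. Hence no factor
  depending on the length of the word appears.\<close>

lemma monomial_taylor:
  assumes "set xs \<subseteq> Basis" "norm x \<le> a" "norm h \<le> t * a" "0 \<le> a" "0 \<le> t" "t \<le> 1"
  shows "\<bar>monomial (x + h) xs - monomial x xs\<bar> \<le> t * (2 * a) ^ length xs" (is "?A xs")
    and "\<bar>monomial (x + h) xs - monomial x xs - monomial_deriv x h xs\<bar> \<le> t\<^sup>2 * (2 * a) ^ length xs" (is "?B xs")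
proof -
  have "?A xs \<and> ?B xs"
    using assms(1)
  proof (induction xs)
    case (Cons b xs)
    then have A: "?A xs" and B: "?B xs" and xs: "set xs \<subseteq> Basis" and b: "b \<in> Basis" by auto
    have xb: "\<bar>x \<bullet> b\<bar> \<le> a" and hb: "\<bar>h \<bullet> b\<bar> \<le> t * a"
      using Basis_le_norm[OF b, of x] Basis_le_norm[OF b, of h] assms by auto
    have "t * a \<le> 1 * a" using assms by (intro mult_right_mono) auto
    then have "norm (x + h) \<le> 2 * a"
      using norm_triangle_ineq[of x h] assms(2,3) by linarith
    then have M: "\<bar>monomial (x + h) xs\<bar> \<le> (2 * a) ^ length xs"
      by (intro abs_monomial_le xs)
    let ?D = "monomial (x + h) xs - monomial x xs"
    have "\<bar>(x \<bullet> b) * ?D + (h \<bullet> b) * monomial (x + h) xs\<bar>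
        \<le> a * (t * (2 * a) ^ length xs) + (t * a) * (2 * a) ^ length xs"
      by (rule order_trans[OF abs_triangle_ineq add_mono])
        (use mult_mono[OF xb A] mult_mono[OF hb M] assms in \<open>simp_all add: abs_mult\<close>)
    moreover have "\<bar>(x \<bullet> b) * (?D - monomial_deriv x h xs) + (h \<bullet> b) * ?D\<bar>
        \<le> a * (t\<^sup>2 * (2 * a) ^ length xs) + (t * a) * (t * (2 * a) ^ length xs)"
      by (rule order_trans[OF abs_triangle_ineq add_mono])
        (use mult_mono[OF xb B] mult_mono[OF hb A] assms in \<open>simp_all add: abs_mult\<close>)
    ultimately show ?case
      by (simp add: algebra_simps inner_add_left power2_eq_square)
  qed (use assms in simp)
  then show "?A xs" "?B xs" by auto
qed

lemma abs_monomial_deriv_le: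
  assumes "set xs \<subseteq> Basis" "norm x \<le> a" "norm h \<le> t * a" "0 \<le> a" "0 \<le> t"
  shows "\<bar>monomial_deriv x h xs\<bar> \<le> t * (2 * a) ^ length xs"
  using assms(1)
proof (induction xs)
  case (Cons b xs)
  then have A: "\<bar>monomial_deriv x h xs\<bar> \<le> t * (2 * a) ^ length xs" and xs: "set xs \<subseteq> Basis" and b: "b \<in> Basis"
    by auto
  have xb: "\<bar>x \<bullet> b\<bar> \<le> a" and hb: "\<bar>h \<bullet> b\<bar> \<le> t * a"
    using Basis_le_norm[OF b, of x] Basis_le_norm[OF b, of h] assms by auto
  have M: "\<bar>monomial x xs\<bar> \<le> (2 * a) ^ length xs"
    using assms by (intro abs_monomial_le xs) auto
  have "\<bar>(x \<bullet> b) * monomial_deriv x h xs + (h \<bullet> b) * monomial x xs\<bar>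
      \<le> a * (t * (2 * a) ^ length xs) + (t * a) * (2 * a) ^ length xs"
    by (rule order_trans[OF abs_triangle_ineq add_mono])
        (use mult_mono[OF xb A] mult_mono[OF hb M] assms in \<open>simp_all add: abs_mult\<close>)
  then show ?case by (simp add: algebra_simps)
qed (use assms in simp)

text \<open>A remainder estimate that is uniform in the base point makes the derivative Lipschitz, and
  bounds the derivative of a function by the size of the function.\<close>

lemma real_analytic_taylor:
  fixes f :: "'a::euclidean_space \<Rightarrow> complex"
  assumes "real_analytic_on f U" "p \<in> U"
  obtains r K D where "0 < r" "0 \<le> K" "\<And>x. x \<in> ball p r \<Longrightarrow> linear (D x)"
    "\<And>x h. x \<in> ball p r \<Longrightarrow> norm h < r \<Longrightarrow> norm (f (x + h) - f x - D x h) \<le> K * (norm h)\<^sup>2"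
proof -
  obtain s and I :: "('a \<Rightarrow> nat) set" and w d where we: "word_expansion f p s I w d"
    using word_expansion_exists[OF assms] .
  then have s: "s > 0" and wB: "\<And>i. i \<in> I \<Longrightarrow> set (w i) \<subseteq> Basis"
    and summ: "(\<lambda>i. s ^ length (w i) * norm (d i)) summable_on I"
    and sums: "\<And>h. norm h \<le> s \<Longrightarrow> ((\<lambda>i. monomial h (w i) *\<^sub>R d i) has_sum f (p + h)) I"
    by (auto simp: word_expansion_def)
  \<comment> \<open>Half the radius, so that the bounds with base \<open>2 * a\<close> become
    multiples of the summable series with base \<open>s\<close>.\<close>
  define a where "a = s / 2"
  have a: "a > 0" "2 * a = s" using s by (auto simp: a_def)
  define S where "S = infsum (\<lambda>i. s ^ length (w i) * norm (d i)) I"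
  have S: "((\<lambda>i. c * (s ^ length (w i) * norm (d i))) has_sum c * S) I" for c
    unfolding S_def by (intro has_sum_cmult_right has_sum_infsum summ)
  have "S \<ge> 0" unfolding S_def using s by (intro infsum_nonneg) auto
  define D where "D x h = infsum (\<lambda>i. monomial_deriv (x - p) h (w i) *\<^sub>R d i) I" for x h
  have D: "((\<lambda>i. monomial_deriv (x - p) h (w i) *\<^sub>R d i) has_sum D x h) I" if "x \<in> ball p a" for x h
  proof -
    have bound: "norm (monomial_deriv (x - p) h (w i) *\<^sub>R d i) \<le> norm h / a * (s ^ length (w i) * norm (d i))"
      if "i \<in> I" for i
    proof -
      have "\<bar>monomial_deriv (x - p) h (w i)\<bar> \<le> norm h / a * s ^ length (w i)"
        unfolding a(2)[symmetric] using wB[OF that] \<open>x \<in> ball p a\<close> a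
        by (intro abs_monomial_deriv_le) (auto simp: dist_norm norm_minus_commute)
      then show ?thesis
        using mult_right_mono[of "\<bar>monomial_deriv (x - p) h (w i)\<bar>" "norm h / a * s ^ length (w i)" "norm (d i)"]
        by (simp add: mult_ac)
    qed
    have "(\<lambda>i. norm (monomial_deriv (x - p) h (w i) *\<^sub>R d i)) summable_on I"
      by (rule summable_on_comparison_test[OF has_sum_imp_summable[OF S] bound norm_ge_zero])
    then show ?thesis
      unfolding D_def by (rule has_sum_infsum[OF abs_summable_summable])
  qed
  have lin: "linear (D x)" if "x \<in> ball p a" for x
  proof (rule linearI)
    fix h k c
    have "((\<lambda>i. monomial_deriv (x - p) (h + k) (w i) *\<^sub>R d i) has_sum D x h + D x k) I"
      using has_sum_add[OF D[OF that, of h] D[OF that, of k]]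
      by (simp add: monomial_deriv_linear scaleR_add_left)
    then show "D x (h + k) = D x h + D x k"
      using D[OF that] has_sum_unique by blast
    have "((\<lambda>i. monomial_deriv (x - p) (c *\<^sub>R h) (w i) *\<^sub>R d i) has_sum c *\<^sub>R D x h) I"
      using has_sum_scaleR[OF D[OF that, of h], of c] by (simp add: monomial_deriv_linear)
    then show "D x (c *\<^sub>R h) = c *\<^sub>R D x h"
      using D[OF that] has_sum_unique by blast
  qed
  have rem: "norm (f (x + h) - f x - D x h) \<le> S / a\<^sup>2 * (norm h)\<^sup>2"
    if x: "x \<in> ball p a" and h: "norm h < a" for x h
  proof -
    define t where "t = norm h / a"
    have t: "0 \<le> t" "t \<le> 1" "norm h = t * a" using h a by (auto simp: t_def)
    have xp: "norm (x - p) < a" using x by (simp add: dist_norm norm_minus_commute)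
    then have "norm (x - p) \<le> s" "norm (x - p + h) \<le> s"
      using norm_triangle_ineq[of "x - p" h] h a by auto
    note s1 = sums[OF this(2)] and s2 = sums[OF this(1)]
    have "((\<lambda>i. (monomial (x - p + h) (w i) - monomial (x - p) (w i) - monomial_deriv (x - p) h (w i)) *\<^sub>R d i)
        has_sum f (x + h) - f x - D x h) I"
      using has_sum_add[OF s1 has_sum_add[OF has_sum_scaleR[OF s2, of "-1"] has_sum_scaleR[OF D[OF x, of h], of "-1"]]]
      by (simp add: scaleR_diff_left add_diff_eq)
    moreover have "norm ((monomial (x - p + h) (w i) - monomial (x - p) (w i) - monomial_deriv (x - p) h (w i)) *\<^sub>R d i)
        \<le> t\<^sup>2 * (s ^ length (w i) * norm (d i))" if "i \<in> I" for i
      using monomial_taylor(2)[OF wB[OF that], of "x - p" a h t] xp t a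
        mult_right_mono[of "\<bar>monomial (x - p + h) (w i) - monomial (x - p) (w i) - monomial_deriv (x - p) h (w i)\<bar>"
          "t\<^sup>2 * s ^ length (w i)" "norm (d i)"]
      by (simp add: a(2) mult.assoc)
    ultimately have "norm (f (x + h) - f x - D x h) \<le> t\<^sup>2 * S"
      by (rule norm_infsum_le[OF _ S])
    then show ?thesis by (simp add: t_def power_divide mult_ac)
  qed
  show ?thesis
    by (rule that[of a "S / a\<^sup>2" D]) (use a \<open>S \<ge> 0\<close> lin rem in auto)
qed

lemma taylor_imp_has_derivative:
  fixes f :: "'a::euclidean_space \<Rightarrow> 'b::real_normed_vector"
  assumes "linear D" "0 < r" and rem: "\<And>h. norm h < r \<Longrightarrow> norm (f (x + h) - f x - D h) \<le> K * (norm h)\<^sup>2"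
  shows "(f has_derivative D) (at x)"
  unfolding has_derivative_at
proof
  show "bounded_linear D" using assms(1) by (simp add: linear_conv_bounded_linear)
  show "(\<lambda>h. norm (f (x + h) - f x - D h) / norm h) \<midarrow>0\<rightarrow> 0"
  proof (rule Lim_null_comparison)
    have "norm (f (x + h) - f x - D h) / norm h \<le> K * norm h" if "0 < norm h" "norm h < r" for h
      using rem[OF that(2)] that by (simp add: divide_simps power2_eq_square mult_ac)
    then show "\<forall>\<^sub>F h in at 0. norm (norm (f (x + h) - f x - D h) / norm h) \<le> K * norm h"
      unfolding eventually_at using assms(2) by (intro exI[of _ r]) auto
    show "(\<lambda>h. K * norm h) \<midarrow>0\<rightarrow> 0"
      by (auto intro!: tendsto_eq_intros)
  qed
qed

text \<open>The value of \<open>f\<close> at a third point \<open>y + m\<close> is expanded both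
  from \<open>x\<close> and from \<open>y\<close>. Together with the expansion of \<open>f y\<close>
  from \<open>x\<close> this expresses \<open>D y m - D x m\<close> by three remainders; 6 is 4 + 1
  + 1.\<close>

lemma taylor_imp_lipschitz_derivative:
  fixes f :: "'a::euclidean_space \<Rightarrow> 'b::real_normed_vector"
  assumes K: "0 \<le> K" and lin: "\<And>x. x \<in> ball p r \<Longrightarrow> linear (D x)"
    and rem: "\<And>x h. x \<in> ball p r \<Longrightarrow> norm h < r \<Longrightarrow> norm (f (x + h) - f x - D x h) \<le> K * (norm h)\<^sup>2"
    and x: "x \<in> ball p (r / 4)" and y: "y \<in> ball p (r / 4)"
  shows "norm (D y h - D x h) \<le> 6 * K * norm (y - x) * norm h"
proof (cases "h = 0 \<or> y = x")
  case True
  have "x \<in> ball p r" "y \<in> ball p r" using x y zero_le_dist[of p x] by (auto simp del: zero_le_dist)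
  then have "D x 0 = 0" "D y 0 = 0" using lin linear_0 by blast+
  with True show ?thesis by auto
next
  case False
  define k where "k = y - x"
  \<comment> \<open>The vector \<open>h\<close> rescaled to the length of \<open>k\<close>, so that
    all three remainders have order \<open>(norm k)\<^sup>2\<close>.\<close>
  define m where "m = (norm k / norm h) *\<^sub>R h"
  have r: "r > 0" using x zero_le_dist[of p x] by (simp del: zero_le_dist)
  have "norm k \<le> dist p x + dist p y"
    unfolding k_def by (metis dist_commute dist_norm dist_triangle2)
  then have k: "norm k < r / 2" using x y by simp
  have m: "norm m = norm k" using False by (simp add: m_def)
  have xr: "x \<in> ball p r" "y \<in> ball p r" using x y r by auto
  have km: "norm (k + m) \<le> 2 * norm k" using norm_triangle_ineq[of k m] m by simp
  have 1: "norm (f (y + m) - f x - D x (k + m)) \<le> K * (2 * norm k)\<^sup>2"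
    using rem[OF xr(1), of "k + m"] km k K power_mono[OF km, of 2]
      mult_left_mono[of "(norm (k + m))\<^sup>2" "(2 * norm k)\<^sup>2" K] by (auto simp: k_def)
  have 2: "norm (f y - f x - D x k) \<le> K * (norm k)\<^sup>2"
    using rem[OF xr(1), of k] k r by (simp add: k_def)
  have 3: "norm (f (y + m) - f y - D y m) \<le> K * (norm k)\<^sup>2"
    using rem[OF xr(2), of m] k r m by simp
  let ?A = "f (y + m) - f x - D x (k + m)" and ?B = "f y - f x - D x k" and ?C = "f (y + m) - f y - D y m"
  have "D y m - D x m = ?A - ?B - ?C"
    using lin[OF xr(1)] by (simp add: linear_add)
  also have "norm \<dots> \<le> K * (2 * norm k)\<^sup>2 + K * (norm k)\<^sup>2 + K * (norm k)\<^sup>2"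
    using 1 2 3 norm_triangle_ineq4[of "?A - ?B" ?C] norm_triangle_ineq4[of ?A ?B] by linarith
  finally have "norm (D y m - D x m) \<le> 6 * K * (norm k)\<^sup>2"
    by (simp add: power2_eq_square)
  moreover have "D y m - D x m = (norm k / norm h) *\<^sub>R (D y h - D x h)"
    using lin[OF xr(1)] lin[OF xr(2)] by (simp add: m_def linear_scale scaleR_diff_right)
  ultimately have "norm k * norm (D y h - D x h) \<le> norm k * (6 * K * norm k * norm h)"
    using False by (simp add: divide_simps power2_eq_square mult_ac)
  then show ?thesis
    using False by (simp add: k_def)
qed

lemma real_analytic_on_isCont:
  fixes f :: "'a::euclidean_space \<Rightarrow> complex"
  assumes "real_analytic_on f U" "p \<in> U"
  shows "isCont f p"
proof -
  obtain r K D where "0 < r" "\<And>x. x \<in> ball p r \<Longrightarrow> linear (D x)"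
    "\<And>x h. x \<in> ball p r \<Longrightarrow> norm h < r \<Longrightarrow> norm (f (x + h) - f x - D x h) \<le> K * (norm h)\<^sup>2"
    using real_analytic_taylor[OF assms] by metis
  then have "(f has_derivative D p) (at p)"
    by (intro taylor_imp_has_derivative[where r = r and K = K]) auto
  then show ?thesis by (rule has_derivative_continuous)
qed

section \<open>The CR structure of a graph\<close>

definition pairing :: "complex ^ 'n \<Rightarrow> complex ^ 'n \<Rightarrow> complex" where
  "pairing a u = (\<Sum>j\<in>UNIV. a $ j * u $ j)"

definition vcnj :: "complex ^ 'n \<Rightarrow> complex ^ 'n" where
  "vcnj u = (\<chi> j. cnj (u $ j))"

lemma vcnj_nth [simp]: "vcnj u $ j = cnj (u $ j)"
  by (simp add: vcnj_def)

lemma vcnj_simps [simp]: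
  "vcnj (vcnj u) = u" "vcnj (u + v) = vcnj u + vcnj v" "vcnj (c *s u) = cnj c *s vcnj u"
  "vcnj (r *\<^sub>R u) = r *\<^sub>R vcnj u" "vcnj (axis j 1) = axis j 1" "vcnj 0 = 0" "vcnj (- u) = - vcnj u"
  "vcnj u = 0 \<longleftrightarrow> u = 0"
  by (auto simp: vec_eq_iff axis_def)

lemma pairing_simps:
  "pairing a (u + v) = pairing a u + pairing a v"
  "pairing a (u - v) = pairing a u - pairing a v"
  "pairing (a + b) u = pairing a u + pairing b u"
  "pairing (a - b) u = pairing a u - pairing b u"
  "pairing a (c *s u) = c * pairing a u"
  "pairing (c *s a) u = c * pairing a u"
  "pairing a (r *\<^sub>R u) = r *\<^sub>R pairing a u"
  "pairing (r *\<^sub>R a) u = r *\<^sub>R pairing a u"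
  "pairing a (- u) = - pairing a u" "pairing a 0 = 0" "pairing 0 u = 0"
  "pairing a (axis j 1) = a $ j"
  by (simp_all add: pairing_def algebra_simps sum.distrib sum_subtractf sum_negf sum_distrib_left scaleR_sum_right
      axis_def if_distrib sum.delta cong: if_cong)

lemma pairing_commute: "pairing a u = pairing u a"
  by (simp add: pairing_def mult.commute)

lemma cnj_pairing: "cnj (pairing a u) = pairing (vcnj a) (vcnj u)"
  by (simp add: pairing_def)

lemma subspace_hyperplane: "vec.subspace {u. pairing a u = 0}"
  by (auto simp: vec.subspace_def pairing_simps)

text \<open>A basis vector on which \<open>a\<close> does not vanish, added to the hyperplane, spans
  everything. The form as a sum covers \<open>a = 0\<close> and avoids truncated
  subtraction.\<close>

lemma dim_hyperplane:
  fixes a :: "complex ^ 'n"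
  shows "vec.dim {u. pairing a u = 0} + (if a = 0 then 0 else 1) = CARD('n)"
proof (cases "a = 0")
  case True
  then show ?thesis by (simp add: pairing_simps vec_dim_card del: vec.dim_UNIV)
next
  case False
  then obtain j where j: "a $ j \<noteq> 0" by (auto simp: vec_eq_iff)
  let ?H = "{u. pairing a u = 0}"
  have span_H: "vec.span ?H = ?H"
    by (simp add: vec.span_eq_iff subspace_hyperplane)
  have "u \<in> vec.span (insert (axis j 1) ?H)" for u
  proof -
    have "u - (pairing a u / a $ j) *s axis j 1 \<in> ?H"
      using j by (simp add: pairing_simps)
    then show ?thesis
      unfolding vec.span_insert span_H by blast
  qed
  then have "vec.dim (insert (axis j 1) ?H) = CARD('n)"
    by (metis UNIV_eq_I vec.dim_span vec_dim_card)
  moreover have "axis j 1 \<notin> vec.span ?H"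
    using j by (simp add: span_H pairing_simps)
  ultimately show ?thesis
    using False by (simp add: vec.dim_insert)
qed

section \<open>Wirtinger gradients of real linear maps\<close>

definition wirtinger :: "(complex ^ 'n \<Rightarrow> complex) \<Rightarrow> complex ^ 'n" where
  "wirtinger D = (\<chi> j. (D (axis j 1) - \<i> * D (axis j \<i>)) / 2)"

definition wirtinger_bar :: "(complex ^ 'n \<Rightarrow> complex) \<Rightarrow> complex ^ 'n" where
  "wirtinger_bar D = (\<chi> j. (D (axis j 1) + \<i> * D (axis j \<i>)) / 2)"

text \<open>The splitting into a complex linear and an antilinear part; it turns the real derivative
  of \<open>\<rho>\<close> into the two gradients on which the CR structure depends.\<close>

lemma real_linear_wirtinger:
  fixes D :: "complex ^ 'n \<Rightarrow> complex"
  assumes "linear D"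
  shows "D v = pairing (wirtinger D) v + pairing (wirtinger_bar D) (vcnj v)"
proof -
  have "v = (\<Sum>j\<in>UNIV. Re (v $ j) *\<^sub>R axis j 1 + Im (v $ j) *\<^sub>R axis j \<i>)"
    by (simp add: vec_eq_iff axis_def if_distrib sum.distrib complex_eq_iff cong: if_cong)
  then have "D v = D (\<Sum>j\<in>UNIV. Re (v $ j) *\<^sub>R axis j 1 + Im (v $ j) *\<^sub>R axis j \<i>)"
    by (rule arg_cong)
  also have "\<dots> = (\<Sum>j\<in>UNIV. Re (v $ j) *\<^sub>R D (axis j 1) + Im (v $ j) *\<^sub>R D (axis j \<i>))"
    by (simp only: linear_sum[OF assms] linear_add[OF assms] linear_scale[OF assms])
  also have "\<dots> = (\<Sum>j\<in>UNIV. wirtinger D $ j * v $ j + wirtinger_bar D $ j * cnj (v $ j))"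
    by (intro sum.cong refl) (simp add: wirtinger_def wirtinger_bar_def complex_eq_iff field_simps)
  finally show ?thesis
    by (simp add: pairing_def sum.distrib)
qed

lemma wirtinger_bar_pairing [simp]:
  "wirtinger_bar (\<lambda>v. pairing a v + pairing b (vcnj v)) = b"
proof -
  have *: "axis j \<i> = \<i> *s axis j 1" for j :: 'a
    by (simp add: vec_eq_iff axis_def)
  have "wirtinger_bar (\<lambda>v. pairing a v + pairing b (vcnj v)) $ j = b $ j" for j
    by (simp add: wirtinger_bar_def * pairing_simps algebra_simps)
  then show ?thesis by (simp add: vec_eq_iff)
qed

lemma wirtinger_bar_diff: "wirtinger_bar (\<lambda>v. D v - D' v) = wirtinger_bar D - wirtinger_bar D'"
  by (simp add: wirtinger_bar_def vec_eq_iff field_simps)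

text \<open>Carries operator bounds over to gradients. Applied to differences of derivatives it
  yields both the continuity of the antiholomorphic gradient of \<open>\<rho>\<close> and its
  first-order approximation.\<close>

lemma norm_wirtinger_bar_le:
  fixes D :: "complex ^ 'n \<Rightarrow> complex"
    and c :: real
  assumes "\<And>v. norm (D v) \<le> c * norm v"
  shows "norm (wirtinger_bar D) \<le> CARD('n) * c"
proof -
  have "norm (wirtinger_bar D $ j) \<le> c" for j
  proof -
    have "norm (D (axis j 1)) \<le> c" "norm (\<i> * D (axis j \<i>)) \<le> c"
      using assms[of "axis j 1"] assms[of "axis j \<i>"] by (simp_all add: norm_mult)
    then have "norm (D (axis j 1) + \<i> * D (axis j \<i>)) \<le> 2 * c"
      using norm_triangle_ineq[of "D (axis j 1)" "\<i> * D (axis j \<i>)"] by linarith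
    then show ?thesis by (simp add: wirtinger_bar_def norm_divide)
  qed
  then have "(\<Sum>j\<in>UNIV. norm (wirtinger_bar D $ j)) \<le> (\<Sum>j\<in>(UNIV::'n set). c)"
    by (intro sum_mono) auto
  moreover have "norm (wirtinger_bar D) \<le> (\<Sum>j\<in>UNIV. norm (wirtinger_bar D $ j))"
    unfolding norm_vec_def by (rule L2_set_le_sum) simp
  ultimately show ?thesis by simp
qed

section \<open>Tangent vectors and (0,1) vectors of a graph\<close>

definition point :: "complex ^ 'n \<Rightarrow> complex \<Rightarrow> complex ^ ('n::finite) option" where
  "point z w = (\<chi> k. case k of None \<Rightarrow> w | Some j \<Rightarrow> z $ j)"

lemma point_nth [simp]: "point z w $ None = w" "point z w $ Some j = z $ j"
  by (simp_all add: point_def)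

lemma z_part_nth [simp]: "z_part \<zeta> $ j = \<zeta> $ Some j"
  by (simp add: z_part_def)

lemma vec_option_eq_iff: "\<zeta> = \<xi> \<longleftrightarrow> \<zeta> $ None = \<xi> $ None \<and> (\<forall>j. \<zeta> $ Some j = \<xi> $ Some j)"
  by (metis (full_types) not_None_eq vec_eq_iff)

lemma point_parts [simp]: "z_part (point z w) = z" "w_part (point z w) = w" "point (z_part \<zeta>) (w_part \<zeta>) = \<zeta>"
  by (simp_all add: vec_eq_iff w_part_def vec_option_eq_iff del: vec_option_eq_iff[symmetric])
     (auto simp: point_def split: option.splits)

lemma bounded_linear_z_part: "bounded_linear z_part"
  by (simp add: linear_conv_bounded_linear[symmetric] linear_iff vec_eq_iff)

lemma bounded_linear_w_part: "bounded_linear w_part"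
  by (simp add: linear_conv_bounded_linear[symmetric] linear_iff w_part_def)

lemma point_simps:
  "point (z + z') (w + w') = point z w + point z' w'" "point (r *\<^sub>R z) (r *\<^sub>R w) = r *\<^sub>R point z w"
  "point (c *s z) (c * w) = c *s point z w" "point 0 0 = 0"
  by (simp_all add: vec_option_eq_iff)

lemma bounded_linear_point: "bounded_linear (\<lambda>(z, w). point z w)"
  by (simp add: linear_conv_bounded_linear[symmetric] linear_iff case_prod_unfold point_simps)

lemma has_derivative_point:
  assumes "(f has_derivative f') (at x within S)" "(g has_derivative g') (at x within S)"
  shows "((\<lambda>x. point (f x) (g x)) has_derivative (\<lambda>h. point (f' h) (g' h))) (at x within S)"
  using bounded_linear.has_derivative[OF bounded_linear_point has_derivative_Pair[OF assms]] by simp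

text \<open>Along a curve in \<open>M\<close> the equation \<open>w = \<rho>(z)\<close> holds for
  small parameters and can be differentiated; conversely the line \<open>z + t v\<close> lifted to
  the graph stays in \<open>W\<close>, hence in \<open>M\<close>, for small
  \<open>t\<close>.\<close>

lemma tangent_space_graph:
  fixes M :: "(complex ^ 'n::finite option) set"
  assumes W: "open W" "M \<inter> W = {\<zeta> \<in> W. w_part \<zeta> = \<rho> (z_part \<zeta>)}" "\<zeta> \<in> M \<inter> W"
    and D: "(\<rho> has_derivative D) (at (z_part \<zeta>))"
  shows "tangent_space M \<zeta> = range (\<lambda>v. point v (D v))"
proof (intro equalityI subsetI)
  fix x assume "x \<in> tangent_space M \<zeta>"
  then obtain \<gamma> :: "real \<Rightarrow> complex ^ 'n option" where
    \<gamma>: "\<gamma> 0 = \<zeta>" "\<forall>\<^sub>F t in nhds 0. \<gamma> t \<in> M" and d\<gamma>: "(\<gamma> has_vector_derivative x) (at 0)"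
    unfolding tangent_space_def by blast
  have "isCont \<gamma> 0" using d\<gamma> by (rule has_vector_derivative_continuous)
  then have "\<forall>\<^sub>F t in nhds 0. \<gamma> t \<in> W"
    using W(1,3) \<gamma>(1) by (auto simp: isCont_def tendsto_def eventually_nhds_conv_at)
  with \<gamma>(2) have ev: "\<forall>\<^sub>F t in nhds 0. w_part (\<gamma> t) = \<rho> (z_part (\<gamma> t))"
    by (rule eventually_elim2) (use W(2) in blast)
  have dz: "((\<lambda>t. z_part (\<gamma> t)) has_vector_derivative z_part x) (at 0)"
    and dw: "((\<lambda>t. w_part (\<gamma> t)) has_vector_derivative w_part x) (at 0)"
    by (rule bounded_linear.has_vector_derivative[OF _ d\<gamma>], rule bounded_linear_z_part bounded_linear_w_part)+
  have "(\<rho> has_derivative D) (at (z_part (\<gamma> 0)))" using D \<gamma>(1) by simp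
  from has_derivative_compose[OF dz[unfolded has_vector_derivative_def] this]
  have "((\<lambda>t. \<rho> (z_part (\<gamma> t))) has_vector_derivative D (z_part x)) (at 0)"
    using linear_scale[OF has_derivative_linear[OF D]] by (simp add: has_vector_derivative_def)
  then have "((\<lambda>t. w_part (\<gamma> t)) has_vector_derivative D (z_part x)) (at 0)"
    unfolding has_vector_derivative_def
    by (rule has_derivative_transform_eventually) (use ev in \<open>auto simp: eventually_nhds_conv_at eq_commute\<close>)
  with dw have "w_part x = D (z_part x)" by (rule vector_derivative_unique_at)
  then have "x = point (z_part x) (D (z_part x))" by (metis point_parts(3))
  then show "x \<in> range (\<lambda>v. point v (D v))" by blast
next
  have \<zeta>: "w_part \<zeta> = \<rho> (z_part \<zeta>)" using W by blast
  fix x assume "x \<in> range (\<lambda>v. point v (D v))"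
  then obtain v where x: "x = point v (D v)" by blast
  define \<gamma> where "\<gamma> t = point (z_part \<zeta> + t *\<^sub>R v) (\<rho> (z_part \<zeta> + t *\<^sub>R v))" for t :: real
  have "((\<lambda>t. z_part \<zeta> + t *\<^sub>R v) has_derivative (\<lambda>t. t *\<^sub>R v)) (at 0)"
    by (auto intro!: derivative_eq_intros)
  moreover from this D have "((\<lambda>t. \<rho> (z_part \<zeta> + t *\<^sub>R v)) has_derivative (\<lambda>t. D (t *\<^sub>R v))) (at 0)"
    by (intro has_derivative_compose[of _ _ 0 UNIV \<rho>]) auto
  ultimately have d\<gamma>: "(\<gamma> has_vector_derivative x) (at 0)"
    unfolding \<gamma>_def x has_vector_derivative_def
    using has_derivative_point linear_scale[OF has_derivative_linear[OF D]]
    by (fastforce simp: point_simps)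
  have \<gamma>0: "\<gamma> 0 = \<zeta>" by (simp add: \<gamma>_def \<zeta>[symmetric])
  have "isCont \<gamma> 0" using d\<gamma> by (rule has_vector_derivative_continuous)
  then have "\<forall>\<^sub>F t in nhds 0. \<gamma> t \<in> W"
    using W(1,3) \<gamma>0 by (auto simp: isCont_def tendsto_def eventually_nhds_conv_at)
  moreover have "\<gamma> t \<in> M" if "\<gamma> t \<in> W" for t
  proof -
    have "\<gamma> t \<in> {\<zeta> \<in> W. w_part \<zeta> = \<rho> (z_part \<zeta>)}" using that by (simp add: \<gamma>_def)
    then show ?thesis using W(2) by blast
  qed
  ultimately have "\<forall>\<^sub>F t in nhds 0. \<gamma> t \<in> M"
    by (rule eventually_mono)
  with \<gamma>0 d\<gamma> show "x \<in> tangent_space M \<zeta>"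
    unfolding tangent_space_def by blast
qed

text \<open>The (0,1) vector with \<open>z\<close>-bar components \<open>u\<close> that annihilates the conjugate of the defining
  function \<open>w - \<rho>\<close>, where \<open>a\<close> is the holomorphic gradient of \<open>\<rho>\<close>.\<close>

definition cr_vector :: "complex ^ 'n \<Rightarrow> complex ^ 'n \<Rightarrow> complex ^ (('n::finite) option + 'n option)" where
  "cr_vector a u = (\<chi> k. case k of Inl _ \<Rightarrow> 0 | Inr None \<Rightarrow> pairing (vcnj a) u | Inr (Some j) \<Rightarrow> u $ j)"

lemma cr_vector_nth [simp]:
  "cr_vector a u $ Inl k = 0" "cr_vector a u $ Inr None = pairing (vcnj a) u" "cr_vector a u $ Inr (Some j) = u $ j"
  by (simp_all add: cr_vector_def)

lemma vec_sum_option_eq_iff: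
  fixes x y :: "'a ^ (('n::finite) option + 'n option)"
  shows "x = y \<longleftrightarrow> x $ Inl None = y $ Inl None \<and> (\<forall>j. x $ Inl (Some j) = y $ Inl (Some j)) \<and>
    x $ Inr None = y $ Inr None \<and> (\<forall>j. x $ Inr (Some j) = y $ Inr (Some j))"
proof safe
  assume *: "x $ Inl None = y $ Inl None" "\<forall>j. x $ Inl (Some j) = y $ Inl (Some j)"
    "x $ Inr None = y $ Inr None" "\<forall>j. x $ Inr (Some j) = y $ Inr (Some j)"
  have "x $ k = y $ k" for k
    using * by (cases k; rename_tac l; case_tac l) auto
  then show "x = y" by (simp add: vec_eq_iff)
qed

lemma linear_cr_vector: "Vector_Spaces.linear (*s) (*s) (cr_vector a)"
  by unfold_locales (simp_all add: vec_sum_option_eq_iff pairing_simps)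

lemma inj_cr_vector: "inj (cr_vector a)"
  by (auto simp: inj_def vec_sum_option_eq_iff vec_eq_iff)

lemma span_antiholomorphic:
  "vec.span (range (\<lambda>j. axis (Inr j) 1)) = {x :: complex ^ ('m::finite + 'm). \<forall>k. x $ Inl k = 0}"
proof (intro equalityI subsetI)
  have "vec.subspace {x :: complex ^ ('m + 'm). \<forall>k. x $ Inl k = 0}"
    by (auto simp: vec.subspace_def)
  then have "vec.span (range (\<lambda>j. axis (Inr j) 1)) \<subseteq> {x :: complex ^ ('m + 'm). \<forall>k. x $ Inl k = 0}"
    by (intro vec.span_minimal) (auto simp: axis_def)
  then show "x \<in> {x. \<forall>k. x $ Inl k = 0}" if "x \<in> vec.span (range (\<lambda>j. axis (Inr j) 1))"
    for x :: "complex ^ ('m + 'm)" using that by blast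
  fix x :: "complex ^ ('m + 'm)" assume x: "x \<in> {x. \<forall>k. x $ Inl k = 0}"
  have "x = (\<Sum>j\<in>UNIV. (x $ Inr j) *s axis (Inr j) 1)"
  proof (subst vec_eq_iff, intro allI)
    show "x $ k = (\<Sum>j\<in>UNIV. (x $ Inr j) *s axis (Inr j) 1) $ k" for k
      using x by (cases k) (simp_all add: axis_def if_distrib cong: if_cong)
  qed
  then show "x \<in> vec.span (range (\<lambda>j. axis (Inr j) 1))"
    by (metis (no_types, lifting) rangeI vec.span_base vec.span_scale vec.span_sum)
qed

lemma T01_iff: "x \<in> T01 M p \<longleftrightarrow> x \<in> complexified_tangent_space M p \<and> (\<forall>k. x $ Inl k = 0)"
  by (simp add: T01_def span_antiholomorphic)

text \<open>After complexification \<open>v\<close> and its conjugate become independent variables.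
  Setting the holomorphic components to 0 in the two linear equations of the tangent space leaves
  \<open>pairing b u = 0\<close> and a formula for the w-bar component.\<close>

lemma T01_graph:
  fixes M :: "(complex ^ 'n::finite option) set"
  assumes W: "open W" "M \<inter> W = {\<zeta> \<in> W. w_part \<zeta> = \<rho> (z_part \<zeta>)}" "\<zeta> \<in> M \<inter> W"
    and D: "(\<rho> has_derivative (\<lambda>v. pairing a v + pairing b (vcnj v))) (at (z_part \<zeta>))"
  shows "T01 M \<zeta> = cr_vector a ` {u. pairing b u = 0}"
proof -
  let ?D = "\<lambda>v. pairing a v + pairing b (vcnj v)"
  let ?R = "range (\<lambda>v. real_tangent_vector (point v (?D v)))"
  have CT: "complexified_tangent_space M \<zeta> = vec.span ?R"
    unfolding complexified_tangent_space_def tangent_space_graph[OF W D] by (simp add: image_image)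
  \<comment> \<open>The equation \<open>dw = d\<rho>\<close> and its conjugate, with the
    \<open>Inl\<close> and \<open>Inr\<close> coordinates treated as independent.\<close>
  let ?H = "{x :: complex ^ ('n option + 'n option).
      x $ Inl None = (\<Sum>j\<in>UNIV. a $ j * x $ Inl (Some j) + b $ j * x $ Inr (Some j)) \<and>
      x $ Inr None = (\<Sum>j\<in>UNIV. cnj (a $ j) * x $ Inr (Some j) + cnj (b $ j) * x $ Inl (Some j))}"
  have "vec.subspace ?H"
    by (auto simp: vec.subspace_def sum.distrib algebra_simps sum_distrib_left)
  moreover have "?R \<subseteq> ?H"
    by (auto simp: real_tangent_vector_def pairing_def sum.distrib)
  ultimately have span_H: "vec.span ?R \<subseteq> ?H" by (intro vec.span_minimal)
  show ?thesis
  proof (intro equalityI subsetI)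
    fix x assume "x \<in> T01 M \<zeta>"
    then have x: "x \<in> ?H" "x $ Inl k = 0" for k
      using span_H by (auto simp: T01_iff CT)
    let ?u = "\<chi> j. x $ Inr (Some j)"
    have "pairing b ?u = 0" "x = cr_vector a ?u"
      using x by (simp_all add: vec_sum_option_eq_iff pairing_def)
    then show "x \<in> cr_vector a ` {u. pairing b u = 0}" by blast
  next
    fix x assume "x \<in> cr_vector a ` {u. pairing b u = 0}"
    then obtain u where x: "x = cr_vector a u" and u: "pairing b u = 0" by blast
    let ?T = "\<lambda>v. real_tangent_vector (point v (?D v))"
    \<comment> \<open>The lift of the j-th antiholomorphic coordinate vector to the complexified
      tangent space. Its only holomorphic component is \<open>b $ j\<close> in the w-direction, and
      these cancel in the sum because \<open>pairing b u = 0\<close>.\<close>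
    define g where "g j = (1 / 2) *s (?T (axis j 1) + \<i> *s ?T (\<i> *s axis j 1))" for j
    have g: "g j $ Inl None = b $ j" "g j $ Inl (Some k) = 0"
        "g j $ Inr None = cnj (a $ j)" "g j $ Inr (Some k) = (if k = j then 1 else 0)" for j k
      by (simp_all add: g_def real_tangent_vector_def pairing_simps field_simps) (simp_all add: axis_def)
    have "x = (\<Sum>j\<in>UNIV. u $ j *s g j)"
      using u by (simp add: x vec_sum_option_eq_iff g pairing_def mult.commute)
        (simp add: if_distrib cong: if_cong)
    also have "\<dots> \<in> vec.span ?R"
      unfolding g_def by (intro vec.span_sum vec.span_scale vec.span_add vec.span_base) (rule rangeI)+
    finally have "x \<in> complexified_tangent_space M \<zeta>" by (simp add: CT)
    then show "x \<in> T01 M \<zeta>" by (simp add: T01_iff x)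
  qed
qed

lemma dim_T01_graph:
  fixes M :: "(complex ^ 'n::finite option) set"
  assumes "open W" "M \<inter> W = {\<zeta> \<in> W. w_part \<zeta> = \<rho> (z_part \<zeta>)}" "\<zeta> \<in> M \<inter> W"
    and "(\<rho> has_derivative (\<lambda>v. pairing a v + pairing b (vcnj v))) (at (z_part \<zeta>))"
  shows "vec.dim (T01 M \<zeta>) + (if b = 0 then 0 else 1) = CARD('n)"
proof -
  have "vec.dim (cr_vector a ` {u. pairing b u = 0}) = vec.dim {u. pairing b u = 0}"
    by (rule vec.dim_image_eq[OF linear_cr_vector inj_on_subset[OF inj_cr_vector]]) simp
  then show ?thesis
    unfolding T01_graph[OF assms] using dim_hyperplane[of b] by simp
qed

lemma norm_pairing_le: "norm (pairing a u) \<le> CARD('n) * norm a * norm u" for a u :: "complex ^ 'n"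
proof -
  have "norm (pairing a u) \<le> (\<Sum>j\<in>(UNIV::'n set). norm a * norm u)"
    unfolding pairing_def
    by (rule sum_norm_le) (auto simp: norm_mult intro!: mult_mono Finite_Cartesian_Product.norm_nth_le)
  then show ?thesis by simp
qed

lemma norm_vcnj [simp]: "norm (vcnj u) = norm u"
  by (simp add: norm_vec_def)

section \<open>The quadratic part and its antiholomorphic gradient\<close>

lemma sesquilinear_form_pairing: "sesquilinear_form A z = pairing (A *v z) (vcnj z)"
  by (simp add: sesquilinear_form_def pairing_def matrix_vector_mult_def sum_distrib_left mult_ac)

lemma quadratic_form_pairing: "quadratic_form B z = pairing (B *v z) z"
  by (simp add: quadratic_form_def pairing_def matrix_vector_mult_def sum_distrib_left mult_ac)

lemma pairing_transpose: "pairing (A *v x) y = pairing (transpose A *v y) x"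
  unfolding pairing_def matrix_vector_mult_def transpose_def
  by (simp add: sum_distrib_left sum_distrib_right mult_ac) (rule sum.swap)

lemma matrix_vector_mult_scaleR_complex: "M *v (t *\<^sub>R z) = t *\<^sub>R (M *v z)" for M :: "complex ^ 'n ^ 'm"
  by (simp add: vec_eq_iff matrix_vector_mult_def scaleR_sum_right)

lemma linear_matrix_vector_complex: "linear ((*v) P)" for P :: "complex ^ 'n ^ 'n"
  by (rule linearI) (simp_all add: matrix_vector_right_distrib matrix_vector_mult_scaleR_complex)

definition quadric :: "complex ^ 'n ^ 'n \<Rightarrow> complex ^ 'n ^ 'n \<Rightarrow> complex ^ 'n ^ 'n \<Rightarrow> complex ^ 'n \<Rightarrow> complex" where
  "quadric A B C z = sesquilinear_form A z + cnj (quadratic_form B z) + quadratic_form C z"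

text \<open>The gradient of \<open>quadric A B C\<close> in the conjugate variables when
  \<open>B\<close> is symmetric; the holomorphic form of \<open>C\<close> does not contribute. It is
  linear over \<real> only.\<close>

definition quadric_bar_gradient :: "complex ^ 'n ^ 'n \<Rightarrow> complex ^ 'n ^ 'n \<Rightarrow> complex ^ 'n \<Rightarrow> complex ^ 'n" where
  "quadric_bar_gradient A B z = A *v z + 2 *s vcnj (B *v z)"

lemma quadric_bar_gradient_scaleR:
  "quadric_bar_gradient A B (t *\<^sub>R z) = t *\<^sub>R quadric_bar_gradient A B z"
  by (simp add: quadric_bar_gradient_def matrix_vector_mult_scaleR_complex vec_eq_iff algebra_simps)

text \<open>Exact, since the form is quadratic; the symmetry of \<open>B\<close> merges its two
  cross terms, whence the factor 2 in the gradient.\<close>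

lemma quadric_taylor:
  assumes "transpose B = B"
  obtains a where "\<And>h. quadric A B C (z + h) =
    quadric A B C z + (pairing a h + pairing (quadric_bar_gradient A B z) (vcnj h)) + quadric A B C h"
proof
  fix h
  have B: "pairing (B *v h) z = pairing (B *v z) h" for z h
    using pairing_transpose[of B h z] assms by simp
  show "quadric A B C (z + h) = quadric A B C z +
    (pairing (transpose A *v vcnj z + C *v z + transpose C *v z) h +
     pairing (quadric_bar_gradient A B z) (vcnj h)) + quadric A B C h"
    by (simp add: quadric_def sesquilinear_form_pairing quadratic_form_pairing quadric_bar_gradient_def
        matrix_vector_right_distrib pairing_simps cnj_pairing[symmetric] B
        pairing_transpose[of A h "vcnj z"] pairing_transpose[of C h z])
qed

lemma quadric_bounded:
  fixes A B C :: "complex ^ 'n ^ 'n"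
  obtains K where "0 \<le> K" "\<And>z. norm (quadric A B C z) \<le> K * (norm z)\<^sup>2"
proof -
  have "\<exists>K\<ge>0. \<forall>z. norm (A *v z) \<le> K * norm z" for A :: "complex ^ 'n ^ 'n"
    using linear_bounded_pos[OF linear_matrix_vector_complex] less_imp_le by metis
  then obtain KA KB KC where K: "0 \<le> KA" "0 \<le> KB" "0 \<le> KC"
    "\<And>z. norm (A *v z) \<le> KA * norm z" "\<And>z. norm (B *v z) \<le> KB * norm z" "\<And>z. norm (C *v z) \<le> KC * norm z"
    by metis
  have *: "norm (pairing (M *v z) y) \<le> CARD('n) * k * (norm z)\<^sup>2"
    if "norm (M *v z) \<le> k * norm z" "norm y = norm z" for M :: "complex ^ 'n ^ 'n" and y z and k :: real
  proof -
    have "norm (pairing (M *v z) y) \<le> CARD('n) * norm (M *v z) * norm z"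
      using norm_pairing_le[of "M *v z" y] that by simp
    also have "\<dots> \<le> CARD('n) * (k * norm z) * norm z"
      using that by (intro mult_right_mono mult_left_mono) auto
    finally show ?thesis by (simp add: power2_eq_square mult_ac)
  qed
  show ?thesis
  proof
    show "0 \<le> CARD('n) * (KA + KB + KC)" using K by simp
    fix z
    have "norm (quadric A B C z) \<le> norm (sesquilinear_form A z) + norm (cnj (quadratic_form B z)) + norm (quadratic_form C z)"
      unfolding quadric_def by (intro norm_triangle_mono order_refl)
    also have "\<dots> \<le> CARD('n) * KA * (norm z)\<^sup>2 + CARD('n) * KB * (norm z)\<^sup>2 + CARD('n) * KC * (norm z)\<^sup>2"
      unfolding complex_mod_cnj sesquilinear_form_pairing quadratic_form_pairing
      by (intro add_mono *[OF K(4)] *[OF K(5)] *[OF K(6)]) simp_all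
    finally show "norm (quadric A B C z) \<le> CARD('n) * (KA + KB + KC) * (norm z)\<^sup>2"
      by (simp add: algebra_simps)
  qed
qed

lemma O3_E:
  assumes "O3 E"
  obtains r c where "0 < r" "0 \<le> c" "\<And>z. norm z < r \<Longrightarrow> norm (E z) \<le> c * norm z ^ 3"
proof -
  obtain c where "c > 0" "\<forall>\<^sub>F z in nhds 0. norm (E z) \<le> c * norm (complex_of_real (norm z ^ 3))"
    using assms unfolding O3_def bigo_def by blast
  moreover from this obtain r where "r > 0" "\<And>z. dist z 0 < r \<Longrightarrow> norm (E z) \<le> c * norm (complex_of_real (norm z ^ 3))"
    unfolding eventually_nhds_metric by blast
  ultimately show ?thesis
    by (intro that[of r c]) (auto simp: norm_power)
qed

lemma O3_I:
  assumes "0 < r" "\<And>z. norm z < r \<Longrightarrow> norm (E z) \<le> c * norm z ^ 3"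
  shows "O3 E"
  unfolding O3_def
proof (rule bigoI)
  show "\<forall>\<^sub>F z in nhds 0. norm (E z) \<le> c * norm (complex_of_real (norm z ^ 3))"
    unfolding eventually_nhds_metric using assms by (auto simp: norm_power intro!: exI[of _ r])
qed

text \<open>Since \<open>E\<close> is only known to be small, its derivative \<open>e\<close> is controlled by comparing increments of
  size \<open>\<bar>z\<bar>\<^sup>3\<^sup>/\<^sup>2\<close>, which balances the cubic bound on \<open>E\<close> against the quadratic Taylor remainder.\<close>

lemma graph_bar_gradient:
  fixes \<rho> :: "complex ^ 'n \<Rightarrow> complex"
  assumes an: "real_analytic_on \<rho> U" "0 \<in> U" and B: "transpose B = B"
    and ev: "\<forall>\<^sub>F z in nhds 0. \<rho> z = quadric A B C z + E z" and E: "O3 E"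
  obtains r c a b where "0 < r"
    "\<And>z. z \<in> ball 0 r \<Longrightarrow> (\<rho> has_derivative (\<lambda>v. pairing (a z) v + pairing (b z) (vcnj v))) (at z)"
    "continuous_on (ball 0 r) b"
    "\<And>z. z \<in> ball 0 r \<Longrightarrow> z \<noteq> 0 \<Longrightarrow> norm (b z - quadric_bar_gradient A B z) \<le> c * (norm z * sqrt (norm z))"
proof -
  obtain r0 K D where r0: "0 < r0" "0 \<le> K" and lin: "\<And>x. x \<in> ball 0 r0 \<Longrightarrow> linear (D x)"
    and rem: "\<And>x h. x \<in> ball 0 r0 \<Longrightarrow> norm h < r0 \<Longrightarrow> norm (\<rho> (x + h) - \<rho> x - D x h) \<le> K * (norm h)\<^sup>2"
    using real_analytic_taylor[OF an] by metis
  obtain r1 c1 where r1: "0 < r1" "0 \<le> c1" and Ebound: "\<And>z. norm z < r1 \<Longrightarrow> norm (E z) \<le> c1 * norm z ^ 3"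
    using O3_E[OF E] by metis
  obtain r2 where r2: "0 < r2" and expand: "\<And>z. norm z < r2 \<Longrightarrow> \<rho> z = quadric A B C z + E z"
    using ev unfolding eventually_nhds_metric by auto
  obtain KQ where KQ: "0 \<le> KQ" "\<And>z. norm (quadric A B C z) \<le> KQ * (norm z)\<^sup>2"
    using quadric_bounded by metis
  \<comment> \<open>The \<open>1\<close> gives \<open>sqrt (norm z) \<le> 1\<close> and hence
    \<open>\<delta> \<le> norm z\<close>; the factor 1/2 keeps \<open>z + h\<close>, of norm at most
    \<open>2 * norm z\<close>, where the bound on \<open>E\<close> and the expansion hold; 1/4 is
    the range of the Lipschitz estimate.\<close>
  define r where "r = min 1 (min (r0 / 4) (min (r1 / 2) (r2 / 2)))"
  have r: "0 < r" "r \<le> 1" "r \<le> r0 / 4" "r \<le> r1 / 2" "r \<le> r2 / 2"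
    using r0 r1 r2 by (auto simp: r_def)
  define a where "a z = wirtinger (D z)" for z
  define b where "b z = wirtinger_bar (D z)" for z
  have D_eq: "D z = (\<lambda>v. pairing (a z) v + pairing (b z) (vcnj v))" if "z \<in> ball 0 r" for z
    using real_linear_wirtinger[OF lin, of z] that r r0 by (auto simp: a_def b_def fun_eq_iff)
  have deriv: "(\<rho> has_derivative (\<lambda>v. pairing (a z) v + pairing (b z) (vcnj v))) (at z)" if "z \<in> ball 0 r" for z
    unfolding D_eq[OF that, symmetric]
    using that r r0 by (intro taylor_imp_has_derivative[OF lin r0(1) rem]) auto
  have cont: "continuous_on (ball 0 r) b"
  proof (rule continuous_on_subset)
    show "continuous_on (ball 0 (r0 / 4)) b"
    proof (rule lipschitz_on_continuous_on)
      show "(CARD('n) * (6 * K))-lipschitz_on (ball 0 (r0 / 4)) b"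
      proof (rule lipschitz_onI)
        fix x y :: "complex ^ 'n" assume x: "x \<in> ball 0 (r0 / 4)" and y: "y \<in> ball 0 (r0 / 4)"
        have "b x - b y = wirtinger_bar (\<lambda>v. D x v - D y v)"
          by (simp add: b_def wirtinger_bar_diff)
        also have "norm \<dots> \<le> CARD('n) * (6 * K * norm (x - y))"
          by (intro norm_wirtinger_bar_le taylor_imp_lipschitz_derivative[OF r0(2) lin rem y x])
        finally show "dist (b x) (b y) \<le> CARD('n) * (6 * K) * dist x y"
          by (simp add: dist_norm)
      qed (use r0 in simp)
    qed
  qed (use r in auto)
  have approx: "norm (b z - quadric_bar_gradient A B z) \<le> CARD('n) * (10 * c1 + K + KQ) * (norm z * sqrt (norm z))"
    if z: "z \<in> ball 0 r" "z \<noteq> 0" for z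
  proof -
    obtain q where q: "\<And>h. quadric A B C (z + h) = quadric A B C z +
        (pairing q h + pairing (quadric_bar_gradient A B z) (vcnj h)) + quadric A B C h"
      using quadric_taylor[OF B] by metis
    let ?DQ = "\<lambda>v. pairing q v + pairing (quadric_bar_gradient A B z) (vcnj v)"
    define e where "e v = D z v - ?DQ v" for v
    define \<delta> where "\<delta> = norm z * sqrt (norm z)"
    have zr: "norm z < r" using z by simp
    have \<delta>: "\<delta> \<le> norm z" "0 < \<delta>" "\<delta>\<^sup>2 = norm z ^ 3"
      using zr r z(2) mult_left_mono[of "sqrt (norm z)" 1 "norm z"]
      by (auto simp: \<delta>_def power_mult_distrib power2_eq_square power3_eq_cube)
    have e_scale: "e (s *\<^sub>R v) = s *\<^sub>R e v" for s v
      unfolding e_def D_eq[OF z(1)] by (simp add: pairing_simps algebra_simps scaleR_diff_right scaleR_add_right)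
    have small: "norm (e h) \<le> (10 * c1 + K + KQ) * \<delta>\<^sup>2" if h: "norm h = \<delta>" for h
    proof -
      have zh: "norm (z + h) \<le> 2 * norm z"
        using norm_triangle_ineq[of z h] h \<delta> by linarith
      have E1: "norm (E (z + h)) \<le> c1 * (8 * norm z ^ 3)"
      proof -
        have "norm (E (z + h)) \<le> c1 * norm (z + h) ^ 3" using zh zr r by (intro Ebound) linarith
        also have "\<dots> \<le> c1 * (2 * norm z) ^ 3" using zh r1 by (intro mult_left_mono power_mono) auto
        finally show ?thesis by (simp add: power_mult_distrib)
      qed
      have E0: "norm (E z) \<le> c1 * norm z ^ 3" using zr r r1 by (intro Ebound) linarith
      have R: "norm (\<rho> (z + h) - \<rho> z - D z h) \<le> K * \<delta>\<^sup>2"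
        using rem[of z h] zr r r0 h \<delta> by auto
      have "e h = E (z + h) - E z - (\<rho> (z + h) - \<rho> z - D z h) + quadric A B C h"
        using expand[of z] expand[of "z + h"] zr zh r r2 q[of h] by (auto simp: e_def)
      also have "norm \<dots> \<le> norm (E (z + h)) + norm (E z) + norm (\<rho> (z + h) - \<rho> z - D z h) + norm (quadric A B C h)"
        by (intro norm_triangle_mono norm_triangle_le_diff add_mono order_refl)
      also have "\<dots> \<le> c1 * (8 * norm z ^ 3) + c1 * norm z ^ 3 + K * \<delta>\<^sup>2 + KQ * \<delta>\<^sup>2"
        using KQ(2)[of h] h by (intro add_mono E1 E0 R) auto
      \<comment> \<open>The 8 from \<open>(2 * norm z) ^ 3\<close> and the 1 from \<open>E z\<close>
        make 9, rounded up to 10; all terms are of order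
        \<open>\<delta>\<^sup>2 = norm z ^ 3\<close>.\<close>
      also have "\<dots> \<le> (10 * c1 + K + KQ) * \<delta>\<^sup>2"
        using r1(2) by (simp add: \<delta>(3) algebra_simps)
      finally show ?thesis .
    qed
    \<comment> \<open>By homogeneity the estimate on the sphere of radius \<open>\<delta>\<close>
      becomes an operator bound, at the cost of one factor \<open>\<delta>\<close>.\<close>
    have "norm (e v) \<le> (10 * c1 + K + KQ) * \<delta> * norm v" for v
    proof (cases "v = 0")
      case True
      then show ?thesis using e_scale[of 0 0] by simp
    next
      case False
      have "norm (e ((\<delta> / norm v) *\<^sub>R v)) \<le> (10 * c1 + K + KQ) * \<delta>\<^sup>2"
        using False \<delta> by (intro small) simp
      then have "\<delta> / norm v * norm (e v) \<le> (10 * c1 + K + KQ) * \<delta>\<^sup>2"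
        using \<delta> by (simp add: e_scale)
      then have "\<delta> * norm (e v) \<le> \<delta> * ((10 * c1 + K + KQ) * \<delta> * norm v)"
        using False by (simp add: field_simps power2_eq_square)
      then show ?thesis using \<delta>(2) by (simp only: mult_le_cancel_left_pos)
    qed
    then have "norm (wirtinger_bar e) \<le> CARD('n) * ((10 * c1 + K + KQ) * \<delta>)"
      by (rule norm_wirtinger_bar_le)
    moreover have "wirtinger_bar e = b z - quadric_bar_gradient A B z"
      unfolding e_def wirtinger_bar_diff b_def by simp
    ultimately show ?thesis by (simp add: \<delta>_def mult_ac)
  qed
  show ?thesis
    by (rule that[OF r(1) deriv cont approx])
qed

section \<open>From the bundle to the rank condition\<close>

lemma hyperplane_unique:
  fixes a b :: "complex ^ 'n"
  assumes N: "vec.subspace N" "vec.dim N + 1 = CARD('n)" and "a \<noteq> 0"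
    and Na: "\<And>u. u \<in> N \<Longrightarrow> pairing a u = 0" and Nb: "\<And>u. u \<in> N \<Longrightarrow> pairing b u = 0"
  shows "b \<in> vec.span {a}"
proof -
  obtain j where j: "a $ j \<noteq> 0" using \<open>a \<noteq> 0\<close> by (auto simp: vec_eq_iff)
  have "N = {u. pairing a u = 0}"
    using dim_hyperplane[of a] \<open>a \<noteq> 0\<close> N Na
    by (intro vec.subspace_dim_equal subspace_hyperplane) auto
  \<comment> \<open>These test vectors lie in the kernel of \<open>a\<close>, hence in
    \<open>N\<close>, and express every coordinate of \<open>b\<close> by its j-th one.\<close>
  then have *: "pairing b (axis k 1 - (a $ k / a $ j) *s axis j 1) = 0" for k
    using j by (intro Nb) (simp add: pairing_simps)
  have coord: "b $ k = (b $ j / a $ j) * a $ k" for k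
    using *[of k] by (simp add: pairing_simps)
  have "b = (b $ j / a $ j) *s a"
    by (subst vec_eq_iff, intro allI, subst coord) simp
  then show ?thesis
    unfolding vec.span_singleton by blast
qed

lemma real_analytic_on_nth_isCont:
  fixes s :: "'a::euclidean_space \<Rightarrow> complex ^ 'k"
  assumes "real_analytic_on s W" "p \<in> W"
  shows "isCont (\<lambda>x. s x $ k) p"
proof -
  have "bounded_linear (\<lambda>x :: complex ^ 'k. x $ k)"
    by (rule bounded_linear_vec_nth)
  from real_analytic_on_bounded_linear[OF this assms(1)] show ?thesis
    by (rule real_analytic_on_isCont) (rule assms(2))
qed

text \<open>\<open>N\<close> is read off from the fibre of the bundle at the origin. It does not
  depend on \<open>z\<close> because the frame at 0 is the limit of the frame along every ray, while
  the relation surviving in the limit is the one with \<open>L z\<close>.\<close>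

lemma CR_image_kernel:
  fixes M :: "(complex ^ 'n::finite option) set"
  assumes graph: "graph_near_0 M \<rho>" and B: "transpose B = B"
    and ev: "\<forall>\<^sub>F z in nhds 0. \<rho> z = quadric A B C z + E z" and E: "O3 E"
    and "CR_image M" and z0: "quadric_bar_gradient A B z0 \<noteq> 0"
  obtains N where "vec.subspace N" "vec.dim N + 1 = CARD('n)"
    "\<And>u z. u \<in> N \<Longrightarrow> pairing (quadric_bar_gradient A B z) u = 0"
proof -
  let ?L = "quadric_bar_gradient A B"
  obtain U0 W0 where U0: "0 \<in> U0" "real_analytic_on \<rho> U0"
    and W0: "open W0" "0 \<in> W0" "M \<inter> W0 = {\<zeta> \<in> W0. w_part \<zeta> = \<rho> (z_part \<zeta>)}"
    using graph unfolding graph_near_0_def by blast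
  obtain r c a b where r: "0 < r"
    and deriv: "\<And>z. z \<in> ball 0 r \<Longrightarrow> (\<rho> has_derivative (\<lambda>v. pairing (a z) v + pairing (b z) (vcnj v))) (at z)"
    and b_cont: "continuous_on (ball 0 r) b"
    and b_approx: "\<And>z. z \<in> ball 0 r \<Longrightarrow> z \<noteq> 0 \<Longrightarrow> norm (b z - ?L z) \<le> c * (norm z * sqrt (norm z))"
    by (rule graph_bar_gradient[OF U0(2,1) B ev E]) (rule that; blast)
  have \<rho>0: "\<rho> 0 = 0"
  proof -
    obtain r c where "0 < r" "\<And>z. norm z < r \<Longrightarrow> norm (E z) \<le> c * norm z ^ 3"
      using O3_E[OF E] by metis
    then have "E 0 = 0" using norm_le_zero_iff by (metis mult_zero_right norm_zero zero_power zero_less_numeral)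
    then show ?thesis
      using eventually_nhds_x_imp_x[OF ev]
      by (simp add: quadric_def sesquilinear_form_pairing quadratic_form_pairing pairing_simps)
  qed
  define W where "W = W0 \<inter> {\<zeta>. z_part \<zeta> \<in> ball 0 r}"
  have z_cont: "continuous_on UNIV z_part"
    by (rule linear_continuous_on[OF bounded_linear_z_part])
  have W: "open W" "0 \<in> W" "M \<inter> W = {\<zeta> \<in> W. w_part \<zeta> = \<rho> (z_part \<zeta>)}"
  proof -
    have "open (z_part -` ball 0 r)"
      by (rule open_vimage[OF open_ball z_cont])
    then show "open W" using W0(1) by (auto simp: W_def vimage_def intro!: open_Int)
    show "0 \<in> W" using W0(2) r by (simp add: W_def z_part_def zero_vec_def[symmetric])
    show "M \<inter> W = {\<zeta> \<in> W. w_part \<zeta> = \<rho> (z_part \<zeta>)}" using W0(3) unfolding W_def by blast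
  qed
  have T01_eq: "T01 M \<zeta> = cr_vector (a (z_part \<zeta>)) ` {u. pairing (b (z_part \<zeta>)) u = 0}"
    and dim_eq: "vec.dim (T01 M \<zeta>) + (if b (z_part \<zeta>) = 0 then 0 else 1) = CARD('n)" if "\<zeta> \<in> M \<inter> W" for \<zeta>
    using T01_graph[OF W(1,3) that deriv] dim_T01_graph[OF W(1,3) that deriv] that by (auto simp: W_def)
  \<comment> \<open>Where \<open>b\<close> does not vanish the dimension is n - 1, and by continuity
    of \<open>b\<close> this is an open condition.\<close>
  have CR: "\<zeta> \<in> CR_points M" if \<zeta>: "\<zeta> \<in> M \<inter> W" and nz: "b (z_part \<zeta>) \<noteq> 0" for \<zeta>
  proof -
    have "open (ball 0 r \<inter> b -` (- {0}))"
      by (rule continuous_open_preimage[OF b_cont]) auto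
    then have "open (z_part -` (ball 0 r \<inter> b -` (- {0})))"
      by (rule open_vimage[OF _ z_cont])
    then have "open (W \<inter> z_part -` (ball 0 r \<inter> b -` (- {0})))"
      using W(1) by blast
    moreover have "\<zeta> \<in> W \<inter> z_part -` (ball 0 r \<inter> b -` (- {0}))"
      using \<zeta> nz by (simp add: W_def)
    moreover have "vec.dim (T01 M \<xi>) = vec.dim (T01 M \<zeta>)"
      if "\<xi> \<in> M \<inter> (W \<inter> z_part -` (ball 0 r \<inter> b -` (- {0})))" for \<xi>
      using dim_eq[of \<xi>] dim_eq[OF \<zeta>] that nz by auto
    ultimately show ?thesis
      unfolding CR_points_def using \<zeta> by blast
  qed
  obtain V where V: "real_analytic_subbundle M V" "\<And>p. p \<in> CR_points M \<Longrightarrow> V p = T01 M p"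
    using \<open>CR_image M\<close> unfolding CR_image_def by blast
  have zero: "0 \<in> M \<inter> W"
    unfolding W(3) using W(2) \<rho>0 by (simp add: z_part_def w_part_def zero_vec_def[symmetric])
  then have "0 \<in> M" by blast
  obtain W1 s and k :: nat where W1: "open W1" "0 \<in> W1" and s_an': "\<forall>i<k. real_analytic_on (s i) W1"
    and frame': "\<forall>q\<in>M \<inter> W1. inj_on (\<lambda>i. s i q) {..<k} \<and>
       vec.independent ((\<lambda>i. s i q) ` {..<k}) \<and> V q = vec.span ((\<lambda>i. s i q) ` {..<k})"
    using V(1)[unfolded real_analytic_subbundle_def, THEN conjunct2, THEN bspec, OF \<open>0 \<in> M\<close>]
    by blast
  have s_an: "real_analytic_on (s i) W1" if "i < k" for i
    using s_an' that by simp
  have frame: "inj_on (\<lambda>i. s i q) {..<k} \<and>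
       vec.independent ((\<lambda>i. s i q) ` {..<k}) \<and> V q = vec.span ((\<lambda>i. s i q) ` {..<k})"
    if "q \<in> M \<inter> W1" for q
    using bspec[OF frame' that] .
  have dim_V: "vec.dim (V q) = k" if "q \<in> M \<inter> W1" for q
    using frame[OF that] by (simp add: vec.dim_eq_card_independent card_image)
  define u where "u i \<zeta> = (\<chi> j. s i \<zeta> $ Inr (Some j))" for i \<zeta>
  have lims: "(\<forall>i<k. (\<forall>l. s i 0 $ Inl l = 0) \<and> pairing (?L z) (u i 0) = 0) \<and> k + 1 = CARD('n)"
    if z: "?L z \<noteq> 0" for z
  proof -
    have "z \<noteq> 0" using z by (auto simp: quadric_bar_gradient_def)
    define \<zeta> where "\<zeta> t = point (t *\<^sub>R z) (\<rho> (t *\<^sub>R z))" for t :: real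
    have tz: "((\<lambda>t. t *\<^sub>R z) \<longlongrightarrow> 0) (at_right 0)"
      by (auto intro!: tendsto_eq_intros)
    have "isCont \<rho> 0" using deriv[of 0] r has_derivative_continuous by force
    then have \<rho>_lim: "((\<lambda>t. \<rho> (t *\<^sub>R z)) \<longlongrightarrow> 0) (at_right 0)"
      using isCont_tendsto_compose[OF _ tz] \<rho>0 by fastforce
    have \<zeta>_lim: "(\<zeta> \<longlongrightarrow> 0) (at_right 0)"
      unfolding \<zeta>_def
      using bounded_linear.tendsto[OF bounded_linear_point tendsto_Pair[OF tz \<rho>_lim]] by (simp add: point_simps)
    have ball: "\<forall>\<^sub>F t in at_right 0. t *\<^sub>R z \<in> ball 0 r"
      using tz r by (intro topological_tendstoD) auto
    \<comment> \<open>The error of \<open>b\<close> at \<open>t z\<close> is of order t^(3/2), so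
      after division by \<open>t\<close> a factor \<open>sqrt t\<close> remains.\<close>
    have "((\<lambda>t. b (t *\<^sub>R z) /\<^sub>R t) \<longlongrightarrow> ?L z) (at_right 0)"
    proof (rule Lim_transform[of "\<lambda>_. ?L z"])
      have "\<forall>\<^sub>F t in at_right 0. norm (b (t *\<^sub>R z) /\<^sub>R t - ?L z) \<le> c * (norm z * sqrt (t * norm z))"
        using ball eventually_at_right_less[of 0]
      proof eventually_elim
        case (elim t)
        have "b (t *\<^sub>R z) /\<^sub>R t - ?L z = (b (t *\<^sub>R z) - ?L (t *\<^sub>R z)) /\<^sub>R t"
          using elim by (simp add: quadric_bar_gradient_scaleR scaleR_diff_right)
        also have "norm \<dots> \<le> (c * (norm (t *\<^sub>R z) * sqrt (norm (t *\<^sub>R z)))) / t"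
          using b_approx[OF elim(1)] elim \<open>z \<noteq> 0\<close> by (simp add: divide_right_mono divide_inverse_commute)
        finally show ?case using elim by simp
      qed
      moreover have "((\<lambda>t. c * (norm z * sqrt (t * norm z))) \<longlongrightarrow> 0) (at_right 0)"
        by (auto intro!: tendsto_eq_intros)
      ultimately show "((\<lambda>t. b (t *\<^sub>R z) /\<^sub>R t - ?L z) \<longlongrightarrow> 0) (at_right 0)"
        by (rule Lim_null_comparison)
    qed simp
    note b_lim = this
    have nz: "\<forall>\<^sub>F t in at_right 0. b (t *\<^sub>R z) /\<^sub>R t \<noteq> 0"
      using b_lim z by (rule tendsto_imp_eventually_ne)
    have inW: "\<forall>\<^sub>F t in at_right 0. \<zeta> t \<in> W" "\<forall>\<^sub>F t in at_right 0. \<zeta> t \<in> W1"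
      using \<zeta>_lim W W1 by (auto intro!: topological_tendstoD)
    have main: "\<forall>\<^sub>F t in at_right 0. k + 1 = CARD('n) \<and>
        (\<forall>i<k. (\<forall>l. s i (\<zeta> t) $ Inl l = 0) \<and> pairing (b (t *\<^sub>R z) /\<^sub>R t) (u i (\<zeta> t)) = 0)"
      using nz inW
    proof eventually_elim
      case (elim t)
      have zt: "z_part (\<zeta> t) = t *\<^sub>R z" by (simp add: \<zeta>_def)
      have MW: "\<zeta> t \<in> M \<inter> W" unfolding W(3) using elim by (simp add: \<zeta>_def)
      have MW1: "\<zeta> t \<in> M \<inter> W1" using MW elim by blast
      have bt: "b (z_part (\<zeta> t)) \<noteq> 0" using elim by (auto simp: zt)
      have Vt: "V (\<zeta> t) = T01 M (\<zeta> t)" by (rule V(2)[OF CR[OF MW bt]])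
      have "k + 1 = CARD('n)"
        using dim_eq[OF MW] dim_V[OF MW1] bt Vt by simp
      moreover have "(\<forall>l. s i (\<zeta> t) $ Inl l = 0) \<and> pairing (b (t *\<^sub>R z)) (u i (\<zeta> t)) = 0" if "i < k" for i
      proof -
        have "s i (\<zeta> t) \<in> vec.span ((\<lambda>i. s i (\<zeta> t)) ` {..<k})"
          by (rule vec.span_base) (use that in simp)
        then have "s i (\<zeta> t) \<in> V (\<zeta> t)"
          using frame[OF MW1] by simp
        then obtain v where "pairing (b (t *\<^sub>R z)) v = 0" "s i (\<zeta> t) = cr_vector (a (t *\<^sub>R z)) v"
          unfolding Vt T01_eq[OF MW] zt by blast
        moreover from this have "u i (\<zeta> t) = v" by (simp add: u_def vec_eq_iff)
        ultimately show ?thesis by simp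
      qed
      ultimately show ?case by (simp add: pairing_simps)
    qed
    then have "k + 1 = CARD('n)"
      using eventually_happens[OF main] by auto
    moreover have "(\<forall>l. s i 0 $ Inl l = 0) \<and> pairing (?L z) (u i 0) = 0" if i: "i < k" for i
    proof
      have s_lim: "((\<lambda>t. s i (\<zeta> t) $ l) \<longlongrightarrow> s i 0 $ l) (at_right 0)" for l
        using real_analytic_on_nth_isCont[OF s_an[OF i] W1(2)] \<zeta>_lim by (rule isCont_tendsto_compose)
      show "\<forall>l. s i 0 $ Inl l = 0"
      proof
        fix l
        have "\<forall>\<^sub>F t in at_right 0. s i (\<zeta> t) $ Inl l = 0"
          using main by eventually_elim (use i in blast)
        then have "((\<lambda>t. s i (\<zeta> t) $ Inl l) \<longlongrightarrow> 0) (at_right 0)"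
          by (rule tendsto_eventually)
        with s_lim[of "Inl l"] show "s i 0 $ Inl l = 0"
          using tendsto_unique trivial_limit_at_right_real by blast
      qed
      have "((\<lambda>t. pairing (b (t *\<^sub>R z) /\<^sub>R t) (u i (\<zeta> t))) \<longlongrightarrow> pairing (?L z) (u i 0)) (at_right 0)"
        unfolding pairing_def u_def vec_lambda_beta
        by (intro tendsto_intros s_lim tendsto_vec_nth b_lim)
      moreover have "((\<lambda>t. pairing (b (t *\<^sub>R z) /\<^sub>R t) (u i (\<zeta> t))) \<longlongrightarrow> 0) (at_right 0)"
        by (rule tendsto_eventually) (use main i in \<open>auto elim: eventually_mono\<close>)
      ultimately show "pairing (?L z) (u i 0) = 0"
        using tendsto_unique trivial_limit_at_right_real by blast
    qed
    ultimately show ?thesis by blast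
  qed
  \<comment> \<open>To have dimension n - 1, \<open>N\<close> must see all of \<open>V 0\<close>.
    This holds because \<open>V 0\<close> is tangent and, by the limits just taken, has no
    holomorphic components; so it lies in \<open>T01 M 0\<close> and in the range of
    \<open>cr_vector (a 0)\<close>.\<close>
  define N where "N = {v. cr_vector (a 0) v \<in> V 0}"
  have V0: "V 0 = vec.span ((\<lambda>i. s i 0) ` {..<k})"
    using frame[of 0] \<open>0 \<in> M\<close> W1(2) by blast
  have "V 0 \<subseteq> {x. \<forall>l. x $ Inl l = 0}"
    unfolding V0
  proof (rule vec.span_minimal)
    show "vec.subspace {x :: complex ^ ('n option + 'n option). \<forall>l. x $ Inl l = 0}"
      by (auto simp: vec.subspace_def)
  qed (use lims[OF z0] in auto)
  moreover have "V 0 \<subseteq> complexified_tangent_space M 0"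
    using V(1) \<open>0 \<in> M\<close> unfolding real_analytic_subbundle_def by blast
  ultimately have "V 0 \<subseteq> T01 M 0" unfolding T01_def span_antiholomorphic by blast
  then have "V 0 \<subseteq> range (cr_vector (a 0))"
    unfolding T01_eq[OF zero] by (auto simp: z_part_def zero_vec_def[symmetric])
  then have "V 0 = cr_vector (a 0) ` N" by (auto simp: N_def)
  moreover have "vec.dim (cr_vector (a 0) ` N) = vec.dim N"
    by (rule vec.dim_image_eq[OF linear_cr_vector inj_on_subset[OF inj_cr_vector]]) simp
  ultimately have "vec.dim N + 1 = CARD('n)"
    using dim_V[of 0] \<open>0 \<in> M\<close> W1(2) lims[OF z0] by simp
  moreover have "vec.subspace N"
    using vec.linear_subspace_linear_preimage[OF linear_cr_vector, of "V 0" "a 0"]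
    by (simp add: N_def V0)
  moreover have ker: "pairing (?L z) v = 0" if "v \<in> N" for v z
  proof (cases "?L z = 0")
    case False
    have "V 0 \<subseteq> {x. pairing (?L z) (\<chi> j. x $ Inr (Some j)) = 0}"
      unfolding V0
    proof (rule vec.span_minimal)
      show "vec.subspace {x :: complex ^ ('n option + 'n option). pairing (?L z) (\<chi> j. x $ Inr (Some j)) = 0}"
        by (auto simp: vec.subspace_def pairing_def sum.distrib algebra_simps sum_distrib_left[symmetric])
    qed (use lims[OF False] in \<open>auto simp: u_def\<close>)
    then show ?thesis
      using that by (auto simp: N_def vec_lambda_eta)
  qed (simp add: pairing_simps)
  ultimately show ?thesis using that[OF _ _ ker] by blast
qed

lemma rank_le_1I:
  assumes "\<And>x y. x \<in> rows R \<Longrightarrow> y \<in> rows R \<Longrightarrow> x \<noteq> 0 \<Longrightarrow> y \<in> vec.span {x}"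
  shows "rank R \<le> 1"
proof -
  have "\<exists>x. rows R \<subseteq> vec.span {x}"
    using assms vec.span_zero by (metis subsetI)
  then obtain x where "rows R \<subseteq> vec.span {x}" by blast
  then have "vec.dim (rows R) \<le> card {x}" by (intro vec.dim_le_card) auto
  then show ?thesis by (simp add: row_rank_def_gen)
qed

text \<open>Rows of \<open>conj_transpose A\<close> are conjugated columns of \<open>A\<close>, and
  rows of the symmetric \<open>B\<close> are its columns. So the conjugates of all rows annihilate
  the same space of dimension n - 1, whose annihilator is a line.\<close>

lemma CR_image_rank_le_1:
  fixes M :: "(complex ^ 'n::finite option) set"
  assumes graph: "graph_near_0 M \<rho>" and B: "transpose B = B"
    and ev: "\<forall>\<^sub>F z in nhds 0. \<rho> z = quadric A B C z + E z" and E: "O3 E" and "CR_image M"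
  shows "rank (stack (conj_transpose A) B) \<le> 1"
proof (rule rank_le_1I)
  let ?L = "quadric_bar_gradient A B"
  let ?R = "stack (conj_transpose A) B"
  have B_sym: "B $ i $ j = B $ j $ i" for i j
    using arg_cong[OF B, of "\<lambda>X. X $ j $ i"] by (simp add: transpose_def)
  have col: "M *v axis i 1 = column i M" for M :: "complex ^ 'n ^ 'n" and i
    by (simp add: vec_eq_iff matrix_vector_mult_def column_def axis_def if_distrib cong: if_cong)
  have rowsE: "(\<exists>i. vcnj x = A *v axis i 1) \<or> (\<exists>i. x = B *v axis i 1)" if "x \<in> rows ?R" for x
  proof -
    obtain k where x: "x = row k ?R" using \<open>x \<in> rows ?R\<close> by (auto simp: rows_def)
    show ?thesis
    proof (cases k)
      case (Inl i)
      then have "vcnj x = A *v axis i 1"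
        by (simp add: x row_def stack_def conj_transpose_def col column_def vec_eq_iff)
      then show ?thesis by blast
    next
      case (Inr i)
      then have "x = B *v axis i 1"
        using B_sym by (simp add: x row_def stack_def col column_def vec_eq_iff)
      then show ?thesis by blast
    qed
  qed
  \<comment> \<open>Passing from \<open>z\<close> to \<open>\<i> *s z\<close> multiplies the first
    term of \<open>?L\<close> by \<open>\<i>\<close> and the conjugated one by
    \<open>- \<i>\<close>, so both are annihilated separately.\<close>
  have split: "pairing (A *v z) u = 0 \<and> pairing (vcnj (B *v z)) u = 0"
    if "\<And>z. pairing (?L z) u = 0" for u z
    using that[of z] that[of "\<i> *s z"]
    by (simp add: quadric_bar_gradient_def pairing_simps vector_scalar_commute)
  fix x y assume x: "x \<in> rows ?R" and y: "y \<in> rows ?R" and "x \<noteq> 0"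
  have "\<exists>z. ?L z \<noteq> 0"
  proof (rule ccontr)
    assume "\<nexists>z. ?L z \<noteq> 0"
    then have "pairing (?L z) u = 0" for z u by (simp add: pairing_simps)
    then have *: "pairing (A *v z) u = 0" "pairing (vcnj (B *v z)) u = 0" for z u using split by auto
    have "(A *v z) $ j = 0" "(B *v z) $ j = 0" for z j
      using *[of z "axis j 1"] by (simp_all add: pairing_simps)
    then have "A *v z = 0" "B *v z = 0" for z by (simp_all add: vec_eq_iff)
    then show False using rowsE[OF x] \<open>x \<noteq> 0\<close> by auto
  qed
  then obtain z0 where z0: "?L z0 \<noteq> 0" by blast
  obtain N where N: "vec.subspace N" "vec.dim N + 1 = CARD('n)"
      "\<And>u z. u \<in> N \<Longrightarrow> pairing (?L z) u = 0"
    using CR_image_kernel[OF graph B ev E \<open>CR_image M\<close> z0] by metis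
  have "pairing (vcnj x) u = 0" if "x \<in> rows ?R" "u \<in> N" for x u
    using rowsE[OF that(1)] split[OF N(3)[OF that(2)]] by auto
  then have "vcnj y \<in> vec.span {vcnj x}"
    using x y \<open>x \<noteq> 0\<close> by (intro hyperplane_unique[OF N(1,2)]) auto
  then obtain c where "vcnj y = c *s vcnj x" by (auto simp: vec.span_singleton)
  then have "y = cnj c *s x" by (metis vcnj_simps(1,3))
  then show "y \<in> vec.span {x}" by (auto simp: vec.span_singleton)
qed

section \<open>Normal forms\<close>

lemma real_analytic_shear:
  fixes \<rho> :: "complex ^ 'n::finite \<Rightarrow> complex"
  assumes "real_analytic_on \<rho> U"
  shows "real_analytic_on (\<lambda>\<zeta>. point (z_part \<zeta>) (w_part \<zeta> + c * \<rho> (z_part \<zeta>))) {\<zeta>. z_part \<zeta> \<in> U}"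
proof (rule real_analytic_on_vec)
  fix k :: "'n option"
  have nth: "real_analytic_on (\<lambda>\<zeta> :: complex ^ 'n option. \<zeta> $ l) V" for l V
    by (intro real_analytic_on_linear bounded_linear.linear bounded_linear_vec_nth)
  have "real_analytic_on (\<lambda>\<zeta>. \<rho> (z_part \<zeta>)) {\<zeta>. z_part \<zeta> \<in> U}"
    by (rule real_analytic_on_compose_linear[OF assms bounded_linear.linear[OF bounded_linear_z_part]]) auto
  then have "real_analytic_on (\<lambda>\<zeta>. \<zeta> $ None + c * \<rho> (z_part \<zeta>)) {\<zeta>. z_part \<zeta> \<in> U}"
    by (intro real_analytic_on_add nth real_analytic_on_mult real_analytic_on_const)
  then show "real_analytic_on (\<lambda>\<zeta>. point (z_part \<zeta>) (w_part \<zeta> + c * \<rho> (z_part \<zeta>)) $ k) {\<zeta>. z_part \<zeta> \<in> U}"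
    using nth by (cases k) (auto simp: w_part_def)
qed

lemma continuous_on_z_part: "continuous_on UNIV z_part"
  by (rule linear_continuous_on[OF bounded_linear_z_part])

lemma open_z_part: "open U \<Longrightarrow> open {\<zeta>. z_part \<zeta> \<in> U}"
  by (drule open_vimage[OF _ continuous_on_z_part]) (simp add: vimage_def)

lemma z_part_0 [simp]: "z_part 0 = 0" and w_part_0 [simp]: "w_part 0 = 0"
  by (simp_all add: vec_eq_iff w_part_def)

text \<open>One chart serves all points: the shear \<open>w - \<rho>(z)\<close> straightens the
  graph to \<open>w = 0\<close>, and the shear with the opposite sign inverts it.\<close>

lemma graph_near_0I:
  fixes \<rho> :: "complex ^ 'n::finite \<Rightarrow> complex"
  assumes "open U" "0 \<in> U" "real_analytic_on \<rho> U"
  shows "graph_near_0 {\<zeta>. z_part \<zeta> \<in> U \<and> w_part \<zeta> = \<rho> (z_part \<zeta>)} \<rho>"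
proof -
  let ?M = "{\<zeta>. z_part \<zeta> \<in> U \<and> w_part \<zeta> = \<rho> (z_part \<zeta>)}" and ?W = "{\<zeta>. z_part \<zeta> \<in> U}"
  let ?\<phi> = "\<lambda>\<zeta>. point (z_part \<zeta>) (w_part \<zeta> + (-1) * \<rho> (z_part \<zeta>))"
  let ?\<psi> = "\<lambda>\<zeta>. point (z_part \<zeta>) (w_part \<zeta> + 1 * \<rho> (z_part \<zeta>))"
  let ?S = "{\<zeta> :: complex ^ 'n option. w_part \<zeta> = 0}"
  have img: "?\<phi> ` ?W = ?W"
  proof (intro equalityI subsetI)
    fix \<zeta> :: "complex ^ 'n option" assume "\<zeta> \<in> ?W"
    then show "\<zeta> \<in> ?\<phi> ` ?W" by (intro image_eqI[of _ _ "?\<psi> \<zeta>"]) auto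
  qed auto
  have S: "?S = (\<lambda>z. point z 0) ` UNIV"
  proof (intro equalityI subsetI)
    fix \<zeta> :: "complex ^ 'n option" assume "\<zeta> \<in> ?S"
    then have "\<zeta> = point (z_part \<zeta>) 0" using point_parts(3)[of \<zeta>] by simp
    then show "\<zeta> \<in> (\<lambda>z. point z 0) ` UNIV" by blast
  qed auto
  have lin: "linear (\<lambda>z :: complex ^ 'n. point z 0)"
    by (rule linearI) (simp_all add: vec_option_eq_iff)
  have "inj (\<lambda>z :: complex ^ 'n. point z 0)"
    by (rule injI, drule arg_cong[of _ _ z_part]) simp
  then have "dim ?S = dim (UNIV :: (complex ^ 'n) set)"
    unfolding S by (intro dim_image_eq lin) (auto intro: inj_on_subset)
  then have dim: "dim ?S = 2 * CARD('n)" by simp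
  have sub: "subspace ?S"
    unfolding S by (intro linear_subspace_image lin subspace_UNIV)
  have straight: "?\<phi> ` (?M \<inter> ?W) = ?S \<inter> ?\<phi> ` ?W"
    unfolding img
  proof (intro equalityI subsetI)
    fix \<zeta> :: "complex ^ 'n option" assume "\<zeta> \<in> ?S \<inter> ?W"
    then show "\<zeta> \<in> ?\<phi> ` (?M \<inter> ?W)"
      by (intro image_eqI[of _ _ "?\<psi> \<zeta>"]) (auto simp: vec_option_eq_iff w_part_def)
  qed auto
  have analytic: "real_analytic_on ?\<phi> ?W" "real_analytic_on ?\<psi> (?\<phi> ` ?W)"
    unfolding img by (rule real_analytic_shear[OF assms(3)])+
  have "open ?W" by (rule open_z_part[OF assms(1)])
  then have open': "open (?\<phi> ` ?W)" by (simp only: img)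
  have "real_analytic_submanifold (2 * CARD('n)) ?M"
    unfolding real_analytic_submanifold_def
    by (intro ballI, rule exI[of _ ?W], rule exI[of _ ?\<phi>], rule exI[of _ ?\<psi>], rule exI[of _ ?S],
        intro conjI dim sub straight analytic open' \<open>open ?W\<close>) simp_all
  moreover have "0 \<in> ?W" "?M \<inter> ?W = {\<zeta> \<in> ?W. w_part \<zeta> = \<rho> (z_part \<zeta>)}"
    using assms by auto
  ultimately show ?thesis
    unfolding graph_near_0_def using assms \<open>open ?W\<close> by blast
qed

section \<open>Reduction of the quadratic part to a model\<close>

lemma rank_le_1_factorization:
  fixes A B C :: "complex ^ 'n ^ 'n"
  assumes "rank (stack (conj_transpose A) B) \<le> 1" and B: "transpose B = B"
  obtains l m b where
    "\<And>z. quadric A B C z = cnj (pairing l z) * pairing m z + b * cnj (pairing l z) ^ 2 + quadratic_form C z"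
proof -
  let ?R = "stack (conj_transpose A) B"
  have "\<exists>l. rows ?R \<subseteq> vec.span {l}"
  proof (cases "rows ?R \<subseteq> {0}")
    case True
    then show ?thesis using vec.span_zero by blast
  next
    case False
    then obtain l where "l \<in> rows ?R" "l \<noteq> 0" by blast
    then have "rows ?R \<subseteq> vec.span {l}"
      using assms(1) by (intro vec.card_ge_dim_independent) (auto simp: row_rank_def_gen)
    then show ?thesis by blast
  qed
  then obtain l where l: "rows ?R \<subseteq> vec.span {l}" by blast
  have "\<exists>c. row k ?R = c *s l" for k
  proof -
    have "row k ?R \<in> rows ?R" by (auto simp: rows_def)
    with l show ?thesis by (auto simp: vec.span_singleton)
  qed
  then obtain c where "\<And>k. row k ?R = c k *s l" by metis
  then have c: "row k ?R $ j = c k * l $ j" for k j by simp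
  have A_eq: "A $ j $ i = cnj (c (Inl i)) * cnj (l $ j)" for i j
    using arg_cong[OF c[of "Inl i" j], of cnj] by (simp add: row_def stack_def conj_transpose_def)
  have B_eq: "B $ i $ j = c (Inr i) * l $ j" for i j
    using c[of "Inr i" j] by (simp add: row_def stack_def)
  have B_sym: "B $ i $ j = B $ j $ i" for i j
    using arg_cong[OF B, of "\<lambda>X. X $ j $ i"] by (simp add: transpose_def)
  \<comment> \<open>All rows of \<open>B\<close> are multiples of \<open>l\<close>; by symmetry so
    are its columns, which makes \<open>B\<close> a multiple of the outer square of
    \<open>l\<close>.\<close>
  have "\<exists>d. \<forall>i j. B $ i $ j = d * l $ i * l $ j"
  proof (cases "l = 0")
    case True
    then show ?thesis by (simp add: B_eq)
  next
    case False
    then obtain k where k: "l $ k \<noteq> 0" by (auto simp: vec_eq_iff)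
    have "c (Inr i) = c (Inr k) / l $ k * l $ i" for i
      using B_sym[of i k] k by (simp add: B_eq field_simps)
    then show ?thesis by (metis B_eq)
  qed
  then obtain d where d: "\<And>i j. B $ i $ j = d * l $ i * l $ j" by blast
  define m where "m = (\<chi> i. cnj (c (Inl i)))"
  have "sesquilinear_form A z = cnj (pairing l z) * pairing m z" for z
    by (simp only: sesquilinear_form_def pairing_def A_eq m_def cnj_sum complex_cnj_mult sum_product vec_lambda_beta)
       (simp add: mult_ac)
  moreover have "quadratic_form B z = d * pairing l z ^ 2" for z
    by (simp add: quadratic_form_def pairing_def d power2_eq_square sum_product sum_distrib_left mult_ac)
  ultimately show ?thesis
    by (intro that[of l m "cnj d"]) (simp add: quadric_def)
qed

text \<open>Extend \<open>{m, l}\<close> to a basis and use its members as rows, with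
  \<open>l\<close> and \<open>m\<close> in the prescribed places. A vector killed by the matrix
  pairs to 0 with a spanning set and is 0.\<close>

lemma matrix_with_two_rows:
  fixes l m :: "complex ^ 'n"
  assumes "i1 \<noteq> i2" "l \<noteq> 0" "m \<notin> vec.span {l}"
  obtains P :: "complex ^ 'n ^ 'n" where "invertible P"
    "\<And>z. (P *v z) $ i1 = pairing l z" "\<And>z. (P *v z) $ i2 = pairing m z"
proof -
  have ind: "vec.independent {m, l}"
    using assms by (auto simp: vec.independent_insert vec.span_empty)
  have "l \<noteq> m" using assms(3) vec.span_base by blast
  define S where "S = vec.extend_basis {m, l}"
  have S: "{m, l} \<subseteq> S" "vec.independent S" "vec.span S = UNIV"
    unfolding S_def
    by (rule vec.extend_basis_superset[OF ind] vec.independent_extend_basis[OF ind] vec.span_extend_basis[OF ind])+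
  have fin: "finite S" using S(2) by (rule vec.finiteI_independent)
  have "card S = CARD('n)"
    using S by (metis vec.dim_span_eq_card_independent vec_dim_card)
  then have "card (UNIV - {i1, i2}) = card (S - {l, m})"
    using assms(1) S(1) \<open>l \<noteq> m\<close> by (simp add: card_Diff_subset)
  then obtain f where f: "bij_betw f (UNIV - {i1, i2}) (S - {l, m})"
    using finite_same_card_bij fin by (metis finite_Diff finite_class.finite_UNIV)
  define g where "g i = (if i = i1 then l else if i = i2 then m else f i)" for i
  have "S \<subseteq> range g"
  proof
    fix x assume "x \<in> S"
    show "x \<in> range g"
    proof (cases "x \<in> {l, m}")
      case True
      then show ?thesis using assms(1) by (auto simp: g_def intro: range_eqI[of _ _ i1] range_eqI[of _ _ i2])
    next
      case False
      with \<open>x \<in> S\<close> have "x \<in> f ` (UNIV - {i1, i2})"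
        using bij_betw_imp_surj_on[OF f] by simp
      then obtain i where "i \<in> UNIV - {i1, i2}" "x = f i" by blast
      then have "x = g i" by (auto simp: g_def)
      then show ?thesis by blast
    qed
  qed
  define P :: "complex ^ 'n ^ 'n" where "P = (\<chi> i. g i)"
  have P: "(P *v z) $ i = pairing (g i) z" for z i
    by (simp add: P_def matrix_vector_mult_def pairing_def)
  have "z = 0" if "P *v z = 0" for z
  proof -
    have "S \<subseteq> {x. pairing x z = 0}"
      using \<open>S \<subseteq> range g\<close> P[of z] that by auto
    then have "vec.span S \<subseteq> {x. pairing x z = 0}"
      using subspace_hyperplane[of z] by (intro vec.span_minimal) (auto simp: pairing_commute)
    then have "pairing (axis j 1) z = 0" for j using S(3) by blast
    then show ?thesis by (simp add: vec_eq_iff pairing_commute[of _ z] pairing_simps)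
  qed
  then have "invertible P"
    unfolding invertible_left_inverse matrix_left_invertible_ker by blast
  then show ?thesis
    by (rule that) (use assms(1) in \<open>simp_all add: P g_def\<close>)
qed

lemma exists_independent:
  fixes l :: "complex ^ 'n"
  assumes "CARD('n) \<ge> 2"
  obtains m where "m \<notin> vec.span {l}"
proof -
  have "vec.dim (vec.span {l}) \<le> 1" by (simp add: vec.dim_singleton)
  then have "vec.span {l} \<noteq> UNIV"
    using assms by (metis vec_dim_card not_less_eq_eq numeral_2_eq_2 One_nat_def order_trans Suc_1 not_less_eq_eq)
  then show ?thesis using that by blast
qed

text \<open>The forms \<open>l\<close> and \<open>m\<close> become coordinates when independent
  (\<open>Form1\<close>, \<open>Form2\<close>); if \<open>m = c *s l\<close>, only one coordinate is
  involved. The scalar \<open>t\<close> normalises one coefficient. For \<open>c \<noteq> 0\<close>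
  it is spent on the mixed term, and what is left is the phase of \<open>l\<close>, which makes the
  other coefficient nonnegative.\<close>

lemma model_normal_form:
  fixes l m :: "complex ^ 'n" and i1 i2 :: 'n
  assumes n: "CARD('n) \<ge> 2" "i1 \<noteq> i2"
  obtains P :: "complex ^ 'n ^ 'n" and t f where "invertible P" "t \<noteq> 0" "f \<in> models"
    "\<And>z. t * (cnj (pairing l z) * pairing m z + b * cnj (pairing l z) ^ 2) = model_quadric i1 i2 f (P *v z)"
proof (cases "l = 0")
  case True
  show ?thesis
    by (rule that[of "mat 1" 1 Form5]) (simp_all add: True pairing_simps models_def invertible_def)
next
  case l: False
  have span_scale: "c *s m \<notin> vec.span {l}" if "c \<noteq> 0" "m \<notin> vec.span {l}" for c m
    using that vec.span_scale[of "c *s m" "{l}" "inverse c"] by (auto simp: vector_smult_assoc)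
  show ?thesis
  proof (cases "m \<in> vec.span {l}")
    case False
    show ?thesis
    proof (cases "b = 0")
      case True
      obtain P where P: "invertible P" "\<And>z. (P *v z) $ i1 = pairing l z" "\<And>z. (P *v z) $ i2 = pairing m z"
        using matrix_with_two_rows[OF n(2) l False] by blast
      show ?thesis
        by (rule that[of P 1 Form2]) (simp_all add: P True models_def)
    next
      case b: False
      \<comment> \<open>Scaling by \<open>1 / b\<close> makes the coefficient of the conjugate
        square 1; its effect on the mixed term is absorbed in the second coordinate.\<close>
      obtain P where P: "invertible P" "\<And>z. (P *v z) $ i1 = pairing l z" "\<And>z. (P *v z) $ i2 = pairing ((1 / b) *s m) z"
        using matrix_with_two_rows[OF n(2) l span_scale[OF _ False]] b by (metis divide_eq_0_iff zero_neq_one)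
      show ?thesis
        by (rule that[of P "1 / b" Form1]) (use b in \<open>simp_all add: P models_def pairing_simps field_simps\<close>)
    qed
  next
    case True
    then obtain c where m: "m = c *s l" by (auto simp: vec.span_singleton)
    \<comment> \<open>In the dependent case only the first row is prescribed; \<open>m'\<close>
      fills the second.\<close>
    obtain m' where m': "m' \<notin> vec.span {l}" using exists_independent[OF n(1)] .
    have P_ex: "\<exists>P. invertible P \<and> (\<forall>z. (P *v z) $ i1 = u * pairing l z)" if "u \<noteq> 0" for u
    proof -
      have "u *s l \<noteq> 0" "m' \<notin> vec.span {u *s l}"
      proof -
        show "u *s l \<noteq> 0" using l that by simp
        have "vec.span {u *s l} \<subseteq> vec.span {l}"
          by (rule vec.span_minimal) (auto intro: vec.span_scale vec.span_base vec.subspace_span)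
        then show "m' \<notin> vec.span {u *s l}" using m' by blast
      qed
      from matrix_with_two_rows[OF n(2) this] show ?thesis by (metis pairing_simps(6))
    qed
    show ?thesis
    proof (cases "c = 0")
      case c: True
      show ?thesis
      proof (cases "b = 0")
        case True
        show ?thesis
          by (rule that[of "mat 1" 1 Form5]) (simp_all add: True c m pairing_simps models_def invertible_def)
      next
        case False
        obtain P where P: "invertible P" "\<And>z. (P *v z) $ i1 = pairing l z" using P_ex[of 1] by auto
        show ?thesis
          by (rule that[of P "1 / b" Form4]) (use False in \<open>simp_all add: P c m pairing_simps models_def\<close>)
      qed
    next
      case c: False
      \<comment> \<open>The conjugate of \<open>u\<close> is a square root of the phase of
        \<open>b / c\<close>: replacing \<open>l\<close> by \<open>u *s l\<close> keeps the square
        of the modulus and turns the coefficient \<open>b / c\<close> into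
        \<open>cmod (b / c)\<close>.\<close>
      define u where "u = (if b = 0 then 1 else cnj (csqrt (b / c / cmod (b / c))))"
      have "norm (csqrt (b / c / cmod (b / c))) = 1" if "b \<noteq> 0"
      proof -
        have "norm (csqrt (b / c / cmod (b / c)))^2 = norm (b / c / cmod (b / c))"
          by (metis norm_power power2_csqrt)
        also have "\<dots> = 1" using that c by (simp add: norm_divide norm_mult)
        finally show ?thesis by (metis norm_ge_zero one_power2 power2_eq_imp_eq zero_le_one)
      qed
      then have u: "norm u = 1" by (simp add: u_def)
      have bu: "cmod (b / c) * cnj u ^ 2 = b / c"
        using c by (simp add: u_def)
      have uu: "cnj u * u = 1"
        using u complex_norm_square[of u] by (simp add: mult.commute)
      obtain P where P: "invertible P" "\<And>z. (P *v z) $ i1 = u * pairing l z" using P_ex[of u] u by force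
      have "1 / c * (cnj (pairing l z) * pairing m z + b * cnj (pairing l z) ^ 2)
          = model_quadric i1 i2 (Form3 (cmod (b / c))) (P *v z)" for z
      proof -
        have "model_quadric i1 i2 (Form3 (cmod (b / c))) (P *v z)
            = (cnj u * u) * (pairing l z * cnj (pairing l z)) + (cmod (b / c) * cnj u ^ 2) * cnj (pairing l z) ^ 2"
          by (simp add: P complex_norm_square[unfolded of_real_power] power_mult_distrib mult_ac)
        then show ?thesis
          unfolding bu uu using c by (simp add: m pairing_simps field_simps)
      qed
      then show ?thesis
        by (intro that[of P "1 / c" "Form3 (cmod (b / c))"]) (use P c in \<open>auto simp: models_def\<close>)
    qed
  qed
qed

section \<open>Realising the normalisation by a biholomorphism\<close>

lemma real_analytic_on_nth: "real_analytic_on (\<lambda>z :: complex ^ 'k. z $ j) U"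
  by (intro real_analytic_on_linear bounded_linear.linear bounded_linear_vec_nth)

lemma real_analytic_on_cnj_nth: "real_analytic_on (\<lambda>z :: complex ^ 'k. cnj (z $ j)) U"
  by (rule real_analytic_on_bounded_linear[OF bounded_linear_cnj real_analytic_on_nth])

lemma real_analytic_on_quadratic_form:
  fixes C :: "complex ^ 'n ^ 'n"
  shows "real_analytic_on (quadratic_form C) U"
  unfolding quadratic_form_def[abs_def]
  by (intro real_analytic_on_sum real_analytic_on_mult real_analytic_on_nth real_analytic_on_const) simp_all

lemma has_derivative_quadratic_form:
  fixes C :: "complex ^ 'n ^ 'n"
  shows "(quadratic_form C has_derivative (\<lambda>h. pairing (C *v z + transpose C *v z) h)) (at z)"
proof -
  have bl: "bounded_linear ((*v) C)"
    using linear_matrix_vector_complex linear_conv_bounded_linear by blast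
  have "bounded_bilinear (pairing :: complex ^ 'n \<Rightarrow> _)"
  proof
    have "norm (pairing a u) \<le> norm a * norm u * CARD('n)" for a u :: "complex ^ 'n"
      using norm_pairing_le[of a u] by (simp add: mult_ac)
    then show "\<exists>K. \<forall>a u :: complex ^ 'n. norm (pairing a u) \<le> norm a * norm u * K" by blast
  qed (simp_all add: pairing_simps)
  from bounded_bilinear.FDERIV[OF this bounded_linear.has_derivative[OF bl has_derivative_ident] has_derivative_ident]
  have "((\<lambda>z. pairing (C *v z) z) has_derivative (\<lambda>h. pairing (C *v z) h + pairing (C *v h) z)) (at z)" .
  then show ?thesis
    by (simp add: quadratic_form_pairing[abs_def] pairing_simps pairing_transpose[of C _ z])
qed

text \<open>The polynomial automorphism \<open>(z, w) \<mapsto> (P z, t w + q(z))\<close> realises every change of the quadratic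
  part used for the normal forms.\<close>

lemma holomorphic_map_on_shear:
  fixes P :: "complex ^ 'n ^ 'n"
  shows "holomorphic_map_on (\<lambda>\<zeta>. point (P *v z_part \<zeta>) (t * (w_part \<zeta> + quadratic_form C (z_part \<zeta>)))) U"
  unfolding holomorphic_map_on_def
proof (intro ballI exI conjI allI)
  fix \<zeta> :: "complex ^ 'n option"
  let ?g = "C *v z_part \<zeta> + transpose C *v z_part \<zeta>"
  let ?D = "\<lambda>h. point (P *v z_part h) (t * (w_part h + pairing ?g (z_part h)))"
  have dz: "(z_part has_derivative z_part) (at \<zeta>)" and dw: "(w_part has_derivative w_part) (at \<zeta>)"
    by (intro bounded_linear_imp_has_derivative bounded_linear_z_part bounded_linear_w_part)+
  have bl: "bounded_linear ((*v) P)"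
    using linear_matrix_vector_complex linear_conv_bounded_linear by blast
  show "((\<lambda>\<zeta>. point (P *v z_part \<zeta>) (t * (w_part \<zeta> + quadratic_form C (z_part \<zeta>)))) has_derivative ?D) (at \<zeta>)"
    by (intro has_derivative_point bounded_linear.has_derivative[OF bl dz] has_derivative_mult_right
        has_derivative_add dw has_derivative_compose[OF dz has_derivative_quadratic_form])
  have "z_part (c *s v) = c *s z_part v" "w_part (c *s v) = c * w_part v" for c and v :: "complex ^ 'n option"
    by (simp_all add: vec_eq_iff w_part_def)
  then show "?D (c *s v) = c *s ?D v" for c v
    by (simp add: vec_option_eq_iff pairing_simps vector_scalar_commute algebra_simps)
qed

text \<open>Shows that the inverse of a shear is again of the form of a shear, so that holomorphy
  has to be proved only once.\<close>

lemma quadratic_form_pullback: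
  fixes C R :: "complex ^ 'n ^ 'n"
  obtains C' where "\<And>z. quadratic_form C' z = s * quadratic_form C (R *v z)"
proof
  let ?D = "transpose R ** C ** R"
  have "quadratic_form C (R *v z) = quadratic_form ?D z" for z
    by (simp add: quadratic_form_pairing matrix_vector_mul_assoc[symmetric]
        pairing_transpose[of "transpose R"] pairing_commute[of z] pairing_commute[of "R *v z"]
        del: transpose_matrix_vector)
  then show "quadratic_form (\<chi> i j. s * ?D $ i $ j) z = s * quadratic_form C (R *v z)" for z
    by (simp add: quadratic_form_def sum_distrib_left mult_ac)
qed

text \<open>The map is a polynomial automorphism of the whole space. \<open>M'\<close> is taken as
  the graph of the transported function \<open>\<rho>'\<close>, whose error term
  \<open>t * E (R *v z)\<close> stays cubic because \<open>R\<close> is linear.\<close>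

lemma equivalent_to_model:
  fixes M :: "(complex ^ 'n::finite option) set" and P :: "complex ^ 'n ^ 'n"
  assumes graph: "graph_near_0 M \<rho>" and ev: "\<forall>\<^sub>F z in nhds 0. \<rho> z = Q z + E z" and E: "O3 E"
    and P: "invertible P" and t: "t \<noteq> 0"
    and normal: "\<And>z. t * (Q z + quadratic_form C z) = model_quadric i1 i2 f (P *v z)"
  shows "\<exists>M'. has_form i1 i2 f M' \<and> biholomorphic_near_0 M M'"
proof -
  obtain R where R: "P ** R = mat 1" "R ** P = mat 1" using P unfolding invertible_def by blast
  have PR [simp]: "P *v (R *v z) = z" and RP [simp]: "R *v (P *v z) = z" for z
    using R by (simp_all add: matrix_vector_mul_assoc)
  obtain U0 W0 where U0: "open U0" "0 \<in> U0" "real_analytic_on \<rho> U0"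
    and W0: "open W0" "0 \<in> W0" "M \<inter> W0 = {\<zeta> \<in> W0. w_part \<zeta> = \<rho> (z_part \<zeta>)}"
    using graph unfolding graph_near_0_def by blast
  define U where "U = {z. R *v z \<in> U0}"
  have R_cont: "continuous_on UNIV ((*v) R)" for R :: "complex ^ 'n ^ 'n"
    by (rule linear_continuous_on) (use linear_matrix_vector_complex linear_conv_bounded_linear in blast)
  have U: "open U" "0 \<in> U"
    using open_vimage[OF U0(1) R_cont[of R]] U0(2) by (simp_all add: U_def vimage_def)
  define \<rho>' where "\<rho>' z = t * (\<rho> (R *v z) + quadratic_form C (R *v z))" for z
  have "real_analytic_on \<rho>' U"
    unfolding \<rho>'_def
    by (intro real_analytic_on_mult real_analytic_on_const real_analytic_on_add
        real_analytic_on_compose_linear[OF U0(3) linear_matrix_vector_complex]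
        real_analytic_on_compose_linear[OF real_analytic_on_quadratic_form[of _ UNIV] linear_matrix_vector_complex])
       (auto simp: U_def)
  note graph' = graph_near_0I[OF U this]
  let ?M' = "{\<zeta>. z_part \<zeta> \<in> U \<and> w_part \<zeta> = \<rho>' (z_part \<zeta>)}"
  have "O3 (\<lambda>z. \<rho>' z - model_quadric i1 i2 f z)"
  proof -
    obtain K where K: "0 < K" "\<And>z. norm (R *v z) \<le> K * norm z"
      using linear_bounded_pos[OF linear_matrix_vector_complex] by blast
    obtain r c where r: "0 < r" "0 \<le> c" "\<And>z. norm z < r \<Longrightarrow> norm (E z) \<le> c * norm z ^ 3"
      using O3_E[OF E] by metis
    obtain r' where r': "0 < r'" "\<And>z. norm z < r' \<Longrightarrow> \<rho> z = Q z + E z"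
      using ev unfolding eventually_nhds_metric by auto
    show ?thesis
    proof (rule O3_I)
      \<comment> \<open>Within this radius \<open>R *v z\<close> lies where both the cubic bound and
        the expansion of \<open>\<rho>\<close> are available.\<close>
      show "0 < min r r' / K" using r(1) r'(1) K(1) by simp
      fix z :: "complex ^ 'n" assume "norm z < min r r' / K"
      then have "K * norm z < min r r'" using K(1) by (simp add: field_simps)
      then have Rz: "norm (R *v z) < min r r'" using K(2)[of z] by linarith
      have "\<rho>' z - model_quadric i1 i2 f z = t * E (R *v z)"
        using r'(2)[of "R *v z"] Rz normal[of "R *v z"] by (simp add: \<rho>'_def algebra_simps)
      moreover have "norm (E (R *v z)) \<le> c * (K * norm z) ^ 3"
        using r(3)[of "R *v z"] Rz K(2)[of z] r(2)
        by (smt (verit) mult_left_mono power_mono norm_ge_zero min_less_iff_conj)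
      ultimately show "norm (\<rho>' z - model_quadric i1 i2 f z) \<le> (norm t * c * K ^ 3) * norm z ^ 3"
        by (simp add: norm_mult power_mult_distrib mult_left_mono mult.assoc)
    qed
  qed
  with graph' have form: "has_form i1 i2 f ?M'" unfolding has_form_def by blast
  let ?F = "\<lambda>\<zeta>. point (P *v z_part \<zeta>) (t * (w_part \<zeta> + quadratic_form C (z_part \<zeta>)))"
  let ?G = "\<lambda>\<zeta>. point (R *v z_part \<zeta>) ((1 / t) * w_part \<zeta> - quadratic_form C (R *v z_part \<zeta>))"
  have hol_F: "holomorphic_map_on ?F V" for V by (rule holomorphic_map_on_shear)
  have hol_G: "holomorphic_map_on ?G V" for V
  proof -
    obtain C' where "\<And>z. quadratic_form C' z = - t * quadratic_form C (R *v z)"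
      using quadratic_form_pullback by blast
    then have "?G = (\<lambda>\<zeta>. point (R *v z_part \<zeta>) ((1 / t) * (w_part \<zeta> + quadratic_form C' (z_part \<zeta>))))"
      using t by (simp add: fun_eq_iff field_simps)
    then show ?thesis by (simp only: holomorphic_map_on_shear)
  qed
  have GF: "?G (?F \<zeta>) = \<zeta>" and FG: "?F (?G \<zeta>) = \<zeta>" for \<zeta>
    using t by (simp_all add: vec_option_eq_iff w_part_def)
  define U1 where "U1 = W0 \<inter> {\<zeta>. z_part \<zeta> \<in> U0}"
  have U1: "open U1" "0 \<in> U1"
    unfolding U1_def using W0 U0 open_z_part by auto
  \<comment> \<open>Writing the image as a preimage under the inverse reduces its openness to the
    continuity of \<open>?G\<close>.\<close>
  have F_img: "?F ` U1 = ?G -` U1"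
  proof (intro equalityI subsetI)
    fix \<xi> assume "\<xi> \<in> ?G -` U1"
    then have "?G \<xi> \<in> U1" by simp
    then show "\<xi> \<in> ?F ` U1" by (rule image_eqI[of \<xi> ?F, OF FG[symmetric]])
  next
    fix \<xi> assume "\<xi> \<in> ?F ` U1"
    then obtain \<zeta> where "\<zeta> \<in> U1" "\<xi> = ?F \<zeta>" by blast
    then show "\<xi> \<in> ?G -` U1" using GF[of \<zeta>] by simp
  qed
  have "continuous_on UNIV ?G"
  proof (rule differentiable_imp_continuous_on)
    show "?G differentiable_on UNIV"
      using hol_G[of UNIV] unfolding holomorphic_map_on_def differentiable_on_def differentiable_def by blast
  qed
  then have open_F: "open (?F ` U1)" unfolding F_img by (rule open_vimage[OF U1(1)])
  have F0: "?F 0 = 0"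
    by (simp add: vec_option_eq_iff quadratic_form_pairing pairing_simps)
  have zero_F: "0 \<in> ?F ` U1"
    by (rule image_eqI[of _ ?F, OF F0[symmetric] U1(2)])
  have graph_F: "?F ` (M \<inter> U1) = ?M' \<inter> ?F ` U1"
  proof -
    have "\<zeta> \<in> M \<longleftrightarrow> ?F \<zeta> \<in> ?M'" if "\<zeta> \<in> U1" for \<zeta>
    proof -
      have "\<zeta> \<in> M \<longleftrightarrow> w_part \<zeta> = \<rho> (z_part \<zeta>)" using W0(3) that unfolding U1_def by blast
      then show ?thesis using that t by (simp add: U_def U1_def \<rho>'_def)
    qed
    then show ?thesis by blast
  qed
  have "biholomorphic_near_0 M ?M'"
    unfolding biholomorphic_near_0_def
    by (rule exI[of _ U1], rule exI[of _ "?F ` U1"], rule exI[of _ ?F], rule exI[of _ ?G],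
        intro conjI ballI refl U1 open_F zero_F hol_F hol_G GF F0 graph_F)
  with form show ?thesis by blast
qed

section \<open>Invariance of the quadratic part\<close>

text \<open>Just what limits along real rays require; it covers the mixed and the antiholomorphic
  terms, which are not complex homogeneous.\<close>

definition real_quadratic :: "('a::real_normed_vector \<Rightarrow> 'b::real_normed_vector) \<Rightarrow> bool" where
  "real_quadratic Q \<longleftrightarrow> continuous_on UNIV Q \<and> (\<forall>s z. Q (s *\<^sub>R z) = s\<^sup>2 *\<^sub>R Q z)"

lemma tendsto_0_of_ray:
  fixes y :: "real \<Rightarrow> 'a::real_normed_vector"
  assumes "((\<lambda>s. y s /\<^sub>R s) \<longlongrightarrow> l) (at_right 0)"
  shows "(y \<longlongrightarrow> 0) (at_right 0)"
proof -
  have "((\<lambda>s. s *\<^sub>R (y s /\<^sub>R s)) \<longlongrightarrow> 0 *\<^sub>R l) (at_right 0)"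
    by (intro tendsto_scaleR assms tendsto_ident_at)
  then show ?thesis
    unfolding scaleR_zero_left by (rule Lim_transform_eventually) (auto simp: eventually_at_filter)
qed

text \<open>By homogeneity \<open>Q (y s) /\<^sub>R s\<^sup>2\<close> is
  \<open>Q (y s /\<^sub>R s)\<close>, and the cubic error contributes O(s). Curves with a tangent at
  0 are allowed, not only rays, since images of rays under a biholomorphism are curved.\<close>

lemma quadratic_part_limit:
  fixes \<rho> :: "complex ^ 'n \<Rightarrow> complex"
  assumes Q: "real_quadratic Q" and O3: "O3 (\<lambda>z. \<rho> z - Q z)"
    and y: "((\<lambda>s. y s /\<^sub>R s) \<longlongrightarrow> y') (at_right 0)"
  shows "((\<lambda>s. \<rho> (y s) /\<^sub>R s\<^sup>2) \<longlongrightarrow> Q y') (at_right 0)"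
proof (rule Lim_transform)
  obtain r c where r: "0 < r" "0 \<le> c" "\<And>z. norm z < r \<Longrightarrow> norm (\<rho> z - Q z) \<le> c * norm z ^ 3"
    using O3_E[OF O3] by metis
  show "((\<lambda>s. Q (y s /\<^sub>R s)) \<longlongrightarrow> Q y') (at_right 0)"
    using Q y unfolding real_quadratic_def
    by (intro isCont_tendsto_compose[OF _ y]) (simp add: continuous_on_eq_continuous_at)
  have "\<forall>\<^sub>F s in at_right 0. norm (y s) < r"
    using tendstoD[OF tendsto_0_of_ray[OF y] r(1)] by (simp add: dist_norm)
  then have "\<forall>\<^sub>F s in at_right 0. norm (\<rho> (y s) /\<^sub>R s\<^sup>2 - Q (y s /\<^sub>R s)) \<le> c * (s * norm (y s /\<^sub>R s) ^ 3)"
    using eventually_at_right_less[of 0]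
  proof eventually_elim
    case (elim s)
    have "Q (y s /\<^sub>R s) = Q (y s) /\<^sub>R s\<^sup>2"
      using Q by (simp add: real_quadratic_def power_inverse)
    then have "norm (\<rho> (y s) /\<^sub>R s\<^sup>2 - Q (y s /\<^sub>R s)) = norm (\<rho> (y s) - Q (y s)) / s\<^sup>2"
      by (simp add: scaleR_diff_right[symmetric] divide_inverse_commute)
    also have "\<dots> \<le> c * norm (y s) ^ 3 / s\<^sup>2"
      using r(3)[OF elim(1)] by (intro divide_right_mono) auto
    also have "\<dots> = c * (s * norm (y s /\<^sub>R s) ^ 3)"
      using elim by (simp add: field_simps power2_eq_square power3_eq_cube)
    finally show ?case .
  qed
  moreover have "((\<lambda>s. c * (s * norm (y s /\<^sub>R s) ^ 3)) \<longlongrightarrow> c * (0 * norm y' ^ 3)) (at_right 0)"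
    by (intro tendsto_intros y)
  then have "((\<lambda>s. c * (s * norm (y s /\<^sub>R s) ^ 3)) \<longlongrightarrow> 0) (at_right 0)" by simp
  ultimately show "((\<lambda>s. \<rho> (y s) /\<^sub>R s\<^sup>2 - Q (y s /\<^sub>R s)) \<longlongrightarrow> 0) (at_right 0)"
    by (rule Lim_null_comparison)
qed

text \<open>The chain rule at the endpoint of a curve that has a one-sided tangent there.\<close>

lemma has_derivative_ray_limit:
  fixes F :: "'a::real_normed_vector \<Rightarrow> 'b::real_normed_vector"
  assumes D: "(F has_derivative D) (at 0)" and "F 0 = 0"
    and x: "((\<lambda>s. x s /\<^sub>R s) \<longlongrightarrow> y) (at_right 0)"
  shows "((\<lambda>s. F (x s) /\<^sub>R s) \<longlongrightarrow> D y) (at_right 0)"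
proof (rule Lim_transform)
  have bl: "bounded_linear D" using D by (rule has_derivative_bounded_linear)
  show "((\<lambda>s. D (x s /\<^sub>R s)) \<longlongrightarrow> D y) (at_right 0)"
    by (rule bounded_linear.tendsto[OF bl x])
  have x0: "(x \<longlongrightarrow> 0) (at_right 0)" by (rule tendsto_0_of_ray[OF x])
  \<comment> \<open>At \<open>h = 0\<close> the quotient is 0 by the convention for division by
    zero, hence continuous; parameters with \<open>x s = 0\<close> then do no harm.\<close>
  have "isCont (\<lambda>h. norm (F h - D h) / norm h) 0"
    using D \<open>F 0 = 0\<close> linear_0[OF has_derivative_linear[OF D]]
    by (simp add: has_derivative_at isCont_def)
  from isCont_tendsto_compose[OF this x0]
  have "((\<lambda>s. norm (F (x s) - D (x s)) / norm (x s) * norm (x s /\<^sub>R s)) \<longlongrightarrow> 0 * norm y) (at_right 0)"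
    by (intro tendsto_mult tendsto_norm x) simp
  then have lim: "((\<lambda>s. norm (F (x s) - D (x s)) / norm (x s) * norm (x s /\<^sub>R s)) \<longlongrightarrow> 0) (at_right 0)"
    by simp
  have "\<forall>\<^sub>F s in at_right 0. norm (F (x s) /\<^sub>R s - D (x s /\<^sub>R s))
      \<le> norm (F (x s) - D (x s)) / norm (x s) * norm (x s /\<^sub>R s)"
    using eventually_at_right_less[of 0]
  proof eventually_elim
    case (elim s)
    have "F (x s) /\<^sub>R s - D (x s /\<^sub>R s) = (F (x s) - D (x s)) /\<^sub>R s"
      using linear_scale[OF has_derivative_linear[OF D]] by (simp add: scaleR_diff_right)
    then show ?case
      using elim \<open>F 0 = 0\<close> linear_0[OF has_derivative_linear[OF D]]
      by (cases "x s = 0") (auto simp: divide_simps)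
  qed
  then show "((\<lambda>s. F (x s) /\<^sub>R s - D (x s /\<^sub>R s)) \<longlongrightarrow> 0) (at_right 0)"
    by (rule Lim_null_comparison[OF _ lim])
qed

section \<open>Holomorphic functions on complex lines\<close>

lemma Schwarz_rescaled:
  assumes "f holomorphic_on ball 0 R" "f 0 = 0" "\<And>\<sigma>. norm \<sigma> < R \<Longrightarrow> norm (f \<sigma>) < B" "norm \<sigma> < R"
  shows "norm (f \<sigma>) \<le> B / R * norm \<sigma>"
proof -
  have R: "0 < R" using assms(4) norm_ge_zero[of \<sigma>] by linarith
  have B: "0 < B" using assms(3)[of 0] R assms(2) by simp
  define h where "h \<xi> = f (of_real R * \<xi>) / of_real B" for \<xi>
  have hol: "h holomorphic_on ball 0 1"
    unfolding h_def
    by (intro holomorphic_intros holomorphic_on_compose_gen[of _ _ f, unfolded o_def, OF _ assms(1)])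
       (use R B in \<open>auto simp: norm_mult\<close>)
  have bound: "norm (h \<xi>) < 1" if "norm \<xi> < 1" for \<xi>
    using assms(3)[of "of_real R * \<xi>"] R B that by (simp add: h_def norm_mult norm_divide)
  have "h 0 = 0" by (simp add: h_def assms(2))
  then have "norm (h (\<sigma> / of_real R)) \<le> norm (\<sigma> / of_real R)"
    using assms(4) R by (intro Schwarz_Lemma(1)[OF hol _ bound]) (simp_all add: norm_divide)
  then show ?thesis
    using R B by (simp add: h_def norm_divide field_simps)
qed

text \<open>The difference quotient of \<open>g\<close> at 0 extends holomorphically over 0 with
  value 0, and its derivative there is the limit sought.\<close>

lemma double_zero_limit:
  fixes g :: "complex \<Rightarrow> complex"
  assumes "g holomorphic_on ball 0 r" "0 < r" "g 0 = 0" "(g has_field_derivative 0) (at 0)"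
  obtains c where "((\<lambda>t. g t / t\<^sup>2) \<longlongrightarrow> c) (at 0)"
proof -
  define k where "k t = (if t = 0 then deriv g 0 else (g t - g 0) / (t - 0))" for t
  have "k holomorphic_on ball 0 r"
    unfolding k_def[abs_def] using assms(1) by (rule pole_lemma_open) simp
  then have "k field_differentiable (at 0)"
    using assms(2) by (intro holomorphic_on_imp_differentiable_at) auto
  then obtain c where "(k has_field_derivative c) (at 0)"
    unfolding field_differentiable_def by blast
  then have lim: "((\<lambda>t. (k t - k 0) / (t - 0)) \<longlongrightarrow> c) (at 0)"
    by (simp add: has_field_derivative_iff)
  have "k 0 = 0" using assms(4) by (simp add: k_def DERIV_imp_deriv)
  then have "((\<lambda>t. g t / t\<^sup>2) \<longlongrightarrow> c) (at 0)"
    by (intro Lim_transform_eventually[OF lim])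
       (auto simp: eventually_at_filter k_def assms(3) power2_eq_square)
  then show ?thesis by (rule that)
qed

lemma holomorphic_on_complex_line:
  fixes F :: "complex ^ ('n::finite) option \<Rightarrow> complex ^ 'n option"
  assumes "holomorphic_map_on F U" "\<And>t. t \<in> T \<Longrightarrow> a + t *s b \<in> U"
  shows "(\<lambda>t. w_part (F (a + t *s b))) holomorphic_on T"
  unfolding holomorphic_on_def
proof
  fix t assume "t \<in> T"
  then obtain D where D: "(F has_derivative D) (at (a + t *s b))" and lin: "\<And>c v. D (c *s v) = c *s D v"
    using assms unfolding holomorphic_map_on_def by blast
  have "bounded_linear (\<lambda>h. h *s b)"
    by (simp add: linear_conv_bounded_linear[symmetric] linear_iff vec_eq_iff algebra_simps)
  then have "((\<lambda>t. a + t *s b) has_derivative (\<lambda>h. h *s b)) (at t)"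
    by (auto intro!: derivative_eq_intros bounded_linear_imp_has_derivative)
  from has_derivative_compose[OF this D]
  have "((\<lambda>t. w_part (F (a + t *s b))) has_derivative (\<lambda>h. w_part (D (h *s b)))) (at t)"
    by (rule bounded_linear.has_derivative[OF bounded_linear_w_part])
  moreover have "(\<lambda>h. w_part (D (h *s b))) = (*) (w_part (D b))"
    by (simp add: lin fun_eq_iff w_part_def)
  ultimately have "((\<lambda>t. w_part (F (a + t *s b))) has_field_derivative w_part (D b)) (at t)"
    by (simp add: has_field_derivative_def)
  then show "(\<lambda>t. w_part (F (a + t *s b))) field_differentiable at t within T"
    unfolding field_differentiable_def by (blast intro: has_field_derivative_at_within)
qed

lemma norm_point_le: "norm (point z w) \<le> norm z + norm w"
proof -
  have "norm (point z w) ^ 2 = norm w ^ 2 + norm z ^ 2"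
    by (simp add: norm_vec_def L2_set_def UNIV_option_conv sum.reindex sum_nonneg)
  also have "\<dots> \<le> (norm z + norm w) ^ 2"
    by (simp add: power2_sum)
  finally show ?thesis
    by (rule power2_le_imp_le) simp
qed

text \<open>The derivative of \<open>F\<close> at 0 preserves the tangent space
  \<open>w = 0\<close>; \<open>P\<close> and \<open>t\<close> are its diagonal blocks. On the graph
  the last component of \<open>F\<close> is its value at \<open>w = 0\<close>, plus
  \<open>t * w\<close>, plus o(s^2). The value at \<open>w = 0\<close> is holomorphic in z with a
  double zero, which is recorded line by line as \<open>c * u\<^sup>2\<close>.\<close>

lemma biholomorphic_quadratic_parts:
  fixes M M' :: "(complex ^ ('n::finite) option) set"
  assumes M: "open W" "0 \<in> W" "M \<inter> W = {\<zeta> \<in> W. w_part \<zeta> = \<rho> (z_part \<zeta>)}"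
    and M': "open W'" "0 \<in> W'" "M' \<inter> W' = {\<zeta> \<in> W'. w_part \<zeta> = \<rho>' (z_part \<zeta>)}"
    and Q: "real_quadratic Q" "O3 (\<lambda>z. \<rho> z - Q z)"
    and Q': "real_quadratic Q'" "O3 (\<lambda>z. \<rho>' z - Q' z)"
    and biholo: "biholomorphic_near_0 M M'"
  obtains P :: "complex ^ 'n \<Rightarrow> complex ^ 'n" and t where
    "linear P" "bij P" "\<And>c z. P (c *s z) = c *s P z" "t \<noteq> 0"
    "\<And>z. \<exists>c. \<forall>u. norm u = 1 \<longrightarrow> Q' (P (u *s z)) = t * Q (u *s z) + c * u\<^sup>2"
proof -
  obtain U U' F G where U: "open U" "open U'" "0 \<in> U" "0 \<in> U'"
    and F: "holomorphic_map_on F U" and G: "holomorphic_map_on G U'" and FU: "F ` U = U'"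
    and GF: "\<And>x. x \<in> U \<Longrightarrow> G (F x) = x" and F0: "F 0 = 0" and FM: "F ` (M \<inter> U) = M' \<inter> U'"
    using biholo unfolding biholomorphic_near_0_def by metis
  obtain D where D: "(F has_derivative D) (at 0)" and D_lin: "\<And>c v. D (c *s v) = c *s D v"
    using F U(3) unfolding holomorphic_map_on_def by blast
  obtain D' where D': "(G has_derivative D') (at 0)"
    using G U(4) unfolding holomorphic_map_on_def by blast
  have linD: "linear D" by (rule has_derivative_linear[OF D])
  have "((\<lambda>x. G (F x)) has_derivative (\<lambda>h. D' (D h))) (at 0)"
    using has_derivative_compose[OF D, of G D'] D' F0 by simp
  moreover have "((\<lambda>x. G (F x)) has_derivative (\<lambda>h. h)) (at 0)"
    by (rule has_derivative_transform_within_open[OF has_derivative_ident U(1,3)]) (simp add: GF)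
  ultimately have D'D: "D' (D h) = h" for h
    using has_derivative_unique by metis
  then have inj_D: "inj D" by (metis injI)
  have surj_D: "surj D" by (rule linear_injective_imp_surjective[OF linD inj_D refl])
  define P where "P z = z_part (D (point z 0))" for z
  define t where "t = w_part (D (point 0 1))"
  \<comment> \<open>The point of the graph over \<open>s v\<close> has w-coordinate O(s^2), so its
    curve is tangent to \<open>point v 0\<close>.\<close>
  have ray: "(((\<lambda>s. point (s *\<^sub>R v) (\<rho> (s *\<^sub>R v)) /\<^sub>R s)) \<longlongrightarrow> point v 0) (at_right 0)" for v
  proof -
    have "((\<lambda>s. (s *\<^sub>R v) /\<^sub>R s) \<longlongrightarrow> v) (at_right 0)"
      by (rule tendsto_eventually) (auto simp: eventually_at_filter)
    from quadratic_part_limit[OF Q this]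
    have "((\<lambda>s. s *\<^sub>R (\<rho> (s *\<^sub>R v) /\<^sub>R s\<^sup>2)) \<longlongrightarrow> 0 *\<^sub>R Q v) (at_right 0)"
      by (intro tendsto_scaleR tendsto_ident_at)
    then have "((\<lambda>s. \<rho> (s *\<^sub>R v) /\<^sub>R s) \<longlongrightarrow> 0) (at_right 0)"
      unfolding scaleR_zero_left
      by (rule Lim_transform_eventually) (auto simp: eventually_at_filter power2_eq_square)
    then have "((\<lambda>s. point v (\<rho> (s *\<^sub>R v) /\<^sub>R s)) \<longlongrightarrow> point v 0) (at_right 0)"
      using bounded_linear.tendsto[OF bounded_linear_point tendsto_Pair[OF tendsto_const]] by fastforce
    then show ?thesis
      by (rule Lim_transform_eventually)
         (auto simp: eventually_at_filter point_simps(2)[symmetric] simp del: point_simps)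
  qed
  define x where "x v s = point (s *\<^sub>R v) (\<rho> (s *\<^sub>R v))" for v and s :: real
  have Fx: "((\<lambda>s. F (x v s) /\<^sub>R s) \<longlongrightarrow> D (point v 0)) (at_right 0)" for v
    unfolding x_def by (rule has_derivative_ray_limit[OF D F0 ray])
  have on_graph: "\<forall>\<^sub>F s in at_right 0. w_part (F (x v s)) = \<rho>' (z_part (F (x v s)))" for v
  proof -
    have "(x v \<longlongrightarrow> 0) (at_right 0)"
      unfolding x_def by (rule tendsto_0_of_ray[OF ray])
    then have "\<forall>\<^sub>F s in at_right 0. x v s \<in> W \<inter> U"
      using M U by (intro topological_tendstoD) auto
    moreover have "\<forall>\<^sub>F s in at_right 0. F (x v s) \<in> W'"
      using tendsto_0_of_ray[OF Fx] M' by (intro topological_tendstoD) auto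
    moreover have "w_part (F (x v s)) = \<rho>' (z_part (F (x v s)))" if "x v s \<in> W \<inter> U" "F (x v s) \<in> W'" for s
    proof -
      have "x v s \<in> {\<zeta> \<in> W. w_part \<zeta> = \<rho> (z_part \<zeta>)}"
        using that(1) unfolding x_def by simp
      then have "x v s \<in> M \<inter> U" unfolding M(3)[symmetric] using that(1) by blast
      then have "F (x v s) \<in> M'" using FM by blast
      then have "F (x v s) \<in> {\<zeta> \<in> W'. w_part \<zeta> = \<rho>' (z_part \<zeta>)}"
        unfolding M'(3)[symmetric] using that(2) by blast
      then show ?thesis by blast
    qed
    ultimately show ?thesis by (rule eventually_elim2)
  qed
  have Fz: "((\<lambda>s. z_part (F (x v s)) /\<^sub>R s) \<longlongrightarrow> P v) (at_right 0)" for v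
    using bounded_linear.tendsto[OF bounded_linear_z_part Fx[of v]]
    by (simp add: P_def linear_scale[OF bounded_linear.linear[OF bounded_linear_z_part]])
  have Fw: "((\<lambda>s. w_part (F (x v s)) /\<^sub>R s\<^sup>2) \<longlongrightarrow> Q' (P v)) (at_right 0)" for v
    using quadratic_part_limit[OF Q' Fz]
    by (rule Lim_transform_eventually) (use on_graph[of v] in \<open>auto elim: eventually_mono\<close>)
  \<comment> \<open>The image curve lies on the second graph, so its w-coordinate is O(s^2) too and
    the tangent space \<open>w = 0\<close> is preserved.\<close>
  have Dw: "w_part (D (point v 0)) = 0" for v
  proof -
    have "((\<lambda>s. s *\<^sub>R (w_part (F (x v s)) /\<^sub>R s\<^sup>2)) \<longlongrightarrow> 0 *\<^sub>R Q' (P v)) (at_right 0)"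
      by (intro tendsto_scaleR Fw tendsto_ident_at)
    then have "((\<lambda>s. w_part (F (x v s)) /\<^sub>R s) \<longlongrightarrow> 0) (at_right 0)"
      unfolding scaleR_zero_left
      by (rule Lim_transform_eventually) (auto simp: eventually_at_filter power2_eq_square)
    moreover have "((\<lambda>s. w_part (F (x v s)) /\<^sub>R s) \<longlongrightarrow> w_part (D (point v 0))) (at_right 0)"
      using bounded_linear.tendsto[OF bounded_linear_w_part Fx[of v]]
      by (simp add: linear_scale[OF bounded_linear.linear[OF bounded_linear_w_part]])
    ultimately show ?thesis using tendsto_unique trivial_limit_at_right_real by blast
  qed
  have wD: "w_part (D (point v \<sigma>)) = t * \<sigma>" for v \<sigma>
  proof -
    have "point v \<sigma> = point v 0 + \<sigma> *s point 0 1" by (simp add: vec_option_eq_iff)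
    then have "D (point v \<sigma>) = D (point v 0) + \<sigma> *s D (point 0 1)"
      by (simp add: linear_add[OF linD] D_lin)
    then have "w_part (D (point v \<sigma>)) = w_part (D (point v 0)) + \<sigma> * w_part (D (point 0 1))"
      by (simp add: w_part_def)
    then show ?thesis by (simp add: Dw t_def)
  qed
  have P_lin: "P (c *s z) = c *s P z" for c z
  proof -
    have "point (c *s z) 0 = c *s point z 0" by (simp add: vec_option_eq_iff)
    then show ?thesis unfolding P_def by (simp only: D_lin) (simp add: vec_eq_iff)
  qed
  have P_linear: "linear P"
  proof (rule linearI)
    show "P (z + z') = P z + P z'" for z z'
    proof -
      have "point (z + z') 0 = point z 0 + point z' 0" using point_simps(1)[of z z' 0 0] by simp
      then show ?thesis unfolding P_def by (simp only: linear_add[OF linD]) (simp add: vec_eq_iff)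
    qed
    show "P (r *\<^sub>R z) = r *\<^sub>R P z" for r z
    proof -
      have "point (r *\<^sub>R z) 0 = r *\<^sub>R point z 0" using point_simps(2)[of r z 0] by simp
      then show ?thesis unfolding P_def by (simp only: linear_scale[OF linD]) (simp add: vec_eq_iff)
    qed
  qed
  have "inj P"
  proof (subst linear_injective_0[OF P_linear], intro allI impI)
    fix z assume "P z = 0"
    then have "D (point z 0) = 0"
      using point_parts(3)[of "D (point z 0)"] by (simp add: P_def Dw point_simps)
    then have "point z 0 = 0" using D'D[of "point z 0"] D'D[of 0] linear_0[OF linD] by metis
    then show "z = 0" by (metis point_parts(1) z_part_0)
  qed
  then have "bij P" using linear_injective_imp_surjective[OF P_linear _ refl] by (simp add: bij_def)
  have "t \<noteq> 0"
  proof
    assume "t = 0"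
    obtain \<zeta> where "D \<zeta> = point 0 1" using surj_D by (metis surjD)
    then have "w_part (D \<zeta>) = 1" by simp
    with \<open>t = 0\<close> show False using wD[of "z_part \<zeta>" "w_part \<zeta>"] by simp
  qed
  obtain r where r: "0 < r" "ball 0 r \<subseteq> U" using U(1,3) open_contains_ball by blast
  text \<open>The Schwarz lemma in the \<open>w\<close>-direction upgrades differentiability at the origin to
    \<open>o(\<bar>z\<bar>\<^sup>2)\<close> on the graph, where \<open>w = O(\<bar>z\<bar>\<^sup>2)\<close>.\<close>
  have schwarz: "((\<lambda>s. (w_part (F (x v s)) - w_part (F (point (s *\<^sub>R v) 0))) /\<^sub>R s\<^sup>2) \<longlongrightarrow> t * Q v) (at_right 0)" for v
  proof (rule Lim_transform)
    have id: "((\<lambda>s. (s *\<^sub>R v) /\<^sub>R s) \<longlongrightarrow> v) (at_right 0)"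
      by (rule tendsto_eventually) (auto simp: eventually_at_filter)
    have \<rho>_lim: "((\<lambda>s. \<rho> (s *\<^sub>R v) /\<^sub>R s\<^sup>2) \<longlongrightarrow> Q v) (at_right 0)"
      by (rule quadratic_part_limit[OF Q id])
    then show "((\<lambda>s. t * (\<rho> (s *\<^sub>R v) /\<^sub>R s\<^sup>2)) \<longlongrightarrow> t * Q v) (at_right 0)"
      by (intro tendsto_intros)
    show "((\<lambda>s. (w_part (F (x v s)) - w_part (F (point (s *\<^sub>R v) 0))) /\<^sub>R s\<^sup>2 - t * (\<rho> (s *\<^sub>R v) /\<^sub>R s\<^sup>2)) \<longlongrightarrow> 0) (at_right 0)"
    proof (rule tendstoI)
      fix e :: real assume "0 < e"
      define K where "K = norm (Q v) + 1"
      have K: "K \<ge> 1" by (simp add: K_def)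
      \<comment> \<open>Chosen so that the final Schwarz bound
        \<open>e' * (2 * norm v + 2) * (K * s\<^sup>2)\<close> equals
        \<open>e / 2 * s\<^sup>2\<close>.\<close>
      define e' where "e' = e / (2 * K * (2 * norm v + 2))"
      have e': "0 < e'" using \<open>0 < e\<close> K by (simp add: e'_def add_nonneg_pos)
      have "\<exists>d>0. \<forall>\<zeta>. norm \<zeta> < d \<longrightarrow> norm (F \<zeta> - D \<zeta>) \<le> e' * norm \<zeta>"
        using D e' F0 unfolding has_derivative_at_alt by force
      then obtain d where d: "0 < d" "\<And>\<zeta>. norm \<zeta> < d \<Longrightarrow> norm (F \<zeta> - D \<zeta>) \<le> e' * norm \<zeta>" by blast
      \<comment> \<open>Below \<open>1 / K\<close> the bound \<open>K * s\<^sup>2\<close> on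
        \<open>\<rho> (s v)\<close> is less than \<open>s\<close>, the radius of the disc used in
        the w-direction; the other term keeps that disc in \<open>U\<close> and where the derivative
        estimate holds.\<close>
      define d' where "d' = min (1 / K) (min d r / (norm v + 1))"
      have d': "0 < d'"
        using d(1) r(1) K by (auto simp: d'_def add_nonneg_pos)
      have "\<forall>\<^sub>F s in at_right 0. norm (\<rho> (s *\<^sub>R v) /\<^sub>R s\<^sup>2) < K"
        using tendsto_norm[OF \<rho>_lim] by (rule order_tendstoD) (simp add: K_def)
      moreover have "\<forall>\<^sub>F s in at_right (0::real). s < d'"
        using d' by (auto simp: eventually_at_right_field)
      ultimately show "\<forall>\<^sub>F s in at_right 0. dist ((w_part (F (x v s)) - w_part (F (point (s *\<^sub>R v) 0))) /\<^sub>R s\<^sup>2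
          - t * (\<rho> (s *\<^sub>R v) /\<^sub>R s\<^sup>2)) 0 < e"
        using eventually_at_right_less[of 0]
      proof eventually_elim
        case (elim s)
        have sK: "s * K < 1"
          using elim(2) K by (simp add: d'_def pos_less_divide_eq)
        have "s * (norm v + 1) < min d r"
          using elim(2) by (simp add: d'_def pos_less_divide_eq add_nonneg_pos)
        then have sd: "s * (norm v + 1) < d" and sr: "s * (norm v + 1) < r" by simp_all
        have \<rho>K: "norm (\<rho> (s *\<^sub>R v)) < K * s\<^sup>2"
          using elim by (simp add: field_simps)
        also have "\<dots> = (s * K) * s" by (simp add: power2_eq_square)
        also have "\<dots> < 1 * s" using sK elim by (intro mult_strict_right_mono) auto
        finally have \<rho>s: "norm (\<rho> (s *\<^sub>R v)) < s" by simp
        have pt: "norm (point (s *\<^sub>R v) \<sigma>) \<le> s * (norm v + 1)" if "norm \<sigma> < s" for \<sigma>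
          using norm_point_le[of "s *\<^sub>R v" \<sigma>] that elim by (simp add: algebra_simps)
        \<comment> \<open>\<open>h\<close> vanishes at 0 and is o(s) on the disc of radius
          \<open>s\<close>; at the point \<open>\<rho> (s v)\<close>, which is O(s^2), the Schwarz
          lemma gains a further factor \<open>s\<close>.\<close>
        define h where "h \<sigma> = w_part (F (point (s *\<^sub>R v) 0 + \<sigma> *s point 0 1)) - w_part (F (point (s *\<^sub>R v) 0)) - t * \<sigma>" for \<sigma>
        have line: "point (s *\<^sub>R v) 0 + \<sigma> *s point 0 1 = point (s *\<^sub>R v) \<sigma>" for \<sigma>
          by (simp add: vec_option_eq_iff)
        have "h holomorphic_on ball 0 s"
          unfolding h_def
        proof (intro holomorphic_intros holomorphic_on_complex_line[OF F])
          fix \<sigma> :: complex assume "\<sigma> \<in> ball 0 s"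
          then show "point (s *\<^sub>R v) 0 + \<sigma> *s point 0 1 \<in> U"
            unfolding line using pt[of \<sigma>] sr r(2) by auto
        qed
        moreover have "h 0 = 0" by (simp add: h_def)
        moreover have "norm (h \<sigma>) < e' * (s * (2 * norm v + 2))" if "norm \<sigma> < s" for \<sigma>
        proof -
          have approx: "norm (w_part (F (point (s *\<^sub>R v) \<tau>)) - t * \<tau>) \<le> e' * norm (point (s *\<^sub>R v) \<tau>)" if "norm \<tau> < s" for \<tau>
          proof -
            have "norm (w_part (F (point (s *\<^sub>R v) \<tau>)) - t * \<tau>) = norm ((F (point (s *\<^sub>R v) \<tau>) - D (point (s *\<^sub>R v) \<tau>)) $ None)"
              using wD[of "s *\<^sub>R v" \<tau>] by (simp add: w_part_def)
            also have "\<dots> \<le> norm (F (point (s *\<^sub>R v) \<tau>) - D (point (s *\<^sub>R v) \<tau>))"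
              by (rule Finite_Cartesian_Product.norm_nth_le)
            also have "\<dots> \<le> e' * norm (point (s *\<^sub>R v) \<tau>)"
              using pt[OF that] sd by (intro d(2)) linarith
            finally show ?thesis .
          qed
          have "norm (h \<sigma>) \<le> norm (w_part (F (point (s *\<^sub>R v) \<sigma>)) - t * \<sigma>) + norm (w_part (F (point (s *\<^sub>R v) 0)) - t * 0)"
            unfolding h_def line using norm_triangle_ineq4[of "w_part (F (point (s *\<^sub>R v) \<sigma>)) - t * \<sigma>" "w_part (F (point (s *\<^sub>R v) 0)) - t * 0"]
            by (simp add: algebra_simps)
          also have "\<dots> \<le> e' * norm (point (s *\<^sub>R v) \<sigma>) + e' * norm (point (s *\<^sub>R v) 0)"
            using elim that by (intro add_mono approx) auto
          also have "\<dots> < e' * (s * (norm v + 1)) + e' * (s * (norm v + 1))"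
          proof (rule add_le_less_mono)
            show "e' * norm (point (s *\<^sub>R v) \<sigma>) \<le> e' * (s * (norm v + 1))"
              using e' pt[OF that] by (intro mult_left_mono) auto
            have "norm (point (s *\<^sub>R v) 0) < s * (norm v + 1)"
              using norm_point_le[of "s *\<^sub>R v" 0] elim by (simp add: algebra_simps)
            then show "e' * norm (point (s *\<^sub>R v) 0) < e' * (s * (norm v + 1))"
              using e' by (intro mult_strict_left_mono) auto
          qed
          finally show ?thesis by (simp add: algebra_simps)
        qed
        ultimately have "norm (h (\<rho> (s *\<^sub>R v))) \<le> e' * (s * (2 * norm v + 2)) / s * norm (\<rho> (s *\<^sub>R v))"
          using \<rho>s by (rule Schwarz_rescaled)
        also have "\<dots> \<le> e' * (2 * norm v + 2) * (K * s\<^sup>2)"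
          using \<rho>K elim e' by (simp add: mult_left_mono)
        also have "\<dots> = e / 2 * s\<^sup>2"
          using K by (simp add: e'_def) (smt (verit) norm_ge_zero nonzero_mult_div_cancel_right)
        finally have "norm (h (\<rho> (s *\<^sub>R v))) / s\<^sup>2 \<le> e / 2"
          using elim by (simp add: field_simps)
        moreover have "norm (h (\<rho> (s *\<^sub>R v)) /\<^sub>R s\<^sup>2) = norm (h (\<rho> (s *\<^sub>R v))) / s\<^sup>2"
          by (simp add: divide_inverse_commute)
        ultimately have "norm (h (\<rho> (s *\<^sub>R v)) /\<^sub>R s\<^sup>2) < e"
          using \<open>0 < e\<close> by linarith
        moreover have "h (\<rho> (s *\<^sub>R v)) /\<^sub>R s\<^sup>2 = (w_part (F (x v s)) - w_part (F (point (s *\<^sub>R v) 0))) /\<^sub>R s\<^sup>2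
          - t * (\<rho> (s *\<^sub>R v) /\<^sub>R s\<^sup>2)"
          by (simp add: h_def line x_def scaleR_diff_right)
        ultimately show ?case by (simp add: dist_norm)
      qed
    qed
  qed
  \<comment> \<open>The contribution of \<open>w\<close> is removed. What remains is
    \<open>F\<close> on the complex subspace \<open>w = 0\<close>, where one-variable theory applies
    on each line.\<close>
  have flat: "((\<lambda>s. w_part (F (point (s *\<^sub>R v) 0)) /\<^sub>R s\<^sup>2) \<longlongrightarrow> Q' (P v) - t * Q v) (at_right 0)" for v
    using tendsto_diff[OF Fw[of v] schwarz[of v]] by (simp add: scaleR_diff_right)
  have "\<exists>c. \<forall>u. norm u = 1 \<longrightarrow> Q' (P (u *s z)) = t * Q (u *s z) + c * u\<^sup>2" for z
  proof -
    define g where "g \<tau> = w_part (F (0 + \<tau> *s point z 0))" for \<tau>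
    define r' where "r' = r / (norm z + 1)"
    have r': "0 < r'" using r(1) by (simp add: r'_def add_nonneg_pos)
    have line: "0 + \<tau> *s point z 0 = point (\<tau> *s z) 0" for \<tau>
      by (simp add: vec_option_eq_iff)
    have "g holomorphic_on ball 0 r'"
      unfolding g_def
    proof (rule holomorphic_on_complex_line[OF F])
      fix \<tau> :: complex assume "\<tau> \<in> ball 0 r'"
      then have "norm \<tau> * (norm z + 1) < r" by (simp add: r'_def pos_less_divide_eq add_nonneg_pos)
      moreover have "norm (\<tau> *s z) = norm \<tau> * norm z"
        by (simp add: norm_vec_def norm_mult L2_set_right_distrib[symmetric])
      ultimately have "norm (point (\<tau> *s z) 0) < r"
        using norm_point_le[of "\<tau> *s z" 0] by (simp add: algebra_simps) (smt (verit) norm_ge_zero)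
      then show "0 + \<tau> *s point z 0 \<in> U" unfolding line using r(2) by auto
    qed
    moreover have "g 0 = 0" by (simp add: g_def F0)
    moreover have "(g has_field_derivative 0) (at 0)"
    proof -
      have "bounded_linear (\<lambda>\<tau>. 0 + \<tau> *s point z 0)"
        by (simp add: linear_conv_bounded_linear[symmetric] linear_iff vec_option_eq_iff algebra_simps)
      then have "((\<lambda>\<tau>. 0 + \<tau> *s point z 0) has_derivative (\<lambda>\<tau>. 0 + \<tau> *s point z 0)) (at 0)"
        by (rule bounded_linear_imp_has_derivative)
      from has_derivative_compose[OF this, of F D] D
      have "(g has_derivative (\<lambda>\<tau>. w_part (D (0 + \<tau> *s point z 0)))) (at 0)"
        unfolding g_def by (intro bounded_linear.has_derivative[OF bounded_linear_w_part]) simp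
      then show ?thesis
        unfolding line Dw has_field_derivative_def by (rule has_derivative_eq_rhs) (simp add: fun_eq_iff)
    qed
    ultimately obtain c where c: "((\<lambda>\<tau>. g \<tau> / \<tau>\<^sup>2) \<longlongrightarrow> c) (at 0)"
      using double_zero_limit r' by metis
    have "Q' (P (u *s z)) = t * Q (u *s z) + c * u\<^sup>2" if u: "norm u = 1" for u
    proof -
      have "u \<noteq> 0" using u by auto
      have "filterlim (\<lambda>s. of_real s * u) (at 0) (at_right (0::real))"
        unfolding filterlim_at
        by (auto intro!: tendsto_eq_intros simp: eventually_at_filter \<open>u \<noteq> 0\<close>)
      then have "((\<lambda>s. g (of_real s * u) / (of_real s * u)\<^sup>2) \<longlongrightarrow> c) (at_right 0)"
        by (rule filterlim_compose[OF c])
      then have lim: "((\<lambda>s. u\<^sup>2 * (g (of_real s * u) / (of_real s * u)\<^sup>2)) \<longlongrightarrow> u\<^sup>2 * c) (at_right 0)"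
        by (intro tendsto_intros)
      \<comment> \<open>The real ray through \<open>u *s z\<close> is the ray through
        \<open>u\<close> in the parameter of the line, and rescaling by \<open>u\<^sup>2\<close>
        produces the term \<open>c * u\<^sup>2\<close>.\<close>
      have ray_eq: "u\<^sup>2 * (g (of_real s * u) / (of_real s * u)\<^sup>2) = w_part (F (point (s *\<^sub>R (u *s z)) 0)) /\<^sub>R s\<^sup>2" for s
      proof -
        have "(of_real s * u) *s z = s *\<^sub>R (u *s z)"
          by (simp add: vec_eq_iff scaleR_conv_of_real[where 'a = complex])
        then show ?thesis
          using \<open>u \<noteq> 0\<close> unfolding g_def line
          by (simp add: scaleR_conv_of_real[where 'a = complex] power_mult_distrib field_simps)
      qed
      from lim have "((\<lambda>s. w_part (F (point (s *\<^sub>R (u *s z)) 0)) /\<^sub>R s\<^sup>2) \<longlongrightarrow> u\<^sup>2 * c) (at_right 0)"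
        by (simp only: ray_eq)
      then have "u\<^sup>2 * c = Q' (P (u *s z)) - t * Q (u *s z)"
        by (rule tendsto_unique[OF trivial_limit_at_right_real _ flat])
      then show ?thesis by (simp add: mult.commute)
    qed
    then show ?thesis by blast
  qed
  then show ?thesis
    using that[OF P_linear \<open>bij P\<close> P_lin \<open>t \<noteq> 0\<close>] by blast
qed

section \<open>Separating the models\<close>

fun mixed_part :: "('n::finite) \<Rightarrow> 'n \<Rightarrow> model \<Rightarrow> complex ^ 'n \<Rightarrow> complex" where
  "mixed_part i1 i2 Form1 z = cnj (z $ i1) * z $ i2"
| "mixed_part i1 i2 Form2 z = cnj (z $ i1) * z $ i2"
| "mixed_part i1 i2 (Form3 a) z = cnj (z $ i1) * z $ i1"
| "mixed_part i1 i2 Form4 z = 0"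
| "mixed_part i1 i2 Form5 z = 0"

fun antiholomorphic_coeff :: "model \<Rightarrow> real" where
  "antiholomorphic_coeff Form1 = 1"
| "antiholomorphic_coeff Form2 = 0"
| "antiholomorphic_coeff (Form3 a) = a"
| "antiholomorphic_coeff Form4 = 1"
| "antiholomorphic_coeff Form5 = 0"

lemma model_quadric_split:
  "model_quadric i1 i2 f z = mixed_part i1 i2 f z + antiholomorphic_coeff f * cnj (z $ i1) ^ 2"
  by (cases f) (simp_all add: complex_norm_square mult.commute del: of_real_power)

text \<open>Under rotation by a unit scalar the mixed part has weight 0 and the antiholomorphic part
  weight -2, against weight 2 for the unknown holomorphic term.\<close>

lemma model_quadric_rotate:
  assumes "norm u = 1"
  shows "model_quadric i1 i2 f (u *s z) = mixed_part i1 i2 f z + cnj u ^ 2 * (antiholomorphic_coeff f * cnj (z $ i1) ^ 2)"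
proof -
  have "cnj u * u = 1" using assms complex_norm_square[of u] by (simp add: mult.commute)
  then have *: "cnj u * cnj x * (u * y) = cnj x * y" for x y
    by (metis (no_types, lifting) mult.assoc mult.left_commute mult_1)
  have "mixed_part i1 i2 f (u *s z) = mixed_part i1 i2 f z"
    by (cases f) (simp_all add: *)
  then show ?thesis
    by (simp add: model_quadric_split power_mult_distrib mult_ac)
qed

lemma real_quadratic_model_quadric:
  fixes i1 i2 :: "'n::finite"
  shows "real_quadratic (model_quadric i1 i2 f)"
proof -
  have "continuous_on UNIV (model_quadric i1 i2 f)"
    by (cases f) (auto simp: model_quadric_split[abs_def] intro!: continuous_intros)
  moreover have "model_quadric i1 i2 f (s *\<^sub>R z) = s\<^sup>2 *\<^sub>R model_quadric i1 i2 f z" for s z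
    by (cases f) (simp_all add: model_quadric_split scaleR_conv_of_real[where 'a = complex] power2_eq_square algebra_simps)
  ultimately show ?thesis by (simp add: real_quadratic_def)
qed

lemma real_quadratic_quadric: "real_quadratic (quadric A B C)"
proof -
  have "continuous_on UNIV (quadric A B C)"
    unfolding quadric_def[abs_def] sesquilinear_form_def quadratic_form_def
    by (intro continuous_intros)
  moreover have "quadric A B C (s *\<^sub>R z) = s\<^sup>2 *\<^sub>R quadric A B C z" for s z
    by (simp add: quadric_def sesquilinear_form_pairing quadratic_form_pairing matrix_vector_mult_scaleR_complex
        pairing_simps scaleR_conv_of_real[where 'a = complex] power2_eq_square algebra_simps)
  ultimately show ?thesis by (simp add: real_quadratic_def)
qed

text \<open>The relation splits by weights, so \<open>R\<close> carries the mixed and the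
  antiholomorphic part of \<open>g\<close> to \<open>t\<close> times those of \<open>f\<close>. The
  models differ in whether these parts vanish and whether the mixed part is definite; two instances
  of \<open>Form3\<close> are told apart by the ratio of the two coefficients.\<close>

lemma equivalent_models_eq:
  fixes i1 i2 :: "'n::finite" and R :: "complex ^ 'n \<Rightarrow> complex ^ 'n"
  assumes i: "i1 \<noteq> i2" and f: "f \<in> models" and g: "g \<in> models"
    and R: "surj R" and R_lin: "\<And>c z. R (c *s z) = c *s R z" and t: "t \<noteq> 0"
    and eq: "\<And>z. \<exists>c. \<forall>u. norm u = 1 \<longrightarrow> model_quadric i1 i2 g (R (u *s z)) = t * model_quadric i1 i2 f (u *s z) + c * u\<^sup>2"
  shows "f = g"
proof -
  define anti where "anti f z = complex_of_real (antiholomorphic_coeff f) * cnj (z $ i1) ^ 2" for f and z :: "complex ^ 'n"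
  have parts: "mixed_part i1 i2 g (R z) = t * mixed_part i1 i2 f z" "anti g (R z) = t * anti f z" for z
  proof -
    obtain c where "\<And>u. norm u = 1 \<Longrightarrow> model_quadric i1 i2 g (R (u *s z)) = t * model_quadric i1 i2 f (u *s z) + c * u\<^sup>2"
      using eq by blast
    then have c: "mixed_part i1 i2 g (R z) + cnj u ^ 2 * anti g (R z)
        = t * (mixed_part i1 i2 f z + cnj u ^ 2 * anti f z) + c * u\<^sup>2" if "norm u = 1" for u
      using that by (simp add: R_lin model_quadric_rotate anti_def)
    \<comment> \<open>Three rotations resolve the three weights: 1 and \<open>\<i>\<close> isolate
      the mixed part, and \<open>\<omega>\<close>, with \<open>\<omega>\<^sup>2 = \<i>\<close>,
      separates the antiholomorphic part from \<open>c\<close>.\<close>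
    define \<omega> where "\<omega> = csqrt \<i>"
    have \<omega>: "\<omega>\<^sup>2 = \<i>" unfolding \<omega>_def by (rule power2_csqrt)
    have "norm \<omega> ^ 2 = 1" by (metis \<omega> norm_power norm_ii)
    then have "norm \<omega> = 1" using norm_ge_zero[of \<omega>] by (simp add: power2_eq_1_iff)
    have "cnj \<omega> ^ 2 = - \<i>" by (metis \<omega> complex_cnj_power complex_cnj_i)
    with c[OF \<open>norm \<omega> = 1\<close>] \<omega>
    have 3: "mixed_part i1 i2 g (R z) - \<i> * anti g (R z) = t * (mixed_part i1 i2 f z - \<i> * anti f z) + c * \<i>"
      by simp
    have 1: "mixed_part i1 i2 g (R z) + anti g (R z) = t * (mixed_part i1 i2 f z + anti f z) + c"
      using c[of 1] by simp
    have 2: "mixed_part i1 i2 g (R z) - anti g (R z) = t * (mixed_part i1 i2 f z - anti f z) - c"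
      using c[of \<i>] by simp
    have "2 * mixed_part i1 i2 g (R z) = 2 * (t * mixed_part i1 i2 f z)"
      using arg_cong2[OF 1 2, of "(+)"] by (simp add: algebra_simps)
    then show m: "mixed_part i1 i2 g (R z) = t * mixed_part i1 i2 f z" by simp
    have "anti g (R z) = t * anti f z + c" using 1 by (simp add: m algebra_simps)
    moreover have "\<i> * anti g (R z) = \<i> * (t * anti f z - c)" using 3 by (simp add: m algebra_simps)
    then have "anti g (R z) = t * anti f z - c" by (subst (asm) mult_cancel_left) simp
    ultimately have "2 * anti g (R z) = 2 * (t * anti f z)" by simp
    then show "anti g (R z) = t * anti f z" by simp
  qed
  let ?no_mixed = "\<lambda>f. \<forall>z. mixed_part i1 i2 f z = 0"
  let ?no_anti = "\<lambda>f. \<forall>z. anti f z = 0"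
  \<comment> \<open>Indefiniteness in a form that survives multiplication by a complex
    \<open>t\<close>: a squared modulus never takes two opposite nonzero values, whereas
    \<open>cnj (z $ i1) * z $ i2\<close> does. It separates \<open>Form3\<close> from
    \<open>Form1\<close> and \<open>Form2\<close>.\<close>
  let ?sign = "\<lambda>f. \<exists>z z'. mixed_part i1 i2 f z \<noteq> 0 \<and> mixed_part i1 i2 f z' = - mixed_part i1 i2 f z"
  have 1: "?no_mixed g \<longleftrightarrow> ?no_mixed f" and 2: "?no_anti g \<longleftrightarrow> ?no_anti f"
    using parts t R by (metis mult_eq_0_iff surjD)+
  have 3: "?sign g \<longleftrightarrow> ?sign f"
  proof
    assume "?sign g"
    then obtain z z' where "mixed_part i1 i2 g (R z) \<noteq> 0" "mixed_part i1 i2 g (R z') = - mixed_part i1 i2 g (R z)"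
      using R by (metis surjD)
    then have "mixed_part i1 i2 f z \<noteq> 0" "t * mixed_part i1 i2 f z' = t * (- mixed_part i1 i2 f z)"
      by (simp_all add: parts)
    then show "?sign f" using t by (metis mult_cancel_left)
  next
    assume "?sign f"
    then show "?sign g" using t by (metis parts(1) mult_eq_0_iff mult_minus_right)
  qed
  let ?e = "axis i1 1 + axis i2 1 :: complex ^ 'n" and ?e' = "axis i1 1 - axis i2 1 :: complex ^ 'n"
  have e: "?e $ i1 = 1" "?e $ i2 = 1" "?e' $ i1 = 1" "?e' $ i2 = -1"
    using i by (simp_all add: axis_def)
  have no_mixed: "?no_mixed h \<longleftrightarrow> h = Form4 \<or> h = Form5" for h
    using e by (cases h) (auto intro: exI[of _ ?e])
  have no_anti: "?no_anti h \<longleftrightarrow> antiholomorphic_coeff h = 0" for h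
  proof
    assume "?no_anti h"
    then have "anti h ?e = 0" by blast
    then show "antiholomorphic_coeff h = 0" unfolding anti_def e by simp
  qed (simp add: anti_def)
  have sign: "?sign h \<longleftrightarrow> h = Form1 \<or> h = Form2" for h
  proof (cases h)
    case (Form3 a)
    have "z = 0" if "cnj y * y = - (cnj z * z)" for y z :: complex
    proof -
      have "cnj y * y + cnj z * z = 0" using that by simp
      then have "complex_of_real ((cmod y)\<^sup>2 + (cmod z)\<^sup>2) = 0"
        by (simp add: complex_norm_square mult.commute del: of_real_power)
      then have "(cmod y)\<^sup>2 + (cmod z)\<^sup>2 = 0" by (simp only: of_real_eq_0_iff)
      then show ?thesis by (simp add: sum_power2_eq_zero_iff)
    qed
    then show ?thesis by (auto simp: Form3)
  next
    case Form1
    have "mixed_part i1 i2 h ?e \<noteq> 0 \<and> mixed_part i1 i2 h ?e' = - mixed_part i1 i2 h ?e"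
      unfolding Form1 mixed_part.simps e by simp
    then show ?thesis using Form1 by blast
  next
    case Form2
    have "mixed_part i1 i2 h ?e \<noteq> 0 \<and> mixed_part i1 i2 h ?e' = - mixed_part i1 i2 h ?e"
      unfolding Form2 mixed_part.simps e by simp
    then show ?thesis using Form2 by blast
  qed simp_all
  show ?thesis
  proof (cases "\<exists>a b. f = Form3 a \<and> g = Form3 b")
    case True
    then obtain a b where ab: "f = Form3 a" "g = Form3 b" by blast
    then have nonneg: "a \<ge> 0" "b \<ge> 0" using f g by (auto simp: models_def)
    \<comment> \<open>At the first axis the mixed part gives \<open>norm t = norm ?y ^ 2\<close> and
      the antiholomorphic part \<open>b * norm ?y ^ 2 = norm t * a\<close>, whence
      \<open>a = b\<close>.\<close>
    let ?y = "R (axis i1 1) $ i1"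
    have "cnj ?y * ?y = t" using parts(1)[of "axis i1 1"] by (simp add: ab axis_def)
    then have "norm t = norm ?y ^ 2" by (metis complex_mod_cnj norm_mult power2_eq_square)
    moreover have "b * norm ?y ^ 2 = norm t * a"
      using arg_cong[OF parts(2)[of "axis i1 1"], of norm] nonneg
      by (simp add: ab anti_def axis_def norm_mult norm_power)
    ultimately have "b * norm t = a * norm t" by simp
    then show ?thesis using t ab by simp
  next
    case False
    then show ?thesis
      using 1 2 3 unfolding no_mixed no_anti sign by (cases f; cases g) auto
  qed
qed

text \<open>The two biholomorphisms are not composed. Each is first reduced to a linear map and a
  scalar relative to the same \<open>quadric A B C\<close>, and only these data are composed, as
  \<open>P' \<circ> inv P\<close> and \<open>t' / t\<close>.\<close>

lemma model_unique:
  fixes M :: "(complex ^ ('n::finite) option) set"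
  assumes i: "i1 \<noteq> i2" and graph: "graph_near_0 M \<rho>" and O3: "O3 (\<lambda>z. \<rho> z - quadric A B C z)"
    and f: "f \<in> models" "has_form i1 i2 f Mf" "biholomorphic_near_0 M Mf"
    and g: "g \<in> models" "has_form i1 i2 g Mg" "biholomorphic_near_0 M Mg"
  shows "f = g"
proof -
  let ?Q = "quadric A B C"
  have normal: "\<exists>P t. bij P \<and> (\<forall>c z. P (c *s z) = c *s P z) \<and> t \<noteq> 0 \<and>
      (\<forall>z. \<exists>c. \<forall>u. norm u = 1 \<longrightarrow> model_quadric i1 i2 h (P (u *s z)) = t * ?Q (u *s z) + c * u\<^sup>2)"
    if form: "has_form i1 i2 h N" and biholo: "biholomorphic_near_0 M N" for h N
  proof -
    obtain W where W: "open W" "0 \<in> W" "M \<inter> W = {\<zeta> \<in> W. w_part \<zeta> = \<rho> (z_part \<zeta>)}"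
      using graph unfolding graph_near_0_def by blast
    obtain \<rho>' where graph': "graph_near_0 N \<rho>'" and O3': "O3 (\<lambda>z. \<rho>' z - model_quadric i1 i2 h z)"
      using form unfolding has_form_def by blast
    obtain W' where W': "open W'" "0 \<in> W'" "N \<inter> W' = {\<zeta> \<in> W'. w_part \<zeta> = \<rho>' (z_part \<zeta>)}"
      using graph' unfolding graph_near_0_def by blast
    obtain P t where "bij P" "\<And>c z. P (c *s z) = c *s P z" "t \<noteq> 0"
      "\<And>z. \<exists>c. \<forall>u. norm u = 1 \<longrightarrow> model_quadric i1 i2 h (P (u *s z)) = t * ?Q (u *s z) + c * u\<^sup>2"
      using biholomorphic_quadratic_parts[OF W W' real_quadratic_quadric O3 real_quadratic_model_quadric O3' biholo]
      by metis
    then show ?thesis by blast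
  qed
  obtain P t where P: "bij P" "\<forall>c z. P (c *s z) = c *s P z" "t \<noteq> 0"
    "\<forall>z. \<exists>c. \<forall>u. norm u = 1 \<longrightarrow> model_quadric i1 i2 f (P (u *s z)) = t * ?Q (u *s z) + c * u\<^sup>2"
    using normal[OF f(2,3)] by blast
  obtain P' t' where P': "bij P'" "\<forall>c z. P' (c *s z) = c *s P' z" "t' \<noteq> 0"
    "\<forall>z. \<exists>c. \<forall>u. norm u = 1 \<longrightarrow> model_quadric i1 i2 g (P' (u *s z)) = t' * ?Q (u *s z) + c * u\<^sup>2"
    using normal[OF g(2,3)] by blast
  define R where "R = P' \<circ> inv P"
  have PinvP: "P (inv P y) = y" for y using P(1) by (simp add: bij_is_surj surj_f_inv_f)
  have inv_lin: "inv P (c *s y) = c *s inv P y" for c y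
    using P(1,2) PinvP by (metis bij_inv_eq_iff)
  show ?thesis
  proof (rule equivalent_models_eq[OF i f(1) g(1), of R "t' / t"])
    show "surj R" unfolding R_def by (intro comp_surj bij_is_surj bij_imp_bij_inv P(1) P'(1))
    show "R (c *s y) = c *s R y" for c y using P'(2) by (simp add: R_def inv_lin)
    show "t' / t \<noteq> 0" using P(3) P'(3) by simp
    fix y
    obtain c where c: "\<And>u. norm u = 1 \<Longrightarrow> model_quadric i1 i2 f (P (u *s inv P y)) = t * ?Q (u *s inv P y) + c * u\<^sup>2"
      using P(4) by blast
    obtain c' where c': "\<And>u. norm u = 1 \<Longrightarrow> model_quadric i1 i2 g (P' (u *s inv P y)) = t' * ?Q (u *s inv P y) + c' * u\<^sup>2"
      using P'(4) by blast
    have "model_quadric i1 i2 g (R (u *s y)) = t' / t * model_quadric i1 i2 f (u *s y) + (c' - t' / t * c) * u\<^sup>2"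
      if "norm u = 1" for u
    proof -
      have "model_quadric i1 i2 f (u *s y) = t * ?Q (u *s inv P y) + c * u\<^sup>2"
        using c[OF that] P(2) by (simp add: PinvP)
      then show ?thesis
        using c'[OF that] P(3) by (simp add: R_def inv_lin field_simps)
    qed
    then show "\<exists>c. \<forall>u. norm u = 1 \<longrightarrow>
        model_quadric i1 i2 g (R (u *s y)) = t' / t * model_quadric i1 i2 f (u *s y) + c * u\<^sup>2" by blast
  qed
qed

section \<open>The models are CR images\<close>

text \<open>Each model has antiholomorphic gradient \<open>(h, 0, \<dots>, 0)\<close> and holomorphic gradient a fixed
  multiple of the conjugate of the first coordinate, so the coordinate directions other than the first
  span the required bundle.\<close>

fun model_gradient :: "('n::finite) \<Rightarrow> 'n \<Rightarrow> model \<Rightarrow> complex ^ 'n" where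
  "model_gradient i1 i2 Form1 = axis i2 1"
| "model_gradient i1 i2 Form2 = axis i2 1"
| "model_gradient i1 i2 (Form3 a) = axis i1 1"
| "model_gradient i1 i2 Form4 = 0"
| "model_gradient i1 i2 Form5 = 0"

fun model_bar_derivative :: "('n::finite) \<Rightarrow> 'n \<Rightarrow> model \<Rightarrow> complex ^ 'n \<Rightarrow> complex" where
  "model_bar_derivative i1 i2 Form1 z = z $ i2 + 2 * cnj (z $ i1)"
| "model_bar_derivative i1 i2 Form2 z = z $ i2"
| "model_bar_derivative i1 i2 (Form3 a) z = z $ i1 + 2 * of_real a * cnj (z $ i1)"
| "model_bar_derivative i1 i2 Form4 z = 2 * cnj (z $ i1)"
| "model_bar_derivative i1 i2 Form5 z = 0"

lemma model_quadric_has_derivative: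
  "(model_quadric i1 i2 f has_derivative
     (\<lambda>v. pairing (cnj (z $ i1) *s model_gradient i1 i2 f) v +
          pairing (model_bar_derivative i1 i2 f z *s axis i1 1) (vcnj v))) (at z)"
proof -
  have nth: "((\<lambda>z :: complex ^ 'a. z $ j) has_derivative (\<lambda>v. v $ j)) (at z)" for j
    by (rule bounded_linear_imp_has_derivative[OF bounded_linear_vec_nth])
  have cnj_nth: "((\<lambda>z :: complex ^ 'a. cnj (z $ j)) has_derivative (\<lambda>v. cnj (v $ j))) (at z)" for j
    by (rule bounded_linear.has_derivative[OF bounded_linear_cnj nth])
  have axis: "pairing (axis j 1) v = v $ j" for j and v :: "complex ^ 'a"
    by (simp add: pairing_commute[of "axis j 1"] pairing_simps)
  let ?h = "model_bar_derivative i1 i2 f z" and ?c = "complex_of_real (antiholomorphic_coeff f)"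
  have d: "((\<lambda>z :: complex ^ 'a. cnj (z $ i) * z $ j) has_derivative
      (\<lambda>v. cnj (z $ i) * v $ j + cnj (v $ i) * z $ j)) (at z)" for i j
    by (rule has_derivative_mult[OF cnj_nth nth])
  have mixed: "(mixed_part i1 i2 f has_derivative
      (\<lambda>v. cnj (z $ i1) * pairing (model_gradient i1 i2 f) v + (?h - 2 * ?c * cnj (z $ i1)) * cnj (v $ i1))) (at z)"
    using d[of i1 i2] d[of i1 i1]
    by (cases f) (simp_all add: mixed_part.simps[abs_def] axis pairing_simps mult.commute)
  have "((\<lambda>z. ?c * cnj (z $ i1) ^ 2) has_derivative (\<lambda>v. 2 * ?c * cnj (z $ i1) * cnj (v $ i1))) (at z)"
    unfolding power2_eq_square
    by (rule has_derivative_eq_rhs[OF has_derivative_mult_right[OF has_derivative_mult[OF cnj_nth cnj_nth]]])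
       (simp add: fun_eq_iff algebra_simps)
  from has_derivative_add[OF mixed this] show ?thesis
    unfolding model_quadric_split[abs_def]
    by (rule has_derivative_eq_rhs) (simp add: fun_eq_iff pairing_simps axis algebra_simps)
qed

lemma real_analytic_on_model_quadric:
  "real_analytic_on (model_quadric i1 i2 f) U"
proof -
  have "real_analytic_on (mixed_part i1 i2 f) U"
    by (cases f) (auto intro!: real_analytic_on_mult real_analytic_on_nth real_analytic_on_cnj_nth real_analytic_on_const
        simp: mixed_part.simps[abs_def])
  then show ?thesis
    unfolding model_quadric_split[abs_def] power2_eq_square
    by (intro real_analytic_on_add real_analytic_on_mult real_analytic_on_const real_analytic_on_cnj_nth)
qed

lemma independent_axes: "vec.independent ((\<lambda>j. axis j 1 :: complex ^ 'n) ` J)"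
  by (rule vec.independent_mono[OF independent_cart_basis]) (auto simp: cart_basis_def)

text \<open>The derivative is real linear in \<open>z\<close>, so it leaves 0 at once along a
  direction on which it does not vanish; for \<open>Form3\<close> its value at the first axis is
  \<open>1 + 2 * a\<close>, positive as \<open>a \<ge> 0\<close>. Zeros of the gradient are
  therefore not CR points.\<close>

lemma model_bar_derivative_nonzero_nearby:
  assumes "i1 \<noteq> i2" "f \<in> models" "f \<noteq> Form5" "model_bar_derivative i1 i2 f z = 0"
  obtains y where "\<And>s :: real. s > 0 \<Longrightarrow> model_bar_derivative i1 i2 f (z + s *\<^sub>R y) \<noteq> 0"
proof -
  have add: "model_bar_derivative i1 i2 f (z + s *\<^sub>R y) = s *\<^sub>R model_bar_derivative i1 i2 f y" for s y
  proof -
    have "model_bar_derivative i1 i2 f (z + s *\<^sub>R y) = model_bar_derivative i1 i2 f z + s *\<^sub>R model_bar_derivative i1 i2 f y"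
      by (cases f) (simp_all add: algebra_simps scaleR_conv_of_real[where 'a = complex])
    then show ?thesis by (simp add: assms(4))
  qed
  have "model_bar_derivative i1 i2 f (if f = Form1 \<or> f = Form2 then axis i2 1 else axis i1 1) \<noteq> 0"
  proof (cases f)
    case (Form3 a)
    then have "a \<ge> 0" using assms(2) by (auto simp: models_def)
    then have "complex_of_real (1 + 2 * a) \<noteq> 0" by (simp only: of_real_eq_0_iff)
    then show ?thesis using Form3 by (simp add: axis_def)
  qed (use assms in \<open>auto simp: axis_def\<close>)
  then show ?thesis using that add by simp
qed

text \<open>The graph of the quadric itself serves as the example; it is defined over the whole
  space and has a global frame.\<close>

lemma model_CR_image:
  fixes i1 i2 :: "'n::finite"
  assumes i: "i1 \<noteq> i2" and f: "f \<in> models"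
  shows "\<exists>M :: (complex ^ 'n option) set. has_form i1 i2 f M \<and> CR_image M"
proof (intro exI conjI)
  let ?\<rho> = "model_quadric i1 i2 f"
  let ?M = "{\<zeta> :: complex ^ 'n option. z_part \<zeta> \<in> UNIV \<and> w_part \<zeta> = ?\<rho> (z_part \<zeta>)}"
  have graph: "graph_near_0 ?M ?\<rho>"
    by (rule graph_near_0I[OF open_UNIV UNIV_I real_analytic_on_model_quadric])
  moreover have "O3 (\<lambda>z. ?\<rho> z - ?\<rho> z)"
    by (rule O3_I[of 1 _ 0]) simp_all
  ultimately show "has_form i1 i2 f ?M" unfolding has_form_def by blast
  \<comment> \<open>For \<open>Form5\<close> the graph is a complex hyperplane with full (0,1)
    spaces; otherwise the generic dimension is n - 1.\<close>
  define J where "J = (if f = Form5 then UNIV else UNIV - {i1})"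
  define a where "a z = cnj (z $ i1) *s model_gradient i1 i2 f" for z
  define b where "b z = model_bar_derivative i1 i2 f z *s axis i1 (1 :: complex)" for z
  have b_eq_0: "b z = 0 \<longleftrightarrow> model_bar_derivative i1 i2 f z = 0" for z
    by (auto simp: b_def vec_eq_iff axis_def)
  have pairing_b: "pairing (b z) u = model_bar_derivative i1 i2 f z * u $ i1" for z u
    by (simp add: b_def pairing_commute[of _ u] pairing_simps)
  have M_UNIV: "?M \<inter> UNIV = {\<zeta> \<in> UNIV. w_part \<zeta> = ?\<rho> (z_part \<zeta>)}" by simp
  have deriv: "(?\<rho> has_derivative (\<lambda>v. pairing (a z) v + pairing (b z) (vcnj v))) (at z)" for z
    unfolding a_def b_def by (rule model_quadric_has_derivative)
  have T01_eq: "T01 ?M \<zeta> = cr_vector (a (z_part \<zeta>)) ` {u. pairing (b (z_part \<zeta>)) u = 0}"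
    and dim_eq: "vec.dim (T01 ?M \<zeta>) + (if b (z_part \<zeta>) = 0 then 0 else 1) = CARD('n)" if "\<zeta> \<in> ?M" for \<zeta>
    using T01_graph[OF open_UNIV M_UNIV _ deriv] dim_T01_graph[OF open_UNIV M_UNIV _ deriv] that by auto
  define V where "V \<zeta> = vec.span ((\<lambda>j. cr_vector (a (z_part \<zeta>)) (axis j 1)) ` J)" for \<zeta>
  have V_eq: "V \<zeta> = cr_vector (a (z_part \<zeta>)) ` {u. \<forall>j. j \<notin> J \<longrightarrow> u $ j = 0}" for \<zeta>
  proof -
    have "vec.span ((\<lambda>j. axis j 1) ` J) = {u :: complex ^ 'n. \<forall>j. j \<notin> J \<longrightarrow> u $ j = 0}"
    proof (intro equalityI subsetI)
      have "vec.subspace {u :: complex ^ 'n. \<forall>j. j \<notin> J \<longrightarrow> u $ j = 0}"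
        by (auto simp: vec.subspace_def)
      then have "vec.span ((\<lambda>j. axis j 1) ` J) \<subseteq> {u :: complex ^ 'n. \<forall>j. j \<notin> J \<longrightarrow> u $ j = 0}"
        by (intro vec.span_minimal) (auto simp: axis_def)
      then show "u \<in> {u. \<forall>j. j \<notin> J \<longrightarrow> u $ j = 0}" if "u \<in> vec.span ((\<lambda>j. axis j 1) ` J)" for u :: "complex ^ 'n"
        using that by blast
      fix u :: "complex ^ 'n" assume "u \<in> {u. \<forall>j. j \<notin> J \<longrightarrow> u $ j = 0}"
      then have "u = (\<Sum>j\<in>J. u $ j *s axis j 1)"
        by (auto simp: vec_eq_iff axis_def if_distrib sum.delta cong: if_cong)
      also have "\<dots> \<in> vec.span ((\<lambda>j. axis j 1) ` J)"
        by (intro vec.span_sum vec.span_scale vec.span_base) auto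
      finally show "u \<in> vec.span ((\<lambda>j. axis j 1) ` J)" .
    qed
    then show ?thesis
      unfolding V_def using vec.linear_span_image[OF linear_cr_vector, of "a (z_part \<zeta>)" "(\<lambda>j. axis j 1) ` J"]
      by (simp add: image_image)
  qed
  have "V \<zeta> \<subseteq> T01 ?M \<zeta>" if "\<zeta> \<in> ?M" for \<zeta>
    unfolding V_eq T01_eq[OF that]
    by (rule image_mono) (auto simp: pairing_b J_def split: if_splits)
  then have "V \<zeta> \<subseteq> complexified_tangent_space ?M \<zeta>" if "\<zeta> \<in> ?M" for \<zeta>
    using that by (auto simp: T01_def)
  moreover have "\<exists>W k. \<exists>s :: nat \<Rightarrow> complex ^ 'n option \<Rightarrow> complex ^ ('n option + 'n option).
        open W \<and> p \<in> W \<and> (\<forall>i<k. real_analytic_on (s i) W) \<and>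
        (\<forall>q\<in>?M \<inter> W. inj_on (\<lambda>i. s i q) {..<k} \<and>
                   vec.independent ((\<lambda>i. s i q) ` {..<k}) \<and>
                   V q = vec.span ((\<lambda>i. s i q) ` {..<k}))" for p
  proof -
    obtain e where e: "bij_betw e {..<card J} J"
      using finite_same_card_bij[of "{..<card J}" J] by auto
    define s where "s i \<zeta> = cr_vector (a (z_part \<zeta>)) (axis (e i) 1)" for i \<zeta>
    have analytic: "real_analytic_on (s i) UNIV" for i
    proof (rule real_analytic_on_vec)
      fix k :: "'n option + 'n option"
      \<comment> \<open>The w-bar component of the frame pairs with the conjugated holomorphic
        gradient and is thus \<open>\<zeta> $ Some i1\<close> times a constant; all other components
        are constant.\<close>
      have "real_analytic_on (\<lambda>\<zeta> :: complex ^ 'n option. \<zeta> $ Some i1 * cnj (model_gradient i1 i2 f $ e i)) UNIV"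
        by (intro real_analytic_on_mult real_analytic_on_nth real_analytic_on_const)
      then show "real_analytic_on (\<lambda>\<zeta>. s i \<zeta> $ k) UNIV"
        by (cases k; rename_tac l; case_tac l)
           (simp_all add: s_def a_def pairing_simps real_analytic_on_const)
    qed
    have image: "(\<lambda>i. s i q) ` {..<card J} = cr_vector (a (z_part q)) ` (\<lambda>j. axis j 1) ` J" for q
    proof -
      have "(\<lambda>i. s i q) ` {..<card J} = cr_vector (a (z_part q)) ` (\<lambda>j. axis j 1) ` e ` {..<card J}"
        by (simp add: s_def image_image)
      then show ?thesis by (simp only: bij_betw_imp_surj_on[OF e])
    qed
    have "inj_on (\<lambda>i. s i q) {..<card J}" for q
    proof (rule inj_onI)
      fix i j assume ij: "i \<in> {..<card J}" "j \<in> {..<card J}" and "s i q = s j q"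
      then have "axis (e i) (1 :: complex) = axis (e j) 1"
        using inj_cr_vector[of "a (z_part q)"] by (auto simp: s_def dest: injD)
      then have "e i = e j" by (simp add: axis_eq_axis)
      then show "i = j" using ij bij_betw_imp_inj_on[OF e] by (auto dest: inj_onD)
    qed
    moreover have "vec.independent ((\<lambda>i. s i q) ` {..<card J})" for q
      unfolding image
      by (rule vec.linear_independent_injective_image[OF linear_cr_vector independent_axes
            inj_on_subset[OF inj_cr_vector]]) simp
    moreover have "V q = vec.span ((\<lambda>i. s i q) ` {..<card J})" for q
      unfolding image V_def by (simp add: image_image)
    ultimately show ?thesis
      using analytic by (intro exI[of _ UNIV] exI[of _ "card J"] exI[of _ s]) auto
  qed
  ultimately have "real_analytic_subbundle ?M V"
    unfolding real_analytic_subbundle_def by blast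
  moreover have "V p = T01 ?M p" if p: "p \<in> CR_points ?M" for p
  proof -
    have pM: "p \<in> ?M" using p by (auto simp: CR_points_def)
    show ?thesis
    proof (cases "f = Form5")
      case True
      then show ?thesis
        unfolding V_eq T01_eq[OF pM] by (simp add: pairing_b J_def)
    next
      case False
      \<comment> \<open>At a zero of the gradient the dimension is n, while at points arbitrarily
        near it is n - 1, so \<open>p\<close> would not be a CR point.\<close>
      have "model_bar_derivative i1 i2 f (z_part p) \<noteq> 0"
      proof
        assume 0: "model_bar_derivative i1 i2 f (z_part p) = 0"
        obtain y where y: "\<And>s :: real. s > 0 \<Longrightarrow> model_bar_derivative i1 i2 f (z_part p + s *\<^sub>R y) \<noteq> 0"
          using model_bar_derivative_nonzero_nearby[OF i f False 0] by metis
        obtain W where W: "open W" "p \<in> W" "\<And>q. q \<in> ?M \<inter> W \<Longrightarrow> vec.dim (T01 ?M q) = vec.dim (T01 ?M p)"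
          using p unfolding CR_points_def by blast
        define q where "q s = point (z_part p + s *\<^sub>R y) (?\<rho> (z_part p + s *\<^sub>R y))" for s :: real
        have "((\<lambda>s. z_part p + s *\<^sub>R y) \<longlongrightarrow> z_part p) (at_right 0)"
          by (auto intro!: tendsto_eq_intros)
        moreover from this have "((\<lambda>s. ?\<rho> (z_part p + s *\<^sub>R y)) \<longlongrightarrow> ?\<rho> (z_part p)) (at_right 0)"
          by (rule isCont_tendsto_compose[OF has_derivative_continuous[OF deriv]])
        ultimately have "(q \<longlongrightarrow> point (z_part p) (?\<rho> (z_part p))) (at_right 0)"
          unfolding q_def using bounded_linear.tendsto[OF bounded_linear_point tendsto_Pair] by fastforce
        moreover have "point (z_part p) (?\<rho> (z_part p)) = p"
          using pM point_parts(3)[of p] by simp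
        ultimately have "\<forall>\<^sub>F s in at_right 0. q s \<in> W"
          using W(1,2) by (metis topological_tendstoD)
        then have "\<forall>\<^sub>F s in at_right 0. q s \<in> W \<and> s > 0"
          using eventually_at_right_less[of 0] by (rule eventually_conj)
        then obtain s where s: "q s \<in> W" "s > 0"
          using eventually_happens'[OF trivial_limit_at_right_real] by blast
        have qM: "q s \<in> ?M" by (simp add: q_def)
        have "b (z_part (q s)) \<noteq> 0" using y[OF s(2)] by (simp add: b_eq_0 q_def)
        moreover have "b (z_part p) = 0" using 0 by (simp add: b_eq_0)
        ultimately show False
          using dim_eq[OF qM] dim_eq[OF pM] W(3)[of "q s"] qM s(1) by simp
      qed
      then show ?thesis
        unfolding V_eq T01_eq[OF pM] using False by (auto simp: pairing_b J_def)
    qed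
  qed
  ultimately show "CR_image ?M"
    unfolding CR_image_def using graph unfolding graph_near_0_def by blast
qed

theorem corollary7p2:
  fixes i1 i2 :: "'n::finite"
  assumes "CARD('n) \<ge> 2" and "i1 \<noteq> i2"
  shows
    "(\<forall>(M :: (complex ^ 'n option) set) \<rho> E (A :: complex ^ 'n ^ 'n) B C.
        graph_near_0 M \<rho> \<longrightarrow>
        (\<forall>\<^sub>F z in nhds 0. \<rho> z =
           sesquilinear_form A z + cnj (quadratic_form B z) + quadratic_form C z + E z) \<longrightarrow>
        transpose B = B \<longrightarrow> transpose C = C \<longrightarrow> O3 E \<longrightarrow>
        CR_image M \<longrightarrow>
          rank (stack (conj_transpose A) B) \<le> 1 \<and>
          (\<exists>!f. f \<in> models \<and> (\<exists>M'. has_form i1 i2 f M' \<and> biholomorphic_near_0 M M'))) \<and>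
     (\<forall>f \<in> models. \<exists>M :: (complex ^ 'n option) set. has_form i1 i2 f M \<and> CR_image M)"
proof (intro conjI allI impI ballI)
  fix M :: "(complex ^ 'n option) set" and \<rho> E and A B C :: "complex ^ 'n ^ 'n"
  assume graph: "graph_near_0 M \<rho>"
    and expansion: "\<forall>\<^sub>F z in nhds 0. \<rho> z =
           sesquilinear_form A z + cnj (quadratic_form B z) + quadratic_form C z + E z"
    and B: "transpose B = B" and "transpose C = C" and E: "O3 E" and "CR_image M"
  have ev: "\<forall>\<^sub>F z in nhds 0. \<rho> z = quadric A B C z + E z"
    using expansion by (simp add: quadric_def)
  show rank: "rank (stack (conj_transpose A) B) \<le> 1"
    by (rule CR_image_rank_le_1[OF graph B ev E \<open>CR_image M\<close>])
  obtain l m b where Q: "\<And>z. quadric A B C z = cnj (pairing l z) * pairing m z + b * cnj (pairing l z) ^ 2 + quadratic_form C z"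
    using rank_le_1_factorization[OF rank B] by metis
  obtain P :: "complex ^ 'n ^ 'n" and t f where P: "invertible P" "t \<noteq> 0" and f: "f \<in> models"
    and normal: "\<And>z. t * (cnj (pairing l z) * pairing m z + b * cnj (pairing l z) ^ 2) = model_quadric i1 i2 f (P *v z)"
    using model_normal_form[OF assms] by metis
  \<comment> \<open>A shear with coefficient matrix \<open>- C\<close> cancels the holomorphic term,
    which the normal form leaves aside.\<close>
  have "quadratic_form (- C) z = - quadratic_form C z" for z
    by (simp add: quadratic_form_def sum_negf)
  then have "t * (quadric A B C z + quadratic_form (- C) z) = model_quadric i1 i2 f (P *v z)" for z
    by (simp add: Q normal[symmetric])
  from equivalent_to_model[OF graph ev E P this]
  have ex: "\<exists>M'. has_form i1 i2 f M' \<and> biholomorphic_near_0 M M'" .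
  have O3: "O3 (\<lambda>z. \<rho> z - quadric A B C z)"
  proof -
    have "\<forall>\<^sub>F z in nhds 0. \<rho> z - quadric A B C z = E z"
      using ev by (rule eventually_mono) simp
    then show ?thesis using E unfolding O3_def by (simp only: landau_o.big.in_cong)
  qed
  show "\<exists>!f. f \<in> models \<and> (\<exists>M'. has_form i1 i2 f M' \<and> biholomorphic_near_0 M M')"
    using f ex model_unique[OF assms(2) graph O3] by blast
next
  fix f assume "f \<in> models"
  then show "\<exists>M :: (complex ^ 'n option) set. has_form i1 i2 f M \<and> CR_image M"
    by (rule model_CR_image[OF assms(2)])
qed

end
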